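(* Let $N\ge1$ and let $f\in C^1([0,\infty))\cap C^2((0,\infty))$ satisfy $f(0)=0$, and $f(u)>0$, $f'(u)>0$, $f''(u)>0$ for all $u>0$, and $\int_u^\infty \frac{ds}{f(s)}<\infty$ for all $u>0$, and $$f(u)=\exp\left(-\frac1u\right)\qquad\text{for } u\in(0,1).$$ For $c>0$ define a nonnegative initial function $$u_0(x)=\frac{1}{\log\Bigl[c^{-1}(|x|^2+1)\{\log(|x|+e)\}^2+1\Bigr]},\qquad x\in\mathbb{R}^N,$$ and consider the problem $$\partial_t u=\Delta u+f(u),\quad x\in\mathbb{R}^N,\ t>0,\qquad u(x,0)=u_0(x),\quad x\in \mathbb{R}^N .$$ Then there exist positive constants $c_0\le c_1$ such that: if $0<c<c_0$, then the solution $u$ of the problem exists globally in time; if $c>c_1$, then there cannot exist global in time solutions of the problem.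
   Context: A solution exists globally in time (is a global in time solution) if it solves the problem for all $t>0$.
   Formalization: As printed, f(u)=exp(-1/u) on (0,1) contradicts f''>0, since the second derivative of exp(-1/u) is negative for 1/2<u<1; the theorem is proved for f(u)=exp(-1/u) on (0,d) with any d in (0,1], which is consistent for d<1/2 and contains the printed case d=1. *)

theory Defs
  imports "HOL-Analysis.Analysis"
begin

(* A function of space and time is curried: u x t, with x in R^N = real ^ 'n, N = CARD('n). *)

definition partial_deriv :: "'n::finite \<Rightarrow> (real ^ 'n \<Rightarrow> real) \<Rightarrow> real ^ 'n \<Rightarrow> real" where
  "partial_deriv i v x = deriv (\<lambda>h. v (x + h *\<^sub>R axis i 1)) 0"

(* deriv is a total choice operator, so existence of derivatives is always stated separately. *)
definition has_partial_deriv :: "'n::finite \<Rightarrow> (real ^ 'n \<Rightarrow> real) \<Rightarrow> real ^ 'n \<Rightarrow> bool" where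
  "has_partial_deriv i v x \<longleftrightarrow> (\<lambda>h. v (x + h *\<^sub>R axis i 1)) field_differentiable (at 0)"

definition laplacian :: "(real ^ 'n::finite \<Rightarrow> real) \<Rightarrow> real ^ 'n \<Rightarrow> real" where
  "laplacian v x = (\<Sum>i\<in>UNIV. partial_deriv i (partial_deriv i v) x)"

(* The class C^{2,1}(R^N x (0,T)): the derivatives u_t, u_{x_i}, u_{x_i x_j} exist and are
   jointly continuous in (x,t). *)
definition C21 :: "real \<Rightarrow> (real ^ 'n::finite \<Rightarrow> real \<Rightarrow> real) \<Rightarrow> bool" where
  "C21 T u \<longleftrightarrow>
     (\<forall>x. \<forall>t\<in>{0<..<T}.
        (\<lambda>s. u x s) field_differentiable (at t) \<and>
        (\<forall>i. has_partial_deriv i (\<lambda>y. u y t) x) \<and>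
        (\<forall>i j. has_partial_deriv i (partial_deriv j (\<lambda>y. u y t)) x)) \<and>
     continuous_on (UNIV \<times> {0<..<T}) (\<lambda>(x, t). u x t) \<and>
     continuous_on (UNIV \<times> {0<..<T}) (\<lambda>(x, t). deriv (\<lambda>s. u x s) t) \<and>
     (\<forall>i. continuous_on (UNIV \<times> {0<..<T}) (\<lambda>(x, t). partial_deriv i (\<lambda>y. u y t) x)) \<and>
     (\<forall>i j. continuous_on (UNIV \<times> {0<..<T})
        (\<lambda>(x, t). partial_deriv i (partial_deriv j (\<lambda>y. u y t)) x))"

(* Nonnegative classical solutions on R^N x [0,T) of
     u_t = Laplacian u + f(u),  u(x,0) = u0(x).
   Nonnegativity is part of the notion because f is only meaningful on [0,\<infinity>). *)
definition solves_heat ::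
    "(real \<Rightarrow> real) \<Rightarrow> (real ^ 'n::finite \<Rightarrow> real) \<Rightarrow> real \<Rightarrow> (real ^ 'n \<Rightarrow> real \<Rightarrow> real) \<Rightarrow> bool" where
  "solves_heat f u0 T u \<longleftrightarrow>
     (\<forall>x. \<forall>t\<in>{0..<T}. u x t \<ge> 0) \<and>
     continuous_on (UNIV \<times> {0..<T}) (\<lambda>(x, t). u x t) \<and>
     C21 T u \<and>
     (\<forall>x. \<forall>t\<in>{0<..<T}. deriv (\<lambda>s. u x s) t = laplacian (\<lambda>y. u y t) x + f (u x t)) \<and>
     (\<forall>x. u x 0 = u0 x)"

definition global_solution ::
    "(real \<Rightarrow> real) \<Rightarrow> (real ^ 'n::finite \<Rightarrow> real) \<Rightarrow> (real ^ 'n \<Rightarrow> real \<Rightarrow> real) \<Rightarrow> bool" where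
  "global_solution f u0 u \<longleftrightarrow> (\<forall>T>0. solves_heat f u0 T u)"

(* The class of functions bounded on every strip R^N x [0,T]. For bounded continuous data a
   classical solution in this class is unique; it is "the" solution of the problem. *)
definition bounded_on_strips :: "(real ^ 'n::finite \<Rightarrow> real \<Rightarrow> real) \<Rightarrow> bool" where
  "bounded_on_strips u \<longleftrightarrow> (\<forall>T>0. bounded ((\<lambda>(x, t). u x t) ` (UNIV \<times> {0..T})))"

definition u_init :: "real \<Rightarrow> real ^ 'n::finite \<Rightarrow> real" where
  "u_init c x =
     1 / ln (inverse c * ((norm x)\<^sup>2 + 1) * (ln (norm x + exp 1))\<^sup>2 + 1)"

(* f in C^1([0,\<infinity>)) (one-sided at 0) and C^2((0,\<infinity>)), with first and second derivatives f', f''. *)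
definition C1_C2_halfline :: "(real \<Rightarrow> real) \<Rightarrow> (real \<Rightarrow> real) \<Rightarrow> (real \<Rightarrow> real) \<Rightarrow> bool" where
  "C1_C2_halfline f f' f'' \<longleftrightarrow>
     (\<forall>u\<ge>0. (f has_real_derivative f' u) (at u within {0..})) \<and> continuous_on {0..} f' \<and>
     (\<forall>u>0. (f' has_real_derivative f'' u) (at u)) \<and> continuous_on {0<..} f''"

(* The nonlinearity: f(u) = exp(-1/u) for 0 < u < d. The source has d = 1, but
   (exp(-1/u))'' = (1 - 2u) exp(-1/u) / u^4 is negative for 1/2 < u < 1, so d = 1 is
   incompatible with f'' > 0. The value d is therefore left arbitrary: d = 1 is the literal
   hypothesis, and d \<le> 1/2 the satisfiable case. *)
definition nonlinearity ::
    "real \<Rightarrow> (real \<Rightarrow> real) \<Rightarrow> (real \<Rightarrow> real) \<Rightarrow> (real \<Rightarrow> real) \<Rightarrow> bool" where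
  "nonlinearity d f f' f'' \<longleftrightarrow>
     C1_C2_halfline f f' f'' \<and>
     f 0 = 0 \<and>
     (\<forall>u>0. f u > 0 \<and> f' u > 0 \<and> f'' u > 0) \<and>
     (\<forall>u>0. (\<integral>\<^sup>+s\<in>{u..}. ennreal (1 / f s) \<partial>lborel) < \<infinity>) \<and>
     (\<forall>u\<in>{0<..<d}. f u = exp (- 1 / u))"

end

theory Submission
  imports Defs "HOL-Probability.Distributions"
begin

text \<open>
  Large \<open>c\<close>: on the unit ball \<open>u_init c \<ge> c / 8\<close>, and comparison with a decaying bump keeps
  \<open>u\<close> large on a smaller ball up to time 1. There \<open>v = F u\<close>, where \<open>F y\<close> is the integral of
  \<open>1 / f\<close> over \<open>[y, \<infinity>)\<close>, satisfies \<open>v\<^sub>t - \<Delta> v \<le> -1\<close>, because \<open>f' > 0\<close>. Comparison with a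
  quadratic polynomial forces \<open>v \<le> 0\<close> at the centre within a short time, whereas \<open>F > 0\<close>.

  Small \<open>c\<close>: cut \<open>f\<close> off above \<open>M = d / 2\<close>. The resulting bounded Lipschitz problem has a global
  classical solution, the fixed point of Duhamel's formula in a space of functions Lipschitz in
  \<open>x\<close>; this Lipschitz bound makes the second derivatives of the Duhamel integral converge
  absolutely. An explicit supersolution \<open>W = 1 / Q\<close> with \<open>Q\<close> close to
  \<open>A + ln (|x|\<^sup>2 + b (t + 1)) + 2 ln (A + ln (|x|\<^sup>2 + b (t + 1)))\<close> stays below \<open>M\<close> and dominates
  \<open>u_init c\<close>, so the maximum principle gives \<open>u \<le> W \<le> M\<close>, and \<open>u\<close> solves the original problem.
\<close>

section \<open>Integrals depending on a parameter\<close>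

text \<open>With \<open>u = 1 / Q\<close> the nonlinearity \<open>exp (- 1 / u)\<close> becomes
  \<open>exp (- Q)\<close>, and the condition on \<open>Q\<close> asks terms of size 1 / (|x|^2 + t
  + 1) to dominate \<open>Q\<^sup>2 * exp (- Q)\<close>. So \<open>exp Q\<close> must carry two
  powers of a logarithm besides |x|^2, which cancel \<open>Q\<^sup>2\<close>. This is exactly the
  shape of the argument of the logarithm in \<open>u_init\<close>, so that at time 0 the
  supersolution and the datum can be compared through a multiplicative constant alone.

  A bounded continuous source does not in general give a Duhamel integral of class C^2. Some modulus
  of continuity in x is needed; a Lipschitz bound is available because \<open>u_init\<close> is
  Lipschitz and the iteration preserves the bound once a time weight absorbs its growth.

  In the nonexistence part, the solution to be excluded has no growth bound at spatial infinity, so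
  every comparison takes place in a ball. On the unit sphere the only boundary information is
  \<open>0 \<le> u\<close>. On the smaller sphere it is the lower bound for \<open>u\<close> gained
  in this way, which the decreasing function \<open>F\<close> turns into an upper bound for
  \<open>v\<close>.\<close>

lemma continuous_on_lebesgue_integral:
  fixes f :: "'a::metric_space \<Rightarrow> 'b \<Rightarrow> real"
  assumes meas: "\<And>a. a \<in> S \<Longrightarrow> f a \<in> borel_measurable M"
    and cont: "AE z in M. continuous_on S (\<lambda>a. f a z)"
    and bound: "\<And>a. a \<in> S \<Longrightarrow> AE z in M. \<bar>f a z\<bar> \<le> H z"
    and H: "integrable M H"
  shows "continuous_on S (\<lambda>a. \<integral>z. f a z \<partial>M)"
  unfolding continuous_on_sequentially
proof (intro ballI allI impI)
  fix X a assume a: "a \<in> S" and X: "(\<forall>n. X n \<in> S) \<and> X \<longlonglongrightarrow> a"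
  have "(\<lambda>n. \<integral>z. f (X n) z \<partial>M) \<longlonglongrightarrow> (\<integral>z. f a z \<partial>M)"
  proof (rule integral_dominated_convergence[where w=H])
    show "AE z in M. (\<lambda>n. f (X n) z) \<longlonglongrightarrow> f a z"
      using cont
    proof eventually_elim
      case (elim z)
      show ?case
        using elim[unfolded continuous_on_sequentially] a X by (auto simp: o_def)
    qed
  qed (use meas bound H a X in auto)
  then show "((\<lambda>a. \<integral>z. f a z \<partial>M) \<circ> X) \<longlonglongrightarrow> (\<integral>z. f a z \<partial>M)"
    by (simp add: o_def)
qed

text \<open>Dominated convergence for the difference quotients along an arbitrary sequence: by the
  mean value inequality they inherit the majorant \<open>H\<close> of the derivative. The quantifier
  over \<open>s\<close> stands inside the almost-everywhere quantifier, so one null set serves the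
  whole neighbourhood of \<open>t\<close>.\<close>

lemma has_real_derivative_lebesgue_integral:
  fixes F F' :: "real \<Rightarrow> 'b \<Rightarrow> real"
  assumes "0 < r"
    and int: "\<And>s. \<bar>s - t\<bar> < r \<Longrightarrow> integrable M (F s)"
    and meas: "F' t \<in> borel_measurable M"
    and deriv: "AE z in M. \<forall>s. \<bar>s - t\<bar> < r \<longrightarrow>
      ((\<lambda>s. F s z) has_real_derivative F' s z) (at s) \<and> \<bar>F' s z\<bar> \<le> H z"
    and H: "integrable M H"
  shows "((\<lambda>s. \<integral>z. F s z \<partial>M) has_real_derivative (\<integral>z. F' t z \<partial>M)) (at t)"
proof -
  have eq: "at 0 = at 0 within {-r<..<r}"
    using \<open>0 < r\<close> by (intro at_within_open[symmetric]) auto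
  have "((\<lambda>h. ((\<integral>z. F (t + h) z \<partial>M) - (\<integral>z. F t z \<partial>M)) / h) \<longlongrightarrow> (\<integral>z. F' t z \<partial>M))
      (at 0 within {-r<..<r})"
    unfolding tendsto_at_iff_sequentially
  proof (intro allI impI)
    fix X :: "nat \<Rightarrow> real"
    assume X: "\<forall>i. X i \<in> {-r<..<r} - {0}" "X \<longlonglongrightarrow> 0"
    have Xr: "\<bar>X i\<bar> < r" "X i \<noteq> 0" for i
      using X(1)[rule_format, of i] by auto
    have "(\<lambda>i. \<integral>z. (F (t + X i) z - F t z) / X i \<partial>M) \<longlonglongrightarrow> (\<integral>z. F' t z \<partial>M)"
    proof (rule integral_dominated_convergence[where w=H])
      show "(\<lambda>z. (F (t + X i) z - F t z) / X i) \<in> borel_measurable M" for i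
        using int[of "t + X i"] int[of t] Xr[of i] \<open>0 < r\<close> by (auto intro!: borel_measurable_divide)
      show "AE z in M. (\<lambda>i. (F (t + X i) z - F t z) / X i) \<longlonglongrightarrow> F' t z"
        using deriv
      proof eventually_elim
        case (elim z)
        then have "((\<lambda>s. F s z) has_real_derivative F' t z) (at t)"
          using \<open>0 < r\<close> by auto
        then have "((\<lambda>h. (F (t + h) z - F t z) / h) \<longlongrightarrow> F' t z) (at 0)"
          by (simp add: DERIV_def)
        then show ?case
          unfolding tendsto_at_iff_sequentially using X(2) Xr(2) by (auto simp: o_def)
      qed
      show "AE z in M. norm ((F (t + X i) z - F t z) / X i) \<le> H z" for i
        using deriv
      proof eventually_elim
        case (elim z)
        have "norm (F (t + X i) z - F t z) \<le> H z * norm ((t + X i) - t)"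
        proof (rule field_differentiable_bound[where S="{t-r<..<t+r}"])
          fix s assume "s \<in> {t-r<..<t+r}"
          then have s: "\<bar>s - t\<bar> < r" by auto
          show "((\<lambda>s. F s z) has_real_derivative F' s z) (at s within {t-r<..<t+r})"
            using elim s by (auto intro: has_field_derivative_at_within)
          show "norm (F' s z) \<le> H z" using elim s by auto
        qed (use Xr[of i] \<open>0 < r\<close> in auto)
        then show ?case
          using Xr(2)[of i] by (simp add: divide_simps)
      qed
    qed (use meas H in auto)
    moreover have "(\<integral>z. (F (t + X i) z - F t z) / X i \<partial>M)
        = ((\<integral>z. F (t + X i) z \<partial>M) - (\<integral>z. F t z \<partial>M)) / X i" for i
      using int[of "t + X i"] int[of t] Xr[of i] \<open>0 < r\<close> by simp
    ultimately show "((\<lambda>h. ((\<integral>z. F (t + h) z \<partial>M) - (\<integral>z. F t z \<partial>M)) / h) \<circ> X)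
        \<longlonglongrightarrow> (\<integral>z. F' t z \<partial>M)"
      by (simp only: o_def)
  qed
  then show ?thesis
    by (simp add: DERIV_def eq)
qed

section \<open>The parabolic maximum principle\<close>

text \<open>If \<open>D\<close> were positive, \<open>f'\<close>, which vanishes at the maximum,
  would be positive just to the right of 0, and \<open>f\<close> would increase there.\<close>

lemma DERIV2_local_max_le:
  fixes f :: "real \<Rightarrow> real"
  assumes "0 < r"
    and f': "\<And>h. \<bar>h\<bar> < r \<Longrightarrow> (f has_real_derivative f' h) (at h)"
    and f'': "(f' has_real_derivative D) (at 0)"
    and max: "\<And>h. \<bar>h\<bar> < r \<Longrightarrow> f h \<le> f 0"
  shows "D \<le> 0"
proof (rule ccontr)
  assume "\<not> D \<le> 0"
  have f'0: "f' 0 = 0"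
    by (rule DERIV_local_max[OF f'[of 0] \<open>0 < r\<close>]) (use max \<open>0 < r\<close> in auto)
  obtain e where e: "0 < e" "\<And>h. 0 < h \<Longrightarrow> h < e \<Longrightarrow> f' 0 < f' (0 + h)"
    using DERIV_pos_inc_right[OF f''] \<open>\<not> D \<le> 0\<close> by auto
  define h where "h = min e r / 2"
  have h: "0 < h" "h < e" "h < r" using e \<open>0 < r\<close> by (auto simp: h_def)
  have "f 0 < f h"
  proof (rule DERIV_pos_imp_increasing_open[OF h(1)])
    fix k assume k: "0 < k" "k < h"
    then have "0 < f' k" using e(2)[of k] f'0 h by simp
    then show "\<exists>y. (f has_real_derivative y) (at k) \<and> 0 < y"
      using f'[of k] k h by auto
  next
    have "isCont f k" if "k \<in> {0..h}" for k
      using f'[of k] that h by (auto intro: DERIV_isCont)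
    then show "continuous_on {0..h} f"
      by (intro continuous_at_imp_continuous_on) blast
  qed
  then show False using max[of h] h by auto
qed

text \<open>At a positive maximum over the closed cylinder the time derivative is nonnegative and
  all pure second derivatives are nonpositive, against the strict inequality \<open>sub\<close>.
  Asking for \<open>sub\<close> only where \<zeta> is positive lets callers exploit that sign. In
  contrast, \<open>d1\<close> is required without a sign, because it is used along a whole segment
  through the maximum. Time derivatives at \<open>t = T\<close> are two-sided, so callers work with
  solutions living beyond \<open>T\<close>.\<close>

lemma parabolic_maximum_principle:
  fixes \<zeta> :: "real ^ 'n::finite \<Rightarrow> real \<Rightarrow> real"
  assumes cont: "continuous_on (cball 0 R \<times> {0..T}) (\<lambda>(x, t). \<zeta> x t)"
    and dt: "\<And>x t. norm x < R \<Longrightarrow> 0 < t \<Longrightarrow> t \<le> T \<Longrightarrow> \<zeta> x t > 0 \<Longrightarrow>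
      ((\<lambda>s. \<zeta> x s) has_real_derivative Dt x t) (at t)"
    and d1: "\<And>i x t. norm x < R \<Longrightarrow> 0 < t \<Longrightarrow> t \<le> T \<Longrightarrow>
      ((\<lambda>h. \<zeta> (x + h *\<^sub>R axis i 1) t) has_real_derivative D1 i x t) (at 0)"
    and d2: "\<And>i x t. norm x < R \<Longrightarrow> 0 < t \<Longrightarrow> t \<le> T \<Longrightarrow> \<zeta> x t > 0 \<Longrightarrow>
      ((\<lambda>h. D1 i (x + h *\<^sub>R axis i 1) t) has_real_derivative D2 i x t) (at 0)"
    and sub: "\<And>x t. norm x < R \<Longrightarrow> 0 < t \<Longrightarrow> t \<le> T \<Longrightarrow> \<zeta> x t > 0 \<Longrightarrow>
      Dt x t < (\<Sum>i\<in>UNIV. D2 i x t)"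
    and initial: "\<And>x. norm x \<le> R \<Longrightarrow> \<zeta> x 0 \<le> 0"
    and lateral: "\<And>x t. norm x = R \<Longrightarrow> 0 \<le> t \<Longrightarrow> t \<le> T \<Longrightarrow> \<zeta> x t \<le> 0"
    and xt: "norm x \<le> R" "0 \<le> t" "t \<le> T"
  shows "\<zeta> x t \<le> 0"
proof (rule ccontr)
  assume pos: "\<not> \<zeta> x t \<le> 0"
  have "compact (cball (0::real^'n) R \<times> {0..T})"
    by (intro compact_Times) auto
  then obtain p where p: "p \<in> cball 0 R \<times> {0..T}"
    and pmax: "\<And>q. q \<in> cball 0 R \<times> {0..T} \<Longrightarrow> (\<lambda>(x, t). \<zeta> x t) q \<le> (\<lambda>(x, t). \<zeta> x t) p"
    using continuous_attains_sup[OF _ _ cont] xt by (metis (no_types, lifting) SigmaI atLeastAtMost_iff empty_iff mem_cball_0)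
  obtain y s where ys: "p = (y, s)" by (cases p)
  have y: "norm y \<le> R" "0 \<le> s" "s \<le> T" using p ys by auto
  have max: "\<zeta> y' s' \<le> \<zeta> y s" if "norm y' \<le> R" "0 \<le> s'" "s' \<le> T" for y' s'
    using pmax[of "(y', s')"] that ys by auto
  have pos': "\<zeta> y s > 0" using max[OF xt] pos by simp
  have y_in: "norm y < R" using lateral[of y s] pos' y by (cases "norm y = R") auto
  have s_in: "0 < s" using initial[of y] pos' y by (cases "s = 0") auto
  \<comment> \<open>The maximum may lie on the top of the cylinder, so it is compared with earlier
    times only.\<close>
  have "Dt y s \<ge> 0"
  proof (rule ccontr)
    assume "\<not> Dt y s \<ge> 0"
    then obtain e where e: "0 < e" "\<And>h. 0 < h \<Longrightarrow> h < e \<Longrightarrow> \<zeta> y s < \<zeta> y (s - h)"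
      using DERIV_neg_dec_left[OF dt[OF y_in s_in y(3) pos']] by auto
    define h where "h = min e s / 2"
    have "0 < h" "h < e" "h \<le> s" using e s_in by (auto simp: h_def)
    then show False using e(2)[of h] max[of y "s - h"] y by auto
  qed
  moreover have "D2 i y s \<le> 0" for i
  proof (rule DERIV2_local_max_le[where r="R - norm y"])
    have nrm: "norm (y + h *\<^sub>R axis i 1) < R" if "\<bar>h\<bar> < R - norm y" for h
      using norm_triangle_ineq[of y "h *\<^sub>R axis i 1"] that by simp
    show "0 < R - norm y" using y_in by simp
    show "((\<lambda>h. \<zeta> (y + h *\<^sub>R axis i 1) s) has_real_derivative D1 i (y + h *\<^sub>R axis i 1) s) (at h)"
      if "\<bar>h\<bar> < R - norm y" for h
    proof -
      have "((\<lambda>k. \<zeta> ((y + h *\<^sub>R axis i 1) + k *\<^sub>R axis i 1) s) has_real_derivative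
          D1 i (y + h *\<^sub>R axis i 1) s) (at 0)"
        by (rule d1[OF nrm[OF that] s_in y(3)])
      then have "((\<lambda>k. \<zeta> (y + (k + h) *\<^sub>R axis i 1) s) has_real_derivative
          D1 i (y + h *\<^sub>R axis i 1) s) (at 0)"
        by (simp add: algebra_simps)
      then show ?thesis
        using DERIV_shift[of "\<lambda>k. \<zeta> (y + k *\<^sub>R axis i 1) s" _ 0 h] by simp
    qed
    show "((\<lambda>h. D1 i (y + h *\<^sub>R axis i 1) s) has_real_derivative D2 i y s) (at 0)"
      by (rule d2[OF y_in s_in y(3) pos'])
    show "\<zeta> (y + h *\<^sub>R axis i 1) s \<le> \<zeta> (y + 0 *\<^sub>R axis i 1) s" if "\<bar>h\<bar> < R - norm y" for h
      using max[of "y + h *\<^sub>R axis i 1" s] nrm[OF that] y by simp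
  qed
  then have "(\<Sum>i\<in>UNIV. D2 i y s) \<le> 0" by (intro sum_nonpos) auto
  ultimately show False using sub[OF y_in s_in y(3) pos'] by simp
qed

section \<open>Radial functions, and the partial derivatives of a solution\<close>

lemma norm_add_axis_power2:
  fixes x :: "real ^ 'n::finite"
  shows "(norm (x + h *\<^sub>R axis i 1))\<^sup>2 = (norm x)\<^sup>2 + 2 * h * x $ i + h\<^sup>2"
  unfolding power2_norm_eq_inner
  by (simp add: inner_add inner_axis inner_commute power2_eq_square algebra_simps inner_axis_axis)

lemma sum_power2_eq_norm_power2:
  fixes x :: "real ^ 'n::finite"
  shows "(\<Sum>i\<in>UNIV. (x $ i)\<^sup>2) = (norm x)\<^sup>2"
  unfolding power2_norm_eq_inner by (simp add: inner_vec_def power2_eq_square)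

text \<open>Radial functions are written in terms of |x|^2, a polynomial in the step
  \<open>h\<close>; the origin then needs no separate treatment.\<close>

lemma has_real_derivative_radial:
  fixes x :: "real ^ 'n::finite"
  assumes "(\<phi> has_real_derivative D) (at ((norm x)\<^sup>2))"
  shows "((\<lambda>h. \<phi> ((norm (x + h *\<^sub>R axis i 1))\<^sup>2)) has_real_derivative D * (2 * x $ i)) (at 0)"
proof -
  have "((\<lambda>h. (norm x)\<^sup>2 + 2 * h * x $ i + h\<^sup>2) has_real_derivative 2 * x $ i) (at 0)"
    by (auto intro!: derivative_eq_intros)
  with assms show ?thesis
    unfolding norm_add_axis_power2
    by (intro DERIV_chain2[of \<phi> D "\<lambda>h. (norm x)\<^sup>2 + 2 * h * x $ i + h\<^sup>2"]) auto
qed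

lemma has_real_derivative_radial2:
  fixes x :: "real ^ 'n::finite"
  assumes "(\<phi>' has_real_derivative D) (at ((norm x)\<^sup>2))"
  shows "((\<lambda>h. \<phi>' ((norm (x + h *\<^sub>R axis i 1))\<^sup>2) * (2 * (x + h *\<^sub>R axis i 1) $ i))
    has_real_derivative D * (2 * x $ i)\<^sup>2 + 2 * \<phi>' ((norm x)\<^sup>2)) (at 0)"
proof -
  have "((\<lambda>h. 2 * (x + h *\<^sub>R axis i 1) $ i) has_real_derivative 2) (at 0)"
    by (auto intro!: derivative_eq_intros)
  from DERIV_mult[OF has_real_derivative_radial[OF assms] this]
  show ?thesis by (simp add: power2_eq_square algebra_simps)
qed

lemma solves_heat_has_derivatives:
  assumes "solves_heat f u0 T u" "0 < t" "t < T"
  shows "((\<lambda>s. u x s) has_real_derivative deriv (\<lambda>s. u x s) t) (at t)"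
    and "((\<lambda>h. u (x + h *\<^sub>R axis i 1) t) has_real_derivative partial_deriv i (\<lambda>y. u y t) x) (at 0)"
    and "((\<lambda>h. partial_deriv j (\<lambda>y. u y t) (x + h *\<^sub>R axis i 1)) has_real_derivative
      partial_deriv i (partial_deriv j (\<lambda>y. u y t)) x) (at 0)"
proof -
  have *: "(\<lambda>s. u x s) field_differentiable (at t)" "has_partial_deriv i (\<lambda>y. u y t) x"
    "has_partial_deriv i (partial_deriv j (\<lambda>y. u y t)) x"
    using assms unfolding solves_heat_def C21_def by auto
  show "((\<lambda>s. u x s) has_real_derivative deriv (\<lambda>s. u x s) t) (at t)"
    using *(1) by (rule field_differentiable_derivI)
  show "((\<lambda>h. u (x + h *\<^sub>R axis i 1) t) has_real_derivative partial_deriv i (\<lambda>y. u y t) x) (at 0)"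
    using *(2) unfolding has_partial_deriv_def partial_deriv_def by (rule field_differentiable_derivI)
  show "((\<lambda>h. partial_deriv j (\<lambda>y. u y t) (x + h *\<^sub>R axis i 1)) has_real_derivative
      partial_deriv i (partial_deriv j (\<lambda>y. u y t)) x) (at 0)"
    using field_differentiable_derivI[OF *(3)[unfolded has_partial_deriv_def]]
    unfolding partial_deriv_def[of i "partial_deriv j (\<lambda>y. u y t)"] .
qed

lemma nonlinearity_has_derivative:
  assumes "nonlinearity d f f' f''" "0 < y"
  shows "(f has_real_derivative f' y) (at y)"
proof -
  have "(f has_real_derivative f' y) (at y within {0..})"
    using assms unfolding nonlinearity_def C1_C2_halfline_def by auto
  moreover have "at y within {0..} = at y"
    using assms by (intro at_within_interior) auto
  ultimately show ?thesis by simp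
qed

section \<open>Gaussian averages\<close>

text \<open>The Gaussian is a product over coordinates, so the claim reduces to one dimension, where
  the function is a multiple of the normal density of variance 1 / (2a).\<close>

lemma integrable_exp_norm_power2:
  assumes "0 < a"
  shows "integrable lborel (\<lambda>z::real ^ 'n::finite. exp (- a * (norm z)\<^sup>2))"
proof (rule integrableI_nonneg)
  have 1: "(\<integral>\<^sup>+x. ennreal (exp (- a * (x::real)\<^sup>2)) \<partial>lborel) < \<infinity>"
  proof -
    have "0 < sqrt (1 / (2 * a))" using assms by simp
    from integrable_normal_density[OF this, of 0]
    have "integrable lborel (\<lambda>x. sqrt (2 * pi * (sqrt (1 / (2 * a)))\<^sup>2) * normal_density 0 (sqrt (1 / (2 * a))) x)"
      by (intro integrable_mult_right)
    moreover have "(\<lambda>x. sqrt (2 * pi * (sqrt (1 / (2 * a)))\<^sup>2) * normal_density 0 (sqrt (1 / (2 * a))) x)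
        = (\<lambda>x. exp (- a * x\<^sup>2))"
      using assms by (auto simp: normal_density_def fun_eq_iff field_simps)
    ultimately show ?thesis by (simp add: real_integrable_def less_top)
  qed
  have "(norm z)\<^sup>2 = (\<Sum>b\<in>Basis. (z \<bullet> b)\<^sup>2)" for z :: "real ^ 'n"
    unfolding power2_norm_eq_inner by (subst euclidean_inner) (simp add: power2_eq_square)
  then have "(\<lambda>z::real ^ 'n. ennreal (exp (- a * (norm z)\<^sup>2)))
      = (\<lambda>z. (\<Prod>b\<in>Basis. ennreal (exp (- a * (z \<bullet> b)\<^sup>2))))"
    by (simp add: prod_ennreal exp_sum sum_distrib_left)
  then have "(\<integral>\<^sup>+z. ennreal (exp (- a * (norm (z::real ^ 'n))\<^sup>2)) \<partial>lborel)
      = (\<Prod>b\<in>(Basis::(real^'n) set). (\<integral>\<^sup>+x. ennreal (exp (- a * (x::real)\<^sup>2)) \<partial>lborel))"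
    by (subst nn_integral_lborel_prod[of "\<lambda>_ x. ennreal (exp (- a * x\<^sup>2))", symmetric]) auto
  also have "\<dots> < \<infinity>" using 1 by (simp add: less_top power_eq_top_ennreal) (simp add: power_eq_top_ennreal flip: less_top)
  finally show "(\<integral>\<^sup>+z. ennreal (exp (- a * (norm (z::real ^ 'n))\<^sup>2)) \<partial>lborel) < \<infinity>" .
qed auto

text \<open>Normalised so that \<open>gauss\<close> is the heat kernel at time 1, and
  \<open>gauss_avg gauss t\<close> below is the heat semigroup. The weights \<open>gauss1\<close> and \<open>gauss2\<close> are its
  derivatives up to sign.\<close>

definition gauss_const :: "'n::finite itself \<Rightarrow> real" where
  "gauss_const _ = (\<integral>z. exp (- (norm (z::real ^ 'n))\<^sup>2 / 4) \<partial>lborel)"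

definition gauss :: "real ^ 'n::finite \<Rightarrow> real" where
  "gauss z = exp (- (norm z)\<^sup>2 / 4) / gauss_const TYPE('n)"

definition gauss1 :: "'n::finite \<Rightarrow> real ^ 'n \<Rightarrow> real" where
  "gauss1 j z = z $ j / 2 * gauss z"

definition gauss2 :: "'n::finite \<Rightarrow> 'n \<Rightarrow> real ^ 'n \<Rightarrow> real" where
  "gauss2 i j z = (z $ i * z $ j / 4 - (if i = j then 1 / 2 else 0)) * gauss z"

definition gauss_lap :: "real ^ 'n::finite \<Rightarrow> real" where
  "gauss_lap z = ((norm z)\<^sup>2 / 4 - real CARD('n) / 2) * gauss z"

text \<open>The rate 1/8 is half of the 1/4 in \<open>gauss\<close>; the other half absorbs any
  factor of quadratic growth. One predicate thus covers the kernel and all its derivative weights up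
  to order two.\<close>

definition gauss_decay :: "(real ^ 'n::finite \<Rightarrow> real) \<Rightarrow> bool" where
  "gauss_decay G \<longleftrightarrow> continuous_on UNIV G \<and> (\<exists>C. \<forall>z. \<bar>G z\<bar> \<le> C * exp (- (norm z)\<^sup>2 / 8))"

lemma gauss_const_pos: "0 < gauss_const TYPE('n::finite)"
proof -
  have int: "integrable lborel (\<lambda>z::real ^ 'n. exp (- (norm z)\<^sup>2 / 4))"
    using integrable_exp_norm_power2[of "1/4"] by simp
  have "gauss_const TYPE('n) \<noteq> 0"
  proof
    assume "gauss_const TYPE('n) = 0"
    then have "AE z in (lborel :: (real^'n) measure). exp (- (norm z)\<^sup>2 / 4) = 0"
      using integral_nonneg_eq_0_iff_AE[OF int] by (simp add: gauss_const_def)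
    then have "AE z in (lborel :: (real^'n) measure). False" by simp
    then have "emeasure (lborel :: (real^'n) measure) (space lborel) = 0"
      unfolding eventually_False ae_filter_eq_bot_iff .
    then show False by simp
  qed
  moreover have "0 \<le> gauss_const TYPE('n)"
    unfolding gauss_const_def by (intro integral_nonneg_AE) auto
  ultimately show ?thesis by simp
qed

lemma gauss_pos:
  fixes z :: "real ^ 'n::finite"
  shows "0 < gauss z"
  using gauss_const_pos[where 'n='n] by (simp add: gauss_def)

lemma integral_gauss: "(\<integral>z. gauss z \<partial>lborel) = 1"
proof -
  have "(\<integral>z. gauss (z::real^'a) \<partial>lborel) = (\<integral>z. exp (- (norm (z::real^'a))\<^sup>2 / 4) \<partial>lborel) / gauss_const TYPE('a)"
    unfolding gauss_def by (rule integral_divide_zero)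
  then show ?thesis using gauss_const_pos[where 'n='a] by (simp add: gauss_const_def)
qed

lemma power2_le_exp: "s\<^sup>2 \<le> 8 * exp (s\<^sup>2 / 8)" for s :: real
  using exp_ge_add_one_self[of "s\<^sup>2 / 8"] by linarith

lemma gauss_decay_mult_gauss:
  fixes p :: "real ^ 'n::finite \<Rightarrow> real"
  assumes "continuous_on UNIV p" and p: "\<And>z. \<bar>p z\<bar> \<le> C * (1 + (norm z)\<^sup>2)"
  shows "gauss_decay (\<lambda>z. p z * gauss z)"
proof -
  have "C \<ge> 0" using p[of 0] by simp
  have "\<bar>p z * gauss z\<bar> \<le> C * 9 / gauss_const TYPE('n) * exp (- (norm z)\<^sup>2 / 8)" for z
  proof -
    have "1 + (norm z)\<^sup>2 \<le> 9 * exp ((norm z)\<^sup>2 / 8)"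
      using power2_le_exp[of "norm z"] by (smt (verit) one_le_exp_iff zero_le_power2 divide_nonneg_nonneg)
    then have "C * (1 + (norm z)\<^sup>2) \<le> C * (9 * exp ((norm z)\<^sup>2 / 8))"
      using \<open>C \<ge> 0\<close> by (rule mult_left_mono)
    with p[of z] have "\<bar>p z\<bar> \<le> C * (9 * exp ((norm z)\<^sup>2 / 8))" by simp
    then have "\<bar>p z\<bar> * gauss z \<le> C * (9 * exp ((norm z)\<^sup>2 / 8)) * gauss z"
      using gauss_pos[of z] by (intro mult_right_mono) auto
    also have "\<dots> = C * 9 / gauss_const TYPE('n) * (exp ((norm z)\<^sup>2 / 8) * exp (- (norm z)\<^sup>2 / 4))"
      by (simp add: gauss_def)
    also have "exp ((norm z)\<^sup>2 / 8) * exp (- (norm z)\<^sup>2 / 4) = exp (- (norm z)\<^sup>2 / 8)"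
      unfolding exp_add[symmetric] by simp
    finally show ?thesis using gauss_pos[of z] by (simp add: abs_mult)
  qed
  moreover have "continuous_on UNIV (\<lambda>z. p z * gauss z)"
    unfolding gauss_def using gauss_const_pos[where 'n='n]
    by (intro continuous_intros assms) auto
  ultimately show ?thesis unfolding gauss_decay_def by blast
qed

lemma decay_gauss: "gauss_decay gauss"
  using gauss_decay_mult_gauss[of "\<lambda>_. 1" 1] by simp

lemma decay_gauss1: "gauss_decay (gauss1 j)"
proof -
  have "\<bar>z $ j / 2\<bar> \<le> 1 * (1 + (norm z)\<^sup>2)" for z :: "real ^ 'a"
    using component_le_norm_cart[of z j] zero_le_power2[of "norm z - 1"] zero_le_power2[of "norm z"]
    unfolding power2_diff by (simp add: power2_eq_square)
  then show ?thesis unfolding gauss1_def[abs_def]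
    by (intro gauss_decay_mult_gauss[where C=1]) (auto intro!: continuous_intros)
qed

lemma decay_gauss2: "gauss_decay (gauss2 i j)"
proof -
  have "\<bar>z $ i * z $ j / 4 - (if i = j then 1 / 2 else 0)\<bar> \<le> 1 * (1 + (norm z)\<^sup>2)" for z :: "real ^ 'a"
  proof -
    have prod_le: "\<bar>z $ i * z $ j\<bar> \<le> norm z * norm z"
      unfolding abs_mult by (intro mult_mono component_le_norm_cart) auto
    have "\<bar>z $ i * z $ j / 4 - (if i = j then 1 / 2 else 0)\<bar> \<le> \<bar>z $ i * z $ j\<bar> / 4 + 1 / 2"
      using abs_triangle_ineq4[of "z $ i * z $ j / 4" "if i = j then 1 / 2 else 0"] by (simp split: if_splits)
    also have "\<dots> \<le> (norm z)\<^sup>2 / 4 + 1 / 2" using prod_le by (simp add: power2_eq_square)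
    also have "\<dots> \<le> 1 * (1 + (norm z)\<^sup>2)" using zero_le_power2[of "norm z"] unfolding mult_1 by linarith
    finally show ?thesis .
  qed
  then show ?thesis unfolding gauss2_def[abs_def]
    by (intro gauss_decay_mult_gauss[where C=1]) (auto intro!: continuous_intros)
qed

lemma gauss_lap_eq: "gauss_lap z = (\<Sum>i\<in>UNIV. gauss2 i i z)"
proof -
  have "(\<Sum>i\<in>UNIV. z $ i * z $ i / 4) = (norm z)\<^sup>2 / 4"
    using sum_power2_eq_norm_power2[of z] by (simp add: power2_eq_square flip: sum_divide_distrib)
  then show ?thesis
    unfolding gauss_lap_def gauss2_def by (simp add: sum_subtractf flip: sum_distrib_right)
qed

lemma gauss_decay_measurable: "gauss_decay G \<Longrightarrow> G \<in> borel_measurable borel"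
  unfolding gauss_decay_def by (auto intro: borel_measurable_continuous_onI)

text \<open>The first moment is what controls a kernel of mean zero acting on a Lipschitz function.
  Absorbing the factor \<open>norm z\<close> costs another half of the rate, down to 1/16.\<close>

lemma gauss_decay_integrable_norm:
  fixes G :: "real ^ 'n::finite \<Rightarrow> real"
  assumes "gauss_decay G"
  shows "integrable lborel G" "integrable lborel (\<lambda>z. norm z * G z)"
proof -
  obtain C where C: "\<And>z. \<bar>G z\<bar> \<le> C * exp (- (norm z)\<^sup>2 / 8)"
    using assms unfolding gauss_decay_def by blast
  have "0 \<le> C" using order_trans[OF abs_ge_zero C[of 0]] by simp
  note [measurable] = gauss_decay_measurable[OF assms]
  show "integrable lborel G"
  proof (rule Bochner_Integration.integrable_bound)
    show "integrable lborel (\<lambda>z::real^'n. C * exp (- (1/8) * (norm z)\<^sup>2))"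
      by (intro integrable_mult_right integrable_exp_norm_power2) auto
    show "AE z in lborel. norm (G z) \<le> norm (C * exp (- (1/8) * (norm z)\<^sup>2))"
      using C \<open>0 \<le> C\<close> by (auto simp: abs_mult)
  qed measurable
  show "integrable lborel (\<lambda>z. norm z * G z)"
  proof (rule Bochner_Integration.integrable_bound)
    show "integrable lborel (\<lambda>z::real^'n. 17 * C * exp (- (1/16) * (norm z)\<^sup>2))"
      by (intro integrable_mult_right integrable_exp_norm_power2) auto
    have "norm (norm z * G z) \<le> norm (17 * C * exp (- (1/16) * (norm z)\<^sup>2))" for z
    proof -
      have "norm z \<le> 1 + (norm z)\<^sup>2"
      proof -
        have "2 * norm z \<le> 1 + (norm z)\<^sup>2"
          using zero_le_power2[of "norm z - 1"] unfolding power2_eq_square by (simp add: algebra_simps)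
        then show ?thesis using norm_ge_zero[of z] by linarith
      qed
      also have "\<dots> \<le> 17 * exp ((norm z)\<^sup>2 / 16)"
        using exp_ge_add_one_self[of "(norm z)\<^sup>2 / 16"] zero_le_power2[of "norm z"] by linarith
      finally have "norm z * \<bar>G z\<bar> \<le> 17 * exp ((norm z)\<^sup>2 / 16) * (C * exp (- (norm z)\<^sup>2 / 8))"
        by (intro mult_mono C) auto
      also have "\<dots> = 17 * C * (exp ((norm z)\<^sup>2 / 16) * exp (- (norm z)\<^sup>2 / 8))"
        by simp
      also have "exp ((norm z)\<^sup>2 / 16) * exp (- (norm z)\<^sup>2 / 8) = exp (- (1/16) * (norm z)\<^sup>2)"
        unfolding exp_add[symmetric] by simp
      finally show ?thesis using \<open>0 \<le> C\<close> by (simp add: abs_mult)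
    qed
    then show "AE z in lborel. norm (norm z * G z) \<le> norm (17 * C * exp (- (1/16) * (norm z)\<^sup>2))"
      by simp
  qed measurable
qed

lemma integrable_gauss_decay_mult:
  assumes "gauss_decay G" "k \<in> borel_measurable borel" "\<And>z. \<bar>k z\<bar> \<le> B"
  shows "integrable lborel (\<lambda>z. G z * k z)"
proof (rule Bochner_Integration.integrable_bound)
  show "integrable lborel (\<lambda>z. B * G z)"
    by (intro integrable_mult_right gauss_decay_integrable_norm assms)
  note [measurable] = gauss_decay_measurable[OF assms(1)] assms(2)
  show "(\<lambda>z. G z * k z) \<in> borel_measurable lborel" by measurable
  have "0 \<le> B" using order_trans[OF abs_ge_zero assms(3)] .
  then show "AE z in lborel. norm (G z * k z) \<le> norm (B * G z)"
    using assms(3) by (auto simp: abs_mult mult.commute[of B] intro!: mult_left_mono)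
qed

lemma gaussian_integral_bound:
  assumes "gauss_decay G" "k \<in> borel_measurable borel" "\<And>z. \<bar>k z\<bar> \<le> B"
  shows "\<bar>\<integral>z. G z * k z \<partial>lborel\<bar> \<le> B * (\<integral>z. \<bar>G z\<bar> \<partial>lborel)"
proof -
  have "\<bar>\<integral>z. G z * k z \<partial>lborel\<bar> \<le> (\<integral>z. \<bar>G z * k z\<bar> \<partial>lborel)"
    using integral_norm_bound[of lborel "\<lambda>z. G z * k z"] by simp
  also have "\<dots> \<le> (\<integral>z. B * \<bar>G z\<bar> \<partial>lborel)"
  proof (rule integral_mono)
    show "integrable lborel (\<lambda>z. \<bar>G z * k z\<bar>)"
      by (intro integrable_abs integrable_gauss_decay_mult[OF assms])
    show "integrable lborel (\<lambda>z. B * \<bar>G z\<bar>)"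
      by (intro integrable_mult_right integrable_abs gauss_decay_integrable_norm assms)
  qed (use assms(3) in \<open>auto simp: abs_mult mult.commute[of B] intro!: mult_left_mono\<close>)
  finally show ?thesis by simp
qed

section \<open>Changes of variables, and majorants uniform under translation\<close>

lemma lborel_integral_translate:
  fixes \<phi> :: "'a::euclidean_space \<Rightarrow> real"
  assumes "\<phi> \<in> borel_measurable borel"
  shows "(\<integral>z. \<phi> (c + z) \<partial>lborel) = (\<integral>z. \<phi> z \<partial>lborel)"
  using integral_distr[of "(+) c" lborel borel \<phi>] assms by (simp add: lborel_distr_plus)

lemma lborel_integral_scale:
  fixes \<phi> :: "'a::euclidean_space \<Rightarrow> real"
  assumes [measurable]: "\<phi> \<in> borel_measurable borel" and "0 < c"
  shows "(\<integral>z. \<phi> z \<partial>lborel) = c ^ DIM('a) * (\<integral>z. \<phi> (c *\<^sub>R z) \<partial>lborel)"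
proof -
  have "(\<integral>z. \<phi> z \<partial>lborel)
      = (\<integral>z. \<phi> z \<partial>density (distr lborel borel (\<lambda>x. 0 + c *\<^sub>R x)) (\<lambda>_. ennreal (c ^ DIM('a))))"
    using lborel_affine[of c "0::'a"] \<open>0 < c\<close> by (simp add: ennreal_power)
  also have "\<dots> = c ^ DIM('a) * (\<integral>z. \<phi> (c *\<^sub>R z) \<partial>lborel)"
    using \<open>0 < c\<close> by (subst integral_density) (auto simp: integral_distr)
  finally show ?thesis .
qed

text \<open>Provides a majorant independent of the shift \<open>w\<close>, as differentiation under
  the integral requires. It rests on |z|^2 \<le> 2 |z - w|^2 + 2 for shifts of length at most 1,
  which halves the rate.\<close>

lemma gauss_decay_shift:
  fixes G :: "real ^ 'n::finite \<Rightarrow> real"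
  assumes "gauss_decay G"
  obtains C where "0 \<le> C" "\<And>z w. norm w \<le> 1 \<Longrightarrow> \<bar>G (z - w)\<bar> \<le> C * exp (- (1/16) * (norm z)\<^sup>2)"
proof -
  obtain C where C: "\<And>z. \<bar>G z\<bar> \<le> C * exp (- (norm z)\<^sup>2 / 8)"
    using assms unfolding gauss_decay_def by blast
  have "0 \<le> C" using order_trans[OF abs_ge_zero C[of 0]] by simp
  have "\<bar>G (z - w)\<bar> \<le> (C * exp (1/8)) * exp (- (1/16) * (norm z)\<^sup>2)" if "norm w \<le> 1" for z w
  proof -
    have "(norm z)\<^sup>2 \<le> (norm (z - w) + 1)\<^sup>2"
      using norm_triangle_ineq[of "z - w" w] that by (intro power_mono) auto
    also have "\<dots> \<le> 2 * (norm (z - w))\<^sup>2 + 2"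
      using zero_le_power2[of "norm (z - w) - 1"] unfolding power2_eq_square by (simp add: algebra_simps)
    finally have "- (norm (z - w))\<^sup>2 / 8 \<le> 1/8 + - (1/16) * (norm z)\<^sup>2" by simp
    then have "exp (- (norm (z - w))\<^sup>2 / 8) \<le> exp (1/8) * exp (- (1/16) * (norm z)\<^sup>2)"
      by (simp flip: exp_add)
    then have "C * exp (- (norm (z - w))\<^sup>2 / 8) \<le> C * (exp (1/8) * exp (- (1/16) * (norm z)\<^sup>2))"
      using \<open>0 \<le> C\<close> by (rule mult_left_mono)
    with C[of "z - w"] show ?thesis by simp
  qed
  then show ?thesis using that[of "C * exp (1/8)"] \<open>0 \<le> C\<close> by simp
qed

text \<open>The convolution after the substitution y = x + sqrt \<tau> z. In this form \<tau> = 0 is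
  a regular value, where the average is \<open>h x\<close> times the mass of \<open>G\<close>, and
  no power of \<tau> appears in front.\<close>

definition gauss_avg ::
    "(real ^ 'n::finite \<Rightarrow> real) \<Rightarrow> real \<Rightarrow> (real ^ 'n \<Rightarrow> real) \<Rightarrow> real ^ 'n \<Rightarrow> real" where
  "gauss_avg G \<tau> h x = (\<integral>z. G z * h (x + sqrt \<tau> *\<^sub>R z) \<partial>lborel)"

text \<open>Since \<open>h\<close> is only continuous, the increment of x must be moved to the
  smooth kernel: translating x by s along the axis amounts to translating z by s / sqrt \<tau>. This
  is the origin of the factor 1 / sqrt \<tau>. The minus sign in \<open>deriv\<close> matches the
  convention for \<open>gauss1\<close> and \<open>gauss2\<close>, so no sign appears in the
  conclusion.\<close>

lemma gauss_avg_has_derivative_space: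
  fixes G G' h :: "real ^ 'n::finite \<Rightarrow> real"
  assumes G: "gauss_decay G" and G': "gauss_decay G'"
    and deriv: "\<And>z. ((\<lambda>s. G (z + s *\<^sub>R axis i 1)) has_real_derivative - G' z) (at 0)"
    and h: "continuous_on UNIV h" "\<And>y. \<bar>h y\<bar> \<le> B" and "0 < \<tau>"
  shows "((\<lambda>s. gauss_avg G \<tau> h (x + s *\<^sub>R axis i 1)) has_real_derivative
    gauss_avg G' \<tau> h x / sqrt \<tau>) (at 0)"
proof -
  define \<sigma> where "\<sigma> = sqrt \<tau>"
  have \<sigma>: "0 < \<sigma>" using \<open>0 < \<tau>\<close> by (simp add: \<sigma>_def)
  define k where "k z = h (x + \<sigma> *\<^sub>R z)" for z
  have kc: "continuous_on UNIV k" unfolding k_def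
    by (intro continuous_on_compose2[OF h(1)] continuous_intros) auto
  have kB: "\<bar>k z\<bar> \<le> B" for z using h(2) by (simp add: k_def)
  have "0 \<le> B" using order_trans[OF abs_ge_zero kB] .
  note [measurable] = gauss_decay_measurable[OF G] gauss_decay_measurable[OF G']
    borel_measurable_continuous_onI[OF kc]
  define v where "v s = (s / \<sigma>) *\<^sub>R (axis i 1 :: real ^ 'n)" for s
  have eq: "gauss_avg G \<tau> h (x + s *\<^sub>R axis i 1) = (\<integral>z. G (z - v s) * k z \<partial>lborel)" for s
  proof -
    have "(\<integral>z. G (z - v s) * k z \<partial>lborel) = (\<integral>z. G (v s + z - v s) * k (v s + z) \<partial>lborel)"
      by (rule lborel_integral_translate[symmetric]) measurable
    also have "\<dots> = gauss_avg G \<tau> h (x + s *\<^sub>R axis i 1)"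
      unfolding gauss_avg_def k_def v_def using \<sigma>
      by (simp add: \<sigma>_def[symmetric] scaleR_add_right add.assoc)
    finally show ?thesis ..
  qed
  obtain C where C: "0 \<le> C" "\<And>z w. norm w \<le> 1 \<Longrightarrow> \<bar>G (z - w)\<bar> \<le> C * exp (- (1/16) * (norm z)\<^sup>2)"
    using gauss_decay_shift[OF G] by metis
  obtain C' where C': "0 \<le> C'" "\<And>z w. norm w \<le> 1 \<Longrightarrow> \<bar>G' (z - w)\<bar> \<le> C' * exp (- (1/16) * (norm z)\<^sup>2)"
    using gauss_decay_shift[OF G'] by metis
  have nv: "norm (v s) \<le> 1" if "\<bar>s - 0\<bar> < \<sigma>" for s
    using that \<sigma> by (simp add: v_def)
  have "((\<lambda>s. \<integral>z. G (z - v s) * k z \<partial>lborel) has_real_derivative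
      (\<integral>z. G' (z - v 0) / \<sigma> * k z \<partial>lborel)) (at 0)"
  proof (rule has_real_derivative_lebesgue_integral[where r=\<sigma>
        and F'="\<lambda>s z. G' (z - v s) / \<sigma> * k z"
        and H="\<lambda>z. C' / \<sigma> * B * exp (- (1/16) * (norm z)\<^sup>2)"])
    show "integrable lborel (\<lambda>z. G (z - v s) * k z)" if "\<bar>s - 0\<bar> < \<sigma>" for s
    proof (rule Bochner_Integration.integrable_bound)
      show "integrable lborel (\<lambda>z::real^'n. C * B * exp (- (1/16) * (norm z)\<^sup>2))"
        by (intro integrable_mult_right integrable_exp_norm_power2) auto
      have "\<bar>G (z - v s)\<bar> * \<bar>k z\<bar> \<le> C * exp (- (1/16) * (norm z)\<^sup>2) * B" for z
        by (intro mult_mono C(2) nv that kB) (use C(1) in auto)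
      then show "AE z in lborel. norm (G (z - v s) * k z) \<le> norm (C * B * exp (- (1/16) * (norm z)\<^sup>2))"
        using C(1) \<open>0 \<le> B\<close> by (simp add: abs_mult mult_ac)
    qed measurable
    have d: "((\<lambda>s. G (z - v s)) has_real_derivative G' (z - v s) / \<sigma>) (at s)" for z s
    proof -
      have "((\<lambda>r. G ((z - v s) + r *\<^sub>R axis i 1)) has_real_derivative - G' (z - v s)) (at ((s - s) / - \<sigma>))"
        using deriv by simp
      moreover have "((\<lambda>r. (r - s) / - \<sigma>) has_real_derivative - 1 / \<sigma>) (at s)"
        using \<sigma> by (auto intro!: derivative_eq_intros simp: field_simps)
      ultimately have "((\<lambda>r. G ((z - v s) + ((r - s) / - \<sigma>) *\<^sub>R axis i 1)) has_real_derivative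
          - G' (z - v s) * (- 1 / \<sigma>)) (at s)"
        by (rule DERIV_chain2)
      moreover have "(z - v s) + ((r - s) / - \<sigma>) *\<^sub>R axis i 1 = z - v r" for r
        by (simp add: v_def diff_divide_distrib scaleR_left_diff_distrib)
      ultimately show ?thesis by (simp only:) simp
    qed
    have "\<bar>G' (z - v s) / \<sigma> * k z\<bar> \<le> C' / \<sigma> * B * exp (- (1/16) * (norm z)\<^sup>2)"
      if "\<bar>s - 0\<bar> < \<sigma>" for z s
    proof -
      have "\<bar>G' (z - v s)\<bar> * \<bar>k z\<bar> \<le> C' * exp (- (1/16) * (norm z)\<^sup>2) * B"
        by (intro mult_mono C'(2) nv that kB) (use C'(1) in auto)
      then have "\<bar>G' (z - v s)\<bar> * \<bar>k z\<bar> / \<sigma> \<le> C' * exp (- (1/16) * (norm z)\<^sup>2) * B / \<sigma>"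
        using \<sigma> by (intro divide_right_mono) auto
      then show ?thesis using \<sigma> by (simp add: abs_mult mult_ac)
    qed
    with DERIV_cmult_right[OF d] show "AE z in lborel. \<forall>s. \<bar>s - 0\<bar> < \<sigma> \<longrightarrow>
        ((\<lambda>s. G (z - v s) * k z) has_real_derivative G' (z - v s) / \<sigma> * k z) (at s) \<and>
        \<bar>G' (z - v s) / \<sigma> * k z\<bar> \<le> C' / \<sigma> * B * exp (- (1/16) * (norm z)\<^sup>2)"
      by (intro AE_I2) blast
    show "integrable lborel (\<lambda>z::real^'n. C' / \<sigma> * B * exp (- (1/16) * (norm z)\<^sup>2))"
      by (intro integrable_mult_right integrable_exp_norm_power2) auto
  qed (use \<sigma> in measurable)
  moreover have "(\<integral>z. G' (z - v 0) / \<sigma> * k z \<partial>lborel) = gauss_avg G' \<tau> h x / sqrt \<tau>"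
    unfolding gauss_avg_def k_def \<sigma>_def[symmetric] by (simp add: v_def)
  ultimately show ?thesis unfolding eq by simp
qed

section \<open>Derivatives of the heat kernel\<close>

lemma gauss_has_derivative:
  "((\<lambda>s. gauss (z + s *\<^sub>R axis i 1)) has_real_derivative - gauss1 i z) (at 0)"
proof -
  have "((\<lambda>s. exp (- s / 4) / gauss_const TYPE('a)) has_real_derivative
      - exp (- (norm z)\<^sup>2 / 4) / 4 / gauss_const TYPE('a)) (at ((norm z)\<^sup>2))"
    using gauss_const_pos[where 'n='a] by (auto intro!: derivative_eq_intros)
  from has_real_derivative_radial[OF this, of i] show ?thesis
    by (simp add: gauss_def gauss1_def mult_ac)
qed

lemma gauss1_has_derivative:
  "((\<lambda>s. gauss1 j (z + s *\<^sub>R axis i 1)) has_real_derivative - gauss2 i j z) (at 0)"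
proof -
  have "((\<lambda>s. (z + s *\<^sub>R axis i 1) $ j) has_real_derivative (if i = j then 1 else 0)) (at 0)"
    by (auto simp: axis_def intro!: derivative_eq_intros)
  then have "((\<lambda>s. (z + s *\<^sub>R axis i 1) $ j / 2) has_real_derivative (if i = j then 1 else 0) / 2) (at 0)"
    by (rule DERIV_cdivide)
  from DERIV_mult[OF this gauss_has_derivative[of z i]]
  show ?thesis
    unfolding gauss1_def[abs_def] gauss2_def
    by (rule DERIV_cong) (simp add: gauss1_def algebra_simps)
qed

text \<open>The average of the constant function 1 does not depend on the base point, so its
  derivative, which is this integral, vanishes.\<close>

lemma integral_gauss2: "(\<integral>z. gauss2 i j z \<partial>lborel) = 0"
proof -
  have "((\<lambda>s. gauss_avg (gauss1 j) 1 (\<lambda>_. 1) (0 + s *\<^sub>R axis i 1)) has_real_derivative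
      gauss_avg (gauss2 i j) 1 (\<lambda>_. 1) 0 / sqrt 1) (at 0)"
    by (rule gauss_avg_has_derivative_space[where B=1])
      (auto intro: decay_gauss1 decay_gauss2 gauss1_has_derivative)
  then have "((\<lambda>s::real. \<integral>z. gauss1 j z \<partial>lborel) has_real_derivative (\<integral>z. gauss2 i j z \<partial>lborel)) (at 0)"
    by (simp add: gauss_avg_def)
  then show ?thesis using DERIV_unique[OF _ DERIV_const] by blast
qed

text \<open>Rescaling y = \<sigma> z with \<sigma> = sqrt \<tau> moves the dependence on time from
  \<open>h\<close> to the kernel. The \<sigma>-derivative of the rescaled kernel is 2 / \<sigma>
  times the rescaled \<open>gauss_lap\<close>, and the chain rule for the square root contributes 1
  / (2 \<sigma>).\<close>

lemma gauss_avg_has_derivative_time: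
  fixes h :: "real ^ 'n::finite \<Rightarrow> real"
  assumes h: "continuous_on UNIV h" "\<And>y. \<bar>h y\<bar> \<le> B" and "0 < \<tau>"
  shows "((\<lambda>\<tau>. gauss_avg gauss \<tau> h x) has_real_derivative gauss_avg gauss_lap \<tau> h x / \<tau>) (at \<tau>)"
proof -
  define N where "N = CARD('n)"
  define k where "k y = h (x + y)" for y
  have kc: "continuous_on UNIV k" unfolding k_def
    by (intro continuous_on_compose2[OF h(1)] continuous_intros) auto
  have kB: "\<bar>k z\<bar> \<le> B" for z using h(2) by (simp add: k_def)
  have "0 \<le> B" using order_trans[OF abs_ge_zero kB] .
  note [measurable] = gauss_decay_measurable[OF decay_gauss]
  have [measurable]: "(gauss_lap :: real ^ 'n \<Rightarrow> real) \<in> borel_measurable borel"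
    unfolding gauss_lap_def[abs_def] by measurable
  note [measurable] = borel_measurable_continuous_onI[OF kc]
  have scale: "(\<integral>z. G z * k (\<sigma> *\<^sub>R z) \<partial>lborel) = (\<integral>y. (inverse \<sigma> ^ N * G (inverse \<sigma> *\<^sub>R y)) * k y \<partial>lborel)"
    if [measurable]: "G \<in> borel_measurable borel" and "0 < \<sigma>" for G \<sigma>
  proof -
    have "(\<integral>y. (inverse \<sigma> ^ N * G (inverse \<sigma> *\<^sub>R y)) * k y \<partial>lborel)
        = \<sigma> ^ N * (\<integral>z. (inverse \<sigma> ^ N * G (inverse \<sigma> *\<^sub>R (\<sigma> *\<^sub>R z))) * k (\<sigma> *\<^sub>R z) \<partial>lborel)"
      using \<open>0 < \<sigma>\<close> by (subst lborel_integral_scale[where c=\<sigma>]) (auto simp: N_def)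
    also have "\<dots> = (\<integral>z. G z * k (\<sigma> *\<^sub>R z) \<partial>lborel)"
      using \<open>0 < \<sigma>\<close> by (simp add: mult.assoc power_inverse)
    finally show ?thesis ..
  qed
  define \<sigma>0 where "\<sigma>0 = sqrt \<tau>"
  have \<sigma>0: "0 < \<sigma>0" using \<open>0 < \<tau>\<close> by (simp add: \<sigma>0_def)
  define K where "K = gauss_const TYPE('n)"
  have K: "0 < K" using gauss_const_pos by (simp add: K_def)
  \<comment> \<open>For \<sigma> within \<sigma>0 / 2 of \<sigma>0 one has \<sigma> < 3/2 \<sigma>0,
    so \<open>a\<close> is at most 1 / (4 \<sigma>^2), the decay rate of every kernel in this
    neighbourhood.\<close>
  define a where "a = 1 / (9 * \<sigma>0\<^sup>2)"
  have a: "0 < a" using \<sigma>0 by (simp add: a_def)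
  \<comment> \<open>Product of the bounds for the factors of \<open>F'\<close>. Half of the rate
    \<open>a\<close> is spent on the quadratic factor of \<open>gauss_lap\<close>, which produces
    \<open>1 + 2 / a\<close> and leaves the rate \<open>a / 2\<close> in the majorant.\<close>
  define D where "D = 2 * (2 / \<sigma>0) * (2 / \<sigma>0) ^ N * ((1 + 2 / a) * (1 / \<sigma>0\<^sup>2 + N) / K) * B"
  define F where "F \<sigma> y = inverse \<sigma> ^ N * gauss (inverse \<sigma> *\<^sub>R y) * k y" for \<sigma> y
  define F' where "F' \<sigma> y = 2 * inverse \<sigma> * (inverse \<sigma> ^ N * gauss_lap (inverse \<sigma> *\<^sub>R y)) * k y" for \<sigma> y
  have bound: "gauss (inverse \<sigma> *\<^sub>R y) \<le> exp (- a * (norm y)\<^sup>2) / K" "inverse \<sigma> \<le> 2 / \<sigma>0" "0 < \<sigma>"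
    if "\<bar>\<sigma> - \<sigma>0\<bar> < \<sigma>0 / 2" for \<sigma> and y :: "real^'n"
  proof -
    have s: "\<sigma>0 / 2 < \<sigma>" "\<sigma> < 3/2 * \<sigma>0" using that[unfolded abs_less_iff] by linarith+
    then show "0 < \<sigma>" "inverse \<sigma> \<le> 2 / \<sigma>0" using \<sigma>0 by (auto simp: field_simps)
    have "\<sigma>\<^sup>2 \<le> (3/2 * \<sigma>0)\<^sup>2" using s \<sigma>0 by (intro power_mono) auto
    then have "4 * \<sigma>\<^sup>2 \<le> 9 * \<sigma>0\<^sup>2" by (simp add: power_mult_distrib power2_eq_square)
    then have "a \<le> 1 / (4 * \<sigma>\<^sup>2)" unfolding a_def
      using s \<sigma>0 by (intro divide_left_mono mult_pos_pos) auto
    then have "a * (norm y)\<^sup>2 \<le> 1 / (4 * \<sigma>\<^sup>2) * (norm y)\<^sup>2" by (intro mult_right_mono) auto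
    also have "\<dots> = (norm (inverse \<sigma> *\<^sub>R y))\<^sup>2 / 4" by (simp add: power_mult_distrib power_inverse field_simps)
    finally show "gauss (inverse \<sigma> *\<^sub>R y) \<le> exp (- a * (norm y)\<^sup>2) / K"
      unfolding gauss_def K_def[symmetric] using K by (intro divide_right_mono) auto
  qed
  have "((\<lambda>\<sigma>. \<integral>y. F \<sigma> y \<partial>lborel) has_real_derivative (\<integral>y. F' \<sigma>0 y \<partial>lborel)) (at \<sigma>0)"
  proof (rule has_real_derivative_lebesgue_integral[where r="\<sigma>0/2" and
        H="\<lambda>y. D * exp (- (a / 2) * (norm y)\<^sup>2)"])
    show "integrable lborel (F \<sigma>)" if "\<bar>\<sigma> - \<sigma>0\<bar> < \<sigma>0 / 2" for \<sigma>
    proof (rule Bochner_Integration.integrable_bound)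
      show "integrable lborel (\<lambda>y::real^'n. inverse \<sigma> ^ N / K * B * exp (- a * (norm y)\<^sup>2))"
        by (intro integrable_mult_right integrable_exp_norm_power2 a)
      show "F \<sigma> \<in> borel_measurable lborel" unfolding F_def[abs_def] by measurable
      have "gauss (inverse \<sigma> *\<^sub>R y) * \<bar>k y\<bar> \<le> exp (- a * (norm y)\<^sup>2) / K * B" for y
        using K by (intro mult_mono bound that kB) auto
      then have "inverse \<sigma> ^ N * (gauss (inverse \<sigma> *\<^sub>R y) * \<bar>k y\<bar>)
          \<le> inverse \<sigma> ^ N * (exp (- a * (norm y)\<^sup>2) / K * B)" for y
        using bound(3)[OF that] by (intro mult_left_mono) auto
      then show "AE y in lborel. norm (F \<sigma> y) \<le> norm (inverse \<sigma> ^ N / K * B * exp (- a * (norm y)\<^sup>2))"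
        using bound(3)[OF that] K \<open>0 \<le> B\<close> gauss_pos
        by (auto simp: F_def abs_mult power_abs mult_ac abs_of_pos[OF gauss_pos])
    qed
    show "F' \<sigma>0 \<in> borel_measurable lborel" unfolding F'_def[abs_def] by measurable
    show "integrable lborel (\<lambda>y::real^'n. D * exp (- (a / 2) * (norm y)\<^sup>2))"
      using a by (intro integrable_mult_right integrable_exp_norm_power2) auto
    have d: "((\<lambda>\<sigma>. F \<sigma> y) has_real_derivative F' \<sigma> y) (at \<sigma>)" if "\<bar>\<sigma> - \<sigma>0\<bar> < \<sigma>0 / 2" for \<sigma> y
    proof -
      have "0 < \<sigma>" by (rule bound(3)[OF that])
      have F_eq: "F = (\<lambda>\<sigma> y. inverse \<sigma> ^ N * (exp (- (inverse \<sigma>)\<^sup>2 * (norm y)\<^sup>2 / 4) / K) * k y)"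
        unfolding F_def gauss_def K_def norm_scaleR power_mult_distrib power2_abs by simp
      have "N > 0" by (simp add: N_def)
      have p: "((\<lambda>\<sigma>. inverse \<sigma> ^ N) has_real_derivative - (N * inverse \<sigma> * inverse \<sigma> ^ N)) (at \<sigma>)"
      proof (rule DERIV_cong[OF DERIV_power[OF DERIV_inverse]])
        show "real N * (- (inverse \<sigma> ^ Suc (Suc 0)) * inverse \<sigma> ^ (N - Suc 0)) = - (N * inverse \<sigma> * inverse \<sigma> ^ N)"
          using \<open>N > 0\<close> by (cases N) auto
      qed (use \<open>0 < \<sigma>\<close> in auto)
      have q: "((\<lambda>\<sigma>. exp (- (inverse \<sigma>)\<^sup>2 * (norm y)\<^sup>2 / 4)) has_real_derivative
          inverse \<sigma> ^ 3 * (norm y)\<^sup>2 / 2 * exp (- (inverse \<sigma>)\<^sup>2 * (norm y)\<^sup>2 / 4)) (at \<sigma>)"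
        using \<open>0 < \<sigma>\<close>
        by (auto intro!: derivative_eq_intros simp: power2_eq_square power3_eq_cube)
      show ?thesis unfolding F_eq
        by (rule DERIV_cong[OF DERIV_cmult_right[OF DERIV_mult[OF p DERIV_cdivide[OF q]]]])
          (use \<open>0 < \<sigma>\<close> in \<open>simp add: F'_def gauss_lap_def gauss_def K_def[symmetric] N_def[symmetric] power_mult_distrib
            power2_eq_square power3_eq_cube algebra_simps diff_divide_distrib\<close>)
    qed
    have b: "\<bar>F' \<sigma> y\<bar> \<le> D * exp (- (a / 2) * (norm y)\<^sup>2)"
      if "\<bar>\<sigma> - \<sigma>0\<bar> < \<sigma>0 / 2" for \<sigma> y
    proof -
      have "0 < \<sigma>" by (rule bound(3)[OF that])
      have "(inverse \<sigma>)\<^sup>2 \<le> (2 / \<sigma>0)\<^sup>2" using bound(2)[OF that] \<open>0 < \<sigma>\<close> by (intro power_mono) auto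
      then have "(inverse \<sigma>)\<^sup>2 * (norm y)\<^sup>2 \<le> (2 / \<sigma>0)\<^sup>2 * (norm y)\<^sup>2" by (intro mult_right_mono) auto
      then have "(norm (inverse \<sigma> *\<^sub>R y))\<^sup>2 / 4 \<le> 1 / \<sigma>0\<^sup>2 * (norm y)\<^sup>2"
        using \<open>0 < \<sigma>\<close> by (simp add: power_mult_distrib power_divide mult_ac)
      moreover have "0 \<le> (norm (inverse \<sigma> *\<^sub>R y))\<^sup>2 / 4" by simp
      moreover have "0 \<le> 1 / \<sigma>0\<^sup>2" by simp
      ultimately have "\<bar>(norm (inverse \<sigma> *\<^sub>R y))\<^sup>2 / 4 - N / 2\<bar> \<le> 1 / \<sigma>0\<^sup>2 * (norm y)\<^sup>2 + N"
        by linarith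
      also have "\<dots> \<le> (1 + (norm y)\<^sup>2) * (1 / \<sigma>0\<^sup>2 + N)" by (simp add: algebra_simps)
      also have "\<dots> \<le> ((1 + 2 / a) * exp (a / 2 * (norm y)\<^sup>2)) * (1 / \<sigma>0\<^sup>2 + N)"
      proof (intro mult_right_mono)
        have e: "1 + a / 2 * (norm y)\<^sup>2 \<le> exp (a / 2 * (norm y)\<^sup>2)" by (rule exp_ge_add_one_self)
        have "0 \<le> a / 2 * (norm y)\<^sup>2" using a by simp
        with e have e1: "1 \<le> exp (a / 2 * (norm y)\<^sup>2)" and "a / 2 * (norm y)\<^sup>2 \<le> exp (a / 2 * (norm y)\<^sup>2)" by linarith+
        then have "(norm y)\<^sup>2 \<le> 2 / a * exp (a / 2 * (norm y)\<^sup>2)" using a by (simp add: field_simps)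
        from add_mono[OF e1 this] show "1 + (norm y)\<^sup>2 \<le> (1 + 2 / a) * exp (a / 2 * (norm y)\<^sup>2)"
          by (simp add: distrib_right)
      qed auto
      finally have "\<bar>gauss_lap (inverse \<sigma> *\<^sub>R y)\<bar> \<le> ((1 + 2 / a) * exp (a / 2 * (norm y)\<^sup>2)) * (1 / \<sigma>0\<^sup>2 + N)
          * (exp (- a * (norm y)\<^sup>2) / K)"
        unfolding gauss_lap_def abs_mult N_def[symmetric] using gauss_pos[of "inverse \<sigma> *\<^sub>R y"] bound(1)[OF that, of y] a
        by (intro mult_mono) auto
      also have "\<dots> = (1 + 2 / a) * (1 / \<sigma>0\<^sup>2 + N) / K * (exp (a / 2 * (norm y)\<^sup>2) * exp (- a * (norm y)\<^sup>2))"
        by simp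
      also have "exp (a / 2 * (norm y)\<^sup>2) * exp (- a * (norm y)\<^sup>2) = exp (- (a / 2) * (norm y)\<^sup>2)"
        unfolding exp_add[symmetric] by (simp add: algebra_simps)
      finally have L: "\<bar>gauss_lap (inverse \<sigma> *\<^sub>R y)\<bar> \<le> (1 + 2 / a) * (1 / \<sigma>0\<^sup>2 + N) / K * exp (- (a / 2) * (norm y)\<^sup>2)" .
      have "\<bar>F' \<sigma> y\<bar> = 2 * inverse \<sigma> * (inverse \<sigma> ^ N * \<bar>gauss_lap (inverse \<sigma> *\<^sub>R y)\<bar>) * \<bar>k y\<bar>"
        using \<open>0 < \<sigma>\<close> by (simp add: F'_def abs_mult power_abs)
      also have "\<dots> \<le> 2 * (2 / \<sigma>0) * ((2 / \<sigma>0) ^ N * ((1 + 2 / a) * (1 / \<sigma>0\<^sup>2 + N) / K * exp (- (a / 2) * (norm y)\<^sup>2))) * B"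
        using \<open>0 < \<sigma>\<close> \<sigma>0 a K
        by (intro mult_mono power_mono L kB bound(2)[OF that] mult_nonneg_nonneg) auto
      finally show ?thesis by (simp only: D_def mult_ac)
    qed
    show "AE y in lborel. \<forall>\<sigma>. \<bar>\<sigma> - \<sigma>0\<bar> < \<sigma>0 / 2 \<longrightarrow>
        ((\<lambda>\<sigma>. F \<sigma> y) has_real_derivative F' \<sigma> y) (at \<sigma>) \<and>
        \<bar>F' \<sigma> y\<bar> \<le> D * exp (- (a / 2) * (norm y)\<^sup>2)"
      using d b by (intro AE_I2) blast
  qed (use \<sigma>0 in auto)
  moreover have "(\<integral>y. F' \<sigma>0 y \<partial>lborel) = 2 * inverse \<sigma>0 * gauss_avg gauss_lap \<tau> h x"
    using scale[of gauss_lap \<sigma>0] \<sigma>0 by (simp add: F'_def gauss_avg_def k_def \<sigma>0_def mult.assoc)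
  ultimately have "((\<lambda>\<sigma>. \<integral>y. F \<sigma> y \<partial>lborel) has_real_derivative
      2 * inverse \<sigma>0 * gauss_avg gauss_lap \<tau> h x) (at (sqrt \<tau>))"
    by (simp add: \<sigma>0_def)
  then have "((\<lambda>\<tau>. \<integral>y. F (sqrt \<tau>) y \<partial>lborel) has_real_derivative
      2 * inverse \<sigma>0 * gauss_avg gauss_lap \<tau> h x * (inverse (sqrt \<tau>) / 2)) (at \<tau>)"
    by (rule DERIV_chain2[of "\<lambda>\<sigma>. \<integral>y. F \<sigma> y \<partial>lborel" _ sqrt]) (rule DERIV_real_sqrt[OF \<open>0 < \<tau>\<close>])
  moreover have "2 * inverse \<sigma>0 * gauss_avg gauss_lap \<tau> h x * (inverse (sqrt \<tau>) / 2)
      = gauss_avg gauss_lap \<tau> h x / \<tau>"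
    using \<open>0 < \<tau>\<close> by (simp add: \<sigma>0_def field_simps)
  moreover have "(\<integral>y. F (sqrt s) y \<partial>lborel) = gauss_avg gauss s h x" if "s \<in> {0<..}" for s
    using scale[of gauss "sqrt s"] that by (simp add: F_def gauss_avg_def k_def)
  ultimately show ?thesis
    using \<open>0 < \<tau>\<close> by (auto intro: has_field_derivative_transform_within_open[where S="{0<..}"])
qed

section \<open>Duhamel's formula\<close>

text \<open>A derivative at 0 for every base point is a derivative at every point of the line.
  Differentiation under the integral needs the latter, on a neighbourhood.\<close>

lemma has_real_derivative_along_axis:
  assumes "\<And>x. ((\<lambda>h. \<phi> (x + h *\<^sub>R axis i 1)) has_real_derivative D x) (at 0)"
  shows "((\<lambda>h. \<phi> (x + h *\<^sub>R axis i 1)) has_real_derivative D (x + s *\<^sub>R axis i 1)) (at s)"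
proof -
  have "((\<lambda>h. \<phi> (x + (h + s) *\<^sub>R axis i 1)) has_real_derivative D (x + s *\<^sub>R axis i 1)) (at 0)"
    using assms[of "x + s *\<^sub>R axis i 1"] by (simp add: algebra_simps)
  then show ?thesis
    using DERIV_shift[of "\<lambda>h. \<phi> (x + h *\<^sub>R axis i 1)" _ 0 s] by simp
qed

abbreviation unit_measure :: "real measure" where
  "unit_measure \<equiv> restrict_space lborel {0<..<1}"

lemma measurable_unit: "f \<in> borel_measurable borel \<Longrightarrow> f \<in> borel_measurable unit_measure"
  by (intro measurable_restrict_space1) simp

lemma AE_unit: "(\<And>\<theta>. 0 < \<theta> \<Longrightarrow> \<theta> < 1 \<Longrightarrow> P \<theta>) \<Longrightarrow> AE \<theta> in unit_measure. P \<theta>"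
  by (intro AE_I2) (auto simp: space_restrict_space)

lemma integrable_inverse_sqrt: "set_integrable lborel {0<..<t} (\<lambda>r. 1 / sqrt r)"
proof (cases "0 < t")
  case True
  have "((\<lambda>r. 1 / sqrt r) has_integral (2 * sqrt t - 2 * sqrt 0)) {0..t}"
  proof (rule fundamental_theorem_of_calculus_interior)
    show "((\<lambda>r. 2 * sqrt r) has_vector_derivative 1 / sqrt r) (at r)" if "r \<in> {0<..<t}" for r
      unfolding has_real_derivative_iff_has_vector_derivative[symmetric]
      using that by (auto intro!: derivative_eq_intros simp: field_simps)
  qed (use True in \<open>auto intro!: continuous_intros\<close>)
  then have "(\<lambda>r. 1 / sqrt r) absolutely_integrable_on {0..t}"
    by (intro nonnegative_absolutely_integrable_1) auto
  then have "set_integrable lebesgue {0<..<t} (\<lambda>r. 1 / sqrt r)"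
    by (rule set_integrable_subset) auto
  then show ?thesis
    unfolding set_integrable_def by (subst (asm) integrable_completion) auto
qed (simp add: set_integrable_def)

lemma integrable_unit_inverse_sqrt: "integrable unit_measure (\<lambda>\<theta>. C / sqrt \<theta>)"
proof -
  have "integrable unit_measure (\<lambda>\<theta>. 1 / sqrt \<theta>)"
    using integrable_inverse_sqrt[of 1] by (simp add: integrable_restrict_space set_integrable_def)
  from integrable_mult_right[OF this, of C] show ?thesis by simp
qed

lemma integrable_unit_const: "integrable unit_measure (\<lambda>\<theta>. C :: real)"
proof -
  have "set_integrable lborel {0<..<1::real} (\<lambda>_. C)"
    unfolding set_integrable_def by simp
  then show ?thesis by (subst integrable_restrict_space) (auto simp: set_integrable_def)
qed

text \<open>The substitution s = t - t \<theta> passes between the source time s and the relative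
  elapsed time \<theta>.\<close>

lemma integral_unit_reflect:
  assumes "0 < t"
  shows "(\<integral>s. indicator {0<..<t} s * \<phi> s \<partial>lborel) = t * (\<integral>\<theta>. \<phi> (t - t * \<theta>) \<partial>unit_measure)"
proof -
  have "(\<integral>s. indicator {0<..<t} s * \<phi> s \<partial>lborel)
      = t * (\<integral>\<theta>. indicator {0<..<t} (t + - t * \<theta>) * \<phi> (t + - t * \<theta>) \<partial>lborel)"
    using assms by (subst lborel_integral_real_affine[of "- t" _ t]) auto
  also have "(\<lambda>\<theta>. indicator {0<..<t} (t + - t * \<theta>) * \<phi> (t + - t * \<theta>))
      = (\<lambda>\<theta>. indicator {0<..<1} \<theta> *\<^sub>R \<phi> (t - t * \<theta>))"
    using assms by (auto simp: fun_eq_iff indicator_def zero_less_mult_iff)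
  finally show ?thesis by (simp add: integral_restrict_space)
qed

lemma decay_gauss_lap: "gauss_decay gauss_lap"
proof -
  have "\<bar>(norm z)\<^sup>2 / 4 - real CARD('a) / 2\<bar> \<le> real (CARD('a) + 1) * (1 + (norm z)\<^sup>2)" for z :: "real ^ 'a"
  proof -
    have "0 \<le> real CARD('a) * (norm z)\<^sup>2" by simp
    then show ?thesis using zero_le_power2[of "norm z"] by (simp add: algebra_simps abs_le_iff)
  qed
  then show ?thesis unfolding gauss_lap_def[abs_def]
    by (intro gauss_decay_mult_gauss) (auto intro!: continuous_intros)
qed

text \<open>\<open>h\<close> is defined for all real times, so that \<open>t - \<tau>\<close> never
  leaves its domain. The Lipschitz constant may depend on a bound for the time, because removing the
  weight from the fixed point multiplies it by an exponential in time.\<close>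

locale heat_source =
  fixes h :: "real ^ 'n::finite \<Rightarrow> real \<Rightarrow> real" and B :: real and \<Lambda> :: "real \<Rightarrow> real"
  assumes continuous: "continuous_on UNIV (\<lambda>p. h (fst p) (snd p))"
    and bounded: "\<And>x t. \<bar>h x t\<bar> \<le> B"
    and lipschitz: "\<And>T x y t. t \<le> T \<Longrightarrow> \<bar>h x t - h y t\<bar> \<le> \<Lambda> T * norm (x - y)"
begin

definition moment :: "(real ^ 'n \<Rightarrow> real) \<Rightarrow> real" where
  "moment G = (\<integral>z. norm z * \<bar>G z\<bar> \<partial>lborel)"

definition avg :: "(real ^ 'n \<Rightarrow> real) \<Rightarrow> real ^ 'n \<Rightarrow> real \<Rightarrow> real \<Rightarrow> real" where
  "avg G x t \<tau> = gauss_avg G \<tau> (\<lambda>y. h y (t - \<tau>)) x"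

text \<open>The elapsed time is \<open>\<tau> = t * \<theta>\<close>, so that the domain of integration does not depend on \<open>t\<close>.\<close>

definition duhamel :: "real ^ 'n \<Rightarrow> real \<Rightarrow> real" where
  "duhamel x t = t * (\<integral>\<theta>. avg gauss x t (t * \<theta>) \<partial>unit_measure)"

definition duhamel1 :: "'n \<Rightarrow> real ^ 'n \<Rightarrow> real \<Rightarrow> real" where
  "duhamel1 j x t = t * (\<integral>\<theta>. avg (gauss1 j) x t (t * \<theta>) / sqrt (t * \<theta>) \<partial>unit_measure)"

definition duhamel2 :: "'n \<Rightarrow> 'n \<Rightarrow> real ^ 'n \<Rightarrow> real \<Rightarrow> real" where
  "duhamel2 i j x t = t * (\<integral>\<theta>. avg (gauss2 i j) x t (t * \<theta>) / (t * \<theta>) \<partial>unit_measure)"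

definition duhamel_lap :: "real ^ 'n \<Rightarrow> real \<Rightarrow> real" where
  "duhamel_lap x t = t * (\<integral>\<theta>. avg gauss_lap x t (t * \<theta>) / (t * \<theta>) \<partial>unit_measure)"

lemma \<Lambda>_nonneg: "0 \<le> \<Lambda> T"
  using order_trans[OF abs_ge_zero lipschitz[of T T "axis undefined 1" 0]] by simp

lemma moment_nonneg: "0 \<le> moment G"
  unfolding moment_def by (intro integral_nonneg_AE) auto

lemma continuous_h: "continuous_on S X \<Longrightarrow> continuous_on S T \<Longrightarrow> continuous_on S (\<lambda>p. h (X p) (T p))"
  using continuous_on_compose2[OF continuous, of S "\<lambda>p. (X p, T p)"]
  by (auto intro: continuous_on_Pair)

text \<open>No sign condition on \<open>Tau\<close> is imposed: \<open>sqrt\<close> is continuous on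
  the whole line and \<open>h\<close> lives on all times. Continuity therefore reaches zero elapsed
  time, where the average with \<open>gauss\<close> returns \<open>h\<close> itself.\<close>

lemma avg_continuous:
  fixes X :: "'b::metric_space \<Rightarrow> real ^ 'n"
  assumes G: "gauss_decay G"
    and "continuous_on S X" "continuous_on S T" "continuous_on S Tau"
  shows "continuous_on S (\<lambda>p. avg G (X p) (T p) (Tau p))"
  unfolding avg_def gauss_avg_def
proof (rule continuous_on_lebesgue_integral[where H="\<lambda>z. B * \<bar>G z\<bar>"])
  note [measurable] = gauss_decay_measurable[OF G]
  show "(\<lambda>z. G z * h (X p + sqrt (Tau p) *\<^sub>R z) (T p - Tau p)) \<in> borel_measurable lborel" for p
  proof -
    have [measurable]: "(\<lambda>z. h (X p + sqrt (Tau p) *\<^sub>R z) (T p - Tau p)) \<in> borel_measurable borel"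
      by (intro borel_measurable_continuous_onI continuous_h continuous_intros)
    show ?thesis by measurable
  qed
  show "AE z in lborel. continuous_on S (\<lambda>p. G z * h (X p + sqrt (Tau p) *\<^sub>R z) (T p - Tau p))"
    by (intro AE_I2 continuous_intros continuous_h assms)
  show "AE z in lborel. \<bar>G z * h (X p + sqrt (Tau p) *\<^sub>R z) (T p - Tau p)\<bar> \<le> B * \<bar>G z\<bar>" for p
    using bounded by (intro AE_I2) (auto simp: abs_mult mult.commute[of B] intro!: mult_left_mono)
  show "integrable lborel (\<lambda>z. B * \<bar>G z\<bar>)"
    by (intro integrable_mult_right integrable_abs gauss_decay_integrable_norm G)
qed

lemma continuous_slice: "continuous_on UNIV (\<lambda>y. h y t)"
  by (intro continuous_h continuous_intros)

lemma avg_measurable: "gauss_decay G \<Longrightarrow> (\<lambda>\<theta>. avg G x t (t * \<theta>)) \<in> borel_measurable unit_measure"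
  by (intro measurable_unit borel_measurable_continuous_onI avg_continuous continuous_intros)

lemma avg_bound:
  assumes "gauss_decay G"
  shows "\<bar>avg G x t \<tau>\<bar> \<le> B * (\<integral>z. \<bar>G z\<bar> \<partial>lborel)"
  unfolding avg_def gauss_avg_def
  by (rule gaussian_integral_bound[OF assms])
    (auto intro!: borel_measurable_continuous_onI continuous_h continuous_intros bounded)

text \<open>A kernel of mean zero only sees the oscillation of \<open>h\<close>; the gained factor \<open>sqrt \<tau>\<close> makes
  the singularity \<open>1 / \<tau>\<close> of the second derivatives integrable.\<close>

lemma avg_lipschitz_bound:
  assumes G: "gauss_decay G" "(\<integral>z. G z \<partial>lborel) = 0" and "0 \<le> \<tau>" "t - \<tau> \<le> T"
  shows "\<bar>avg G x t \<tau>\<bar> \<le> \<Lambda> T * moment G * sqrt \<tau>"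
proof -
  define k where "k z = h (x + sqrt \<tau> *\<^sub>R z) (t - \<tau>)" for z
  have km [measurable]: "k \<in> borel_measurable borel"
    unfolding k_def by (intro borel_measurable_continuous_onI continuous_h continuous_intros)
  note [measurable] = gauss_decay_measurable[OF G(1)]
  have "\<bar>k z\<bar> \<le> B" for z by (simp add: k_def bounded)
  then have int: "integrable lborel (\<lambda>z. G z * k z)" "integrable lborel (\<lambda>z. G z * k 0)"
    using integrable_gauss_decay_mult[OF G(1) km] gauss_decay_integrable_norm(1)[OF G(1)] by auto
  have "avg G x t \<tau> = (\<integral>z. G z * k z \<partial>lborel) - (\<integral>z. G z * k 0 \<partial>lborel)"
    using G(2) by (simp add: avg_def gauss_avg_def k_def)
  also have "\<dots> = (\<integral>z. G z * k z - G z * k 0 \<partial>lborel)"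
    using int by simp
  finally have "\<bar>avg G x t \<tau>\<bar> \<le> (\<integral>z. \<bar>G z * k z - G z * k 0\<bar> \<partial>lborel)"
    using integral_norm_bound[of lborel "\<lambda>z. G z * k z - G z * k 0"] by simp
  also have "\<dots> \<le> (\<integral>z. \<Lambda> T * sqrt \<tau> * (norm z * \<bar>G z\<bar>) \<partial>lborel)"
  proof (rule integral_mono)
    show "integrable lborel (\<lambda>z. \<bar>G z * k z - G z * k 0\<bar>)"
      using int by (intro integrable_abs Bochner_Integration.integrable_diff)
    have "integrable lborel (\<lambda>z. \<bar>norm z * G z\<bar>)"
      by (intro integrable_abs gauss_decay_integrable_norm G)
    then show "integrable lborel (\<lambda>z. \<Lambda> T * sqrt \<tau> * (norm z * \<bar>G z\<bar>))"
      by (intro integrable_mult_right) (simp add: abs_mult)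
    fix z
    have "\<bar>k z - k 0\<bar> \<le> \<Lambda> T * (sqrt \<tau> * norm z)"
      using lipschitz[OF \<open>t - \<tau> \<le> T\<close>, of "x + sqrt \<tau> *\<^sub>R z" x] \<open>0 \<le> \<tau>\<close> by (simp add: k_def)
    then have "\<bar>k z - k 0\<bar> * \<bar>G z\<bar> \<le> \<Lambda> T * (sqrt \<tau> * norm z) * \<bar>G z\<bar>"
      by (rule mult_right_mono) simp
    then show "\<bar>G z * k z - G z * k 0\<bar> \<le> \<Lambda> T * sqrt \<tau> * (norm z * \<bar>G z\<bar>)"
      by (simp add: abs_mult mult_ac flip: right_diff_distrib)
  qed
  finally show ?thesis by (simp only: integral_mult_right_zero moment_def) (simp add: mult_ac)
qed

text \<open>The gain sqrt (t \<theta>) against the weight 1 / (t \<theta>) leaves the integrable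
  singularity 1 / sqrt \<theta>. The majorant sees x and t only through \<open>T\<close>, as needed
  for joint continuity and for differentiation under the integral.\<close>

lemma avg_divide_bound:
  assumes G: "gauss_decay G" "(\<integral>z. G z \<partial>lborel) = 0" and "0 < \<theta>" "0 < t" "t \<le> T"
  shows "\<bar>t * (avg G x t (t * \<theta>) / (t * \<theta>))\<bar> \<le> \<Lambda> T * moment G * sqrt T / sqrt \<theta>"
proof -
  define C where "C = \<Lambda> T * moment G"
  have "0 \<le> C" unfolding C_def by (intro mult_nonneg_nonneg \<Lambda>_nonneg moment_nonneg)
  have "0 < t * \<theta>" using assms by simp
  then have "\<bar>avg G x t (t * \<theta>)\<bar> \<le> C * sqrt (t * \<theta>)"
    unfolding C_def using assms by (intro avg_lipschitz_bound) linarith+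
  also have "\<dots> \<le> C * (sqrt T * sqrt \<theta>)"
    unfolding real_sqrt_mult using assms \<open>0 \<le> C\<close> by (intro mult_left_mono mult_right_mono) auto
  finally have "\<bar>avg G x t (t * \<theta>)\<bar> / \<theta> \<le> C * (sqrt T * sqrt \<theta>) / \<theta>"
    using assms by (intro divide_right_mono) auto
  also have "\<dots> = C * sqrt T / sqrt \<theta>"
    using \<open>0 < \<theta>\<close> real_sqrt_mult_self[of \<theta>] by (simp add: field_simps)
  finally show ?thesis
    using assms by (simp add: C_def abs_mult)
qed

lemma avg_divide_sqrt_bound:
  assumes G: "gauss_decay G" and "0 < \<theta>" "0 < t" "t \<le> T"
  shows "\<bar>t * (avg G x t (t * \<theta>) / sqrt (t * \<theta>))\<bar> \<le> B * (\<integral>z. \<bar>G z\<bar> \<partial>lborel) * sqrt T / sqrt \<theta>"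
proof -
  define C where "C = B * (\<integral>z. \<bar>G z\<bar> \<partial>lborel)"
  have "\<bar>avg G x t (t * \<theta>)\<bar> \<le> C"
    unfolding C_def by (rule avg_bound[OF G])
  then have "0 \<le> C" by linarith
  have "t / sqrt (t * \<theta>) = sqrt t / sqrt \<theta>"
    using \<open>0 < t\<close> by (simp add: real_sqrt_mult real_div_sqrt flip: divide_divide_eq_left)
  then have "t * (\<bar>avg G x t (t * \<theta>)\<bar> / sqrt (t * \<theta>)) = sqrt t * \<bar>avg G x t (t * \<theta>)\<bar> / sqrt \<theta>"
    by (metis times_divide_eq_left times_divide_eq_right)
  also have "\<dots> \<le> sqrt T * C / sqrt \<theta>"
    using assms \<open>\<bar>avg G x t (t * \<theta>)\<bar> \<le> C\<close> by (intro divide_right_mono mult_mono) auto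
  finally show ?thesis
    using assms by (simp add: C_def abs_mult mult_ac)
qed

lemma avg_has_derivative:
  assumes "gauss_decay G" "gauss_decay G'"
    and "\<And>z. ((\<lambda>s. G (z + s *\<^sub>R axis i 1)) has_real_derivative - G' z) (at 0)" and "0 < \<tau>"
  shows "((\<lambda>s. avg G (x + s *\<^sub>R axis i 1) t \<tau>) has_real_derivative
    avg G' (x + r *\<^sub>R axis i 1) t \<tau> / sqrt \<tau>) (at r)"
  unfolding avg_def
  by (rule has_real_derivative_along_axis[where D="\<lambda>x. gauss_avg G' \<tau> (\<lambda>y. h y (t - \<tau>)) x / sqrt \<tau>"])
    (rule gauss_avg_has_derivative_space[OF assms(1-3) continuous_slice bounded assms(4)])

lemma integral_gauss_lap: "(\<integral>z. gauss_lap z \<partial>lborel) = 0"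
  unfolding gauss_lap_eq
  by (subst Bochner_Integration.integral_sum) (auto simp: integral_gauss2 intro: gauss_decay_integrable_norm decay_gauss2)

lemma avg_gauss_lap: "avg gauss_lap x t \<tau> = (\<Sum>i\<in>UNIV. avg (gauss2 i i) x t \<tau>)"
  unfolding avg_def gauss_avg_def gauss_lap_eq sum_distrib_right
  by (rule Bochner_Integration.integral_sum)
    (auto intro!: integrable_gauss_decay_mult[where B=B] decay_gauss2 bounded
      borel_measurable_continuous_onI continuous_h continuous_intros)

section \<open>Continuity and spatial derivatives of the Duhamel integral\<close>

lemma duhamel_continuous: "continuous_on UNIV (\<lambda>p. duhamel (fst p) (snd p))"
  unfolding duhamel_def
proof (intro continuous_intros continuous_on_lebesgue_integral[where H="\<lambda>_. B * (\<integral>z. \<bar>gauss z\<bar> \<partial>(lborel::(real^'n) measure))"])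
qed (auto intro!: avg_measurable avg_continuous continuous_intros avg_bound decay_gauss
    integrable_unit_const)

text \<open>Treats the first derivatives (\<open>w = sqrt\<close>) and the second derivatives
  (\<open>w\<close> the identity) at once: all that matters is a majorant of the form C / sqrt
  \<theta>, uniform for times up to \<open>T\<close>.\<close>

lemma weighted_avg_regular:
  assumes G: "gauss_decay G" and w: "continuous_on UNIV w" "\<And>r. 0 < r \<Longrightarrow> w r \<noteq> 0"
    and bound: "\<And>x t \<theta> T. 0 < \<theta> \<Longrightarrow> 0 < t \<Longrightarrow> t \<le> T \<Longrightarrow>
      \<bar>t * (avg G x t (t * \<theta>) / w (t * \<theta>))\<bar> \<le> C T / sqrt \<theta>"
  shows "continuous_on (UNIV \<times> {0<..<T})
      (\<lambda>p. snd p * (\<integral>\<theta>. avg G (fst p) (snd p) (snd p * \<theta>) / w (snd p * \<theta>) \<partial>unit_measure))" (is ?cont)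
    and "0 < t \<Longrightarrow> integrable unit_measure (\<lambda>\<theta>. t * (avg G x t (t * \<theta>) / w (t * \<theta>)))" (is "_ \<Longrightarrow> ?int")
proof -
  have meas: "(\<lambda>\<theta>. t * (avg G x t (t * \<theta>) / w (t * \<theta>))) \<in> borel_measurable unit_measure" for x t
  proof -
    have "continuous_on UNIV (\<lambda>\<theta>. w (t * \<theta>))"
      by (rule continuous_on_compose2[OF w(1)]) (auto intro!: continuous_intros)
    then have "(\<lambda>\<theta>. w (t * \<theta>)) \<in> borel_measurable unit_measure"
      by (intro measurable_unit borel_measurable_continuous_onI)
    then show ?thesis
      by (intro borel_measurable_times borel_measurable_divide avg_measurable[OF G]) auto
  qed
  have "continuous_on (UNIV \<times> {0<..<T})
      (\<lambda>p. \<integral>\<theta>. snd p * (avg G (fst p) (snd p) (snd p * \<theta>) / w (snd p * \<theta>)) \<partial>unit_measure)"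
  proof (rule continuous_on_lebesgue_integral[OF meas])
    show "AE \<theta> in unit_measure. \<bar>snd p * (avg G (fst p) (snd p) (snd p * \<theta>) / w (snd p * \<theta>))\<bar> \<le> C T / sqrt \<theta>"
      if "p \<in> UNIV \<times> {0<..<T}" for p
      using that by (intro AE_unit bound) auto
    show "AE \<theta> in unit_measure. continuous_on (UNIV \<times> {0<..<T})
        (\<lambda>p. snd p * (avg G (fst p) (snd p) (snd p * \<theta>) / w (snd p * \<theta>)))"
      by (intro AE_unit continuous_intros avg_continuous G continuous_on_compose2[OF w(1)])
        (auto intro!: w(2))
  qed (rule integrable_unit_inverse_sqrt)
  then show ?cont
    by (simp only: integral_mult_right_zero)
  assume "0 < t"
  then have "norm (t * (avg G x t (t * \<theta>) / w (t * \<theta>))) \<le> norm (C t / sqrt \<theta>)" if "0 < \<theta>" for \<theta>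
    unfolding real_norm_def by (intro order_trans[OF bound[OF that \<open>0 < t\<close> order_refl] abs_ge_self])
  then show ?int
    by (intro Bochner_Integration.integrable_bound[OF integrable_unit_inverse_sqrt meas] AE_unit)
qed

lemmas avg_divide_sqrt_regular =
  weighted_avg_regular[where w=sqrt, OF _ _ _ avg_divide_sqrt_bound]

lemmas avg_divide_regular =
  weighted_avg_regular[where w="\<lambda>r. r", OF _ _ _ avg_divide_bound]

lemma duhamel1_continuous: "continuous_on (UNIV \<times> {0<..<T}) (\<lambda>p. duhamel1 j (fst p) (snd p))"
  unfolding duhamel1_def
  by (rule avg_divide_sqrt_regular(1)) (auto intro: decay_gauss1 continuous_intros)

lemma continuous_avg_divide:
  assumes "gauss_decay G" "(\<integral>z. G z \<partial>lborel) = 0"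
  shows "continuous_on (UNIV \<times> {0<..<T})
    (\<lambda>p. snd p * (\<integral>\<theta>. avg G (fst p) (snd p) (snd p * \<theta>) / (snd p * \<theta>) \<partial>unit_measure))"
  using assms by (intro avg_divide_regular(1)) auto

lemma duhamel2_continuous: "continuous_on (UNIV \<times> {0<..<T}) (\<lambda>p. duhamel2 i j (fst p) (snd p))"
  unfolding duhamel2_def by (rule continuous_avg_divide[OF decay_gauss2 integral_gauss2])

lemma duhamel_lap_continuous: "continuous_on (UNIV \<times> {0<..<T}) (\<lambda>p. duhamel_lap (fst p) (snd p))"
  unfolding duhamel_lap_def by (rule continuous_avg_divide[OF decay_gauss_lap integral_gauss_lap])

lemma integrable_avg_divide:
  assumes "gauss_decay G" "(\<integral>z. G z \<partial>lborel) = 0" "0 < t"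
  shows "integrable unit_measure (\<lambda>\<theta>. t * (avg G x t (t * \<theta>) / (t * \<theta>)))"
  using assms by (intro avg_divide_regular(2)) auto

lemma integrable_avg_divide_sqrt:
  assumes "gauss_decay G" "0 < t"
  shows "integrable unit_measure (\<lambda>\<theta>. t * (avg G x t (t * \<theta>) / sqrt (t * \<theta>)))"
  using assms by (intro avg_divide_sqrt_regular(2)) (auto intro: continuous_intros)

lemma integrable_avg:
  assumes "gauss_decay G"
  shows "integrable unit_measure (\<lambda>\<theta>. avg G x t (t * \<theta>))"
proof (rule Bochner_Integration.integrable_bound[OF integrable_unit_const])
  show "AE \<theta> in unit_measure. norm (avg G x t (t * \<theta>)) \<le> norm (B * (\<integral>z. \<bar>G z\<bar> \<partial>lborel))"
    unfolding real_norm_def using assms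
    by (intro AE_unit order_trans[OF avg_bound abs_ge_self]) auto
qed (intro avg_measurable assms)

text \<open>\<open>gauss_lap\<close>, the weight of the time derivative, is the trace of the weights
  \<open>gauss2\<close>. Here the heat equation for the kernel becomes the one for the Duhamel
  integral.\<close>

lemma duhamel_lap_eq:
  assumes "0 < t"
  shows "duhamel_lap x t = (\<Sum>i\<in>UNIV. duhamel2 i i x t)"
proof -
  have "duhamel_lap x t = (\<integral>\<theta>. (\<Sum>i\<in>UNIV. t * (avg (gauss2 i i) x t (t * \<theta>) / (t * \<theta>))) \<partial>unit_measure)"
    by (simp add: duhamel_lap_def avg_gauss_lap sum_divide_distrib sum_distrib_left flip: integral_mult_right_zero)
  also have "\<dots> = (\<Sum>i\<in>UNIV. \<integral>\<theta>. t * (avg (gauss2 i i) x t (t * \<theta>) / (t * \<theta>)) \<partial>unit_measure)"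
    using assms by (intro Bochner_Integration.integral_sum integrable_avg_divide decay_gauss2 integral_gauss2)
  finally show ?thesis by (simp only: duhamel2_def integral_mult_right_zero)
qed

lemma duhamel_has_derivative:
  assumes "0 < t"
  shows "((\<lambda>s. duhamel (x + s *\<^sub>R axis i 1) t) has_real_derivative duhamel1 i x t) (at 0)"
proof -
  have "((\<lambda>s. \<integral>\<theta>. t * avg gauss (x + s *\<^sub>R axis i 1) t (t * \<theta>) \<partial>unit_measure) has_real_derivative
      (\<integral>\<theta>. t * (avg (gauss1 i) (x + 0 *\<^sub>R axis i 1) t (t * \<theta>) / sqrt (t * \<theta>)) \<partial>unit_measure)) (at 0)"
  proof (rule has_real_derivative_lebesgue_integral[where r=1
        and F'="\<lambda>s \<theta>. t * (avg (gauss1 i) (x + s *\<^sub>R axis i 1) t (t * \<theta>) / sqrt (t * \<theta>))"])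
    show "AE \<theta> in unit_measure. \<forall>s. \<bar>s - 0\<bar> < 1 \<longrightarrow>
      ((\<lambda>s. t * avg gauss (x + s *\<^sub>R axis i 1) t (t * \<theta>)) has_real_derivative
        t * (avg (gauss1 i) (x + s *\<^sub>R axis i 1) t (t * \<theta>) / sqrt (t * \<theta>))) (at s) \<and>
      \<bar>t * (avg (gauss1 i) (x + s *\<^sub>R axis i 1) t (t * \<theta>) / sqrt (t * \<theta>))\<bar>
        \<le> B * (\<integral>z. \<bar>gauss1 i z\<bar> \<partial>lborel) * sqrt t / sqrt \<theta>"
      using assms
      by (intro AE_unit allI impI conjI DERIV_cmult avg_has_derivative avg_divide_sqrt_bound
          decay_gauss decay_gauss1 gauss_has_derivative) auto
    show "(\<lambda>\<theta>. t * (avg (gauss1 i) (x + 0 *\<^sub>R axis i 1) t (t * \<theta>) / sqrt (t * \<theta>))) \<in> borel_measurable unit_measure"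
      using assms by (intro borel_measurable_integrable integrable_avg_divide_sqrt decay_gauss1)
  qed (auto intro!: integrable_mult_right integrable_avg decay_gauss
      integrable_unit_inverse_sqrt)
  then show ?thesis by (simp only: duhamel_def duhamel1_def integral_mult_right_zero scaleR_zero_left add_0_right)
qed

lemma duhamel1_has_derivative:
  assumes "0 < t"
  shows "((\<lambda>s. duhamel1 j (x + s *\<^sub>R axis i 1) t) has_real_derivative duhamel2 i j x t) (at 0)"
proof -
  have sq: "a / sqrt r / sqrt r = a / r" if "0 < r" for a r
    using that by simp
  have "((\<lambda>s. \<integral>\<theta>. t * (avg (gauss1 j) (x + s *\<^sub>R axis i 1) t (t * \<theta>) / sqrt (t * \<theta>)) \<partial>unit_measure) has_real_derivative
      (\<integral>\<theta>. t * (avg (gauss2 i j) (x + 0 *\<^sub>R axis i 1) t (t * \<theta>) / (t * \<theta>)) \<partial>unit_measure)) (at 0)"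
  proof (rule has_real_derivative_lebesgue_integral[where r=1
        and F'="\<lambda>s \<theta>. t * (avg (gauss2 i j) (x + s *\<^sub>R axis i 1) t (t * \<theta>) / (t * \<theta>))"])
    have "((\<lambda>s. t * (avg (gauss1 j) (x + s *\<^sub>R axis i 1) t (t * \<theta>) / sqrt (t * \<theta>))) has_real_derivative
        t * (avg (gauss2 i j) (x + s *\<^sub>R axis i 1) t (t * \<theta>) / (t * \<theta>))) (at s)" if "0 < \<theta>" for s \<theta>
    proof -
      have "0 < t * \<theta>" using assms that by simp
      show ?thesis
        by (rule DERIV_cong[OF DERIV_cmult[OF DERIV_cdivide[OF
              avg_has_derivative[OF decay_gauss1 decay_gauss2 gauss1_has_derivative \<open>0 < t * \<theta>\<close>]]]])
          (simp only: sq[OF \<open>0 < t * \<theta>\<close>])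
    qed
    then show "AE \<theta> in unit_measure. \<forall>s. \<bar>s - 0\<bar> < 1 \<longrightarrow>
      ((\<lambda>s. t * (avg (gauss1 j) (x + s *\<^sub>R axis i 1) t (t * \<theta>) / sqrt (t * \<theta>))) has_real_derivative
        t * (avg (gauss2 i j) (x + s *\<^sub>R axis i 1) t (t * \<theta>) / (t * \<theta>))) (at s) \<and>
      \<bar>t * (avg (gauss2 i j) (x + s *\<^sub>R axis i 1) t (t * \<theta>) / (t * \<theta>))\<bar>
        \<le> \<Lambda> t * moment (gauss2 i j) * sqrt t / sqrt \<theta>"
      using assms
      by (intro AE_unit allI impI conjI avg_divide_bound
          decay_gauss2 integral_gauss2) auto
    show "(\<lambda>\<theta>. t * (avg (gauss2 i j) (x + 0 *\<^sub>R axis i 1) t (t * \<theta>) / (t * \<theta>))) \<in> borel_measurable unit_measure"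
      using assms by (intro borel_measurable_integrable integrable_avg_divide decay_gauss2 integral_gauss2)
    show "integrable unit_measure (\<lambda>\<theta>. t * (avg (gauss1 j) (x + s *\<^sub>R axis i 1) t (t * \<theta>) / sqrt (t * \<theta>)))" for s
      using assms by (intro integrable_avg_divide_sqrt decay_gauss1)
  qed (auto intro: integrable_unit_inverse_sqrt)
  then show ?thesis by (simp only: duhamel1_def duhamel2_def integral_mult_right_zero scaleR_zero_left add_0_right)
qed

end

section \<open>The time derivative of the Duhamel integral\<close>

lemma set_integrable_divide_sqrt: "set_integrable lborel {0<..<t} (\<lambda>r. C / sqrt r)"
  using set_integrable_mult_right[OF integrable_inverse_sqrt, of t C] by simp

context heat_source
begin

lemma avg_gauss_lap_divide_bound:
  assumes "s < \<sigma>" "s \<le> T"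
  shows "\<bar>avg gauss_lap x \<sigma> (\<sigma> - s) / (\<sigma> - s)\<bar>
    \<le> \<Lambda> T * moment gauss_lap / sqrt (\<sigma> - s)"
proof -
  define C where "C = \<Lambda> T * moment gauss_lap"
  have "\<bar>avg gauss_lap x \<sigma> (\<sigma> - s)\<bar> / (\<sigma> - s) \<le> C * sqrt (\<sigma> - s) / (\<sigma> - s)"
    unfolding C_def using assms
    by (intro divide_right_mono avg_lipschitz_bound decay_gauss_lap integral_gauss_lap) auto
  also have "\<dots> = C / sqrt (\<sigma> - s)"
    using assms real_div_sqrt[of "\<sigma> - s"] by (simp add: field_simps)
  finally show ?thesis using assms by (simp add: C_def)
qed

text \<open>Fundamental theorem of calculus for the heat semigroup started at time \<open>s\<close>
  from the slice of \<open>h\<close> at \<open>s\<close>. At \<sigma> = s only continuity of the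
  primitive is used; its value there is \<open>h x s\<close>, and the derivative is integrable up to
  that endpoint by the Lipschitz bound.\<close>

lemma avg_gauss_increment:
  assumes "0 < s" "s < t"
  shows "(\<integral>\<sigma>. indicator {s<..<t} \<sigma> * (avg gauss_lap x \<sigma> (\<sigma> - s) / (\<sigma> - s)) \<partial>lborel)
    = avg gauss x t (t - s) - h x s"
proof -
  define \<phi> where "\<phi> \<sigma> = avg gauss_lap x \<sigma> (\<sigma> - s) / (\<sigma> - s)" for \<sigma>
  define C where "C = \<Lambda> s * moment gauss_lap"
  have "0 \<le> C" unfolding C_def by (intro mult_nonneg_nonneg \<Lambda>_nonneg moment_nonneg)
  have "(\<phi> has_integral (avg gauss x t (t - s) - avg gauss x s (s - s))) {s..t}"
  proof (rule fundamental_theorem_of_calculus_interior)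
    show "continuous_on {s..t} (\<lambda>\<sigma>. avg gauss x \<sigma> (\<sigma> - s))"
      by (intro avg_continuous decay_gauss continuous_intros)
    fix \<sigma> assume \<sigma>: "\<sigma> \<in> {s<..<t}"
    have "((\<lambda>\<tau>. gauss_avg gauss \<tau> (\<lambda>y. h y s) x) has_real_derivative
        gauss_avg gauss_lap (\<sigma> - s) (\<lambda>y. h y s) x / (\<sigma> - s)) (at (\<sigma> - s))"
      using \<sigma> by (intro gauss_avg_has_derivative_time[where B=B] continuous_slice bounded) auto
    then have "((\<lambda>\<sigma>. gauss_avg gauss (\<sigma> - s) (\<lambda>y. h y s) x) has_real_derivative
        gauss_avg gauss_lap (\<sigma> - s) (\<lambda>y. h y s) x / (\<sigma> - s)) (at \<sigma>)"
      using DERIV_shift[of "\<lambda>\<tau>. gauss_avg gauss \<tau> (\<lambda>y. h y s) x" _ \<sigma> "-s"] by simp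
    then show "((\<lambda>\<sigma>. avg gauss x \<sigma> (\<sigma> - s)) has_vector_derivative \<phi> \<sigma>) (at \<sigma>)"
      by (simp add: avg_def \<phi>_def has_real_derivative_iff_has_vector_derivative)
  qed (use assms in auto)
  moreover have "avg gauss x s (s - s) = h x s"
    by (simp add: avg_def gauss_avg_def integral_gauss)
  ultimately have hi: "(\<phi> has_integral (avg gauss x t (t - s) - h x s)) {s..t}" by simp
  have "set_integrable lborel {s<..<t} \<phi>"
    unfolding set_integrable_def
  proof (rule Bochner_Integration.integrable_bound)
    have "set_integrable lborel {0<..<t - s} (\<lambda>r. C / sqrt r)"
      by (rule set_integrable_divide_sqrt)
    then have "integrable lborel (\<lambda>r. indicator {0<..<t - s} r * (C / sqrt r))"
      by (simp add: set_integrable_def)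
    from lborel_integrable_real_affine[OF this, of 1 "-s"]
    show "integrable lborel (\<lambda>\<sigma>. indicator {0<..<t - s} (- s + 1 * \<sigma>) * (C / sqrt (- s + 1 * \<sigma>)))"
      by simp
    have "continuous_on UNIV (\<lambda>\<sigma>. avg gauss_lap x \<sigma> (\<sigma> - s))"
      by (intro avg_continuous decay_gauss_lap continuous_intros)
    note [measurable] = borel_measurable_continuous_onI[OF this]
    show "(\<lambda>\<sigma>. indicator {s<..<t} \<sigma> *\<^sub>R \<phi> \<sigma>) \<in> borel_measurable lborel"
      unfolding \<phi>_def by measurable
    have "\<bar>\<phi> \<sigma>\<bar> \<le> C / sqrt (\<sigma> - s)" if "s < \<sigma>" for \<sigma>
      unfolding \<phi>_def C_def using that by (intro avg_gauss_lap_divide_bound) auto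
    then show "AE \<sigma> in lborel. norm (indicator {s<..<t} \<sigma> *\<^sub>R \<phi> \<sigma>)
        \<le> norm (indicator {0<..<t - s} (- s + 1 * \<sigma>) * (C / sqrt (- s + 1 * \<sigma>)))"
      using \<open>0 \<le> C\<close> by (auto simp: indicator_def)
  qed
  from set_borel_integral_eq_integral(2)[OF this]
  have "(\<integral>\<sigma>. indicator {s<..<t} \<sigma> * \<phi> \<sigma> \<partial>lborel) = integral {s<..<t} \<phi>"
    by (simp add: set_lebesgue_integral_def)
  also have "\<dots> = integral {s..t} \<phi>" by (rule integral_open_interval_real[symmetric])
  also have "\<dots> = avg gauss x t (t - s) - h x s" by (rule integral_unique[OF hi])
  finally show ?thesis by (simp add: \<phi>_def)
qed

text \<open>Exchanging the order of integration in the increments of the semigroup exhibits \<open>duhamel\<close> as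
  the primitive of a continuous function, although the kernel is singular at \<open>s = t\<close>.\<close>

lemma duhamel_eq_integral:
  assumes "0 < t"
  shows "duhamel x t = (\<integral>\<sigma>. indicator {0<..<t} \<sigma> * (h x \<sigma> + duhamel_lap x \<sigma>) \<partial>lborel)"
    and "integrable lborel (\<lambda>\<sigma>. indicator {0<..<t} \<sigma> * (h x \<sigma> + duhamel_lap x \<sigma>))"
proof -
  have ind_int: "integrable lborel (indicat_real {0<..<t})"
    by (rule integrable_real_indicator) (use assms in auto)
  define a where "a s \<sigma> = avg gauss_lap x \<sigma> (\<sigma> - s) / (\<sigma> - s)" for s \<sigma>
  \<comment> \<open>On the triangle 0 < s < \<sigma> < t, integrating over \<sigma> gives the
    increments of the semigroup (\<open>inner1\<close>), while integrating over s gives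
    \<open>duhamel_lap\<close> at time \<sigma> (\<open>inner2\<close>).\<close>
  define k where "k = (\<lambda>(s, \<sigma>). indicator {p :: real \<times> real. 0 < fst p \<and> fst p < snd p \<and> snd p < t} (s, \<sigma>) * a s \<sigma>)"
  define C where "C = \<Lambda> t * moment gauss_lap"
  have "0 \<le> C" unfolding C_def by (intro mult_nonneg_nonneg \<Lambda>_nonneg moment_nonneg)
  define g where "g r = indicator {0<..<t} r * (C / sqrt r)" for r
  have "set_integrable lborel {0<..<t} (\<lambda>r. C / sqrt r)"
    by (rule set_integrable_divide_sqrt)
  then have g_int: "integrable lborel g"
    by (simp add: set_integrable_def g_def[abs_def])
  have [measurable]: "g \<in> borel_measurable borel" unfolding g_def by measurable
  \<comment> \<open>A majorant of \<open>k\<close> in convolution form: by translation its integral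
    over \<sigma> is the same for all s in (0, t), so the iterated integral is finite and Fubini
    applies to \<open>k\<close>.\<close>
  define K where "K = (\<lambda>(s, \<sigma>). indicator {0<..<t} s * g (\<sigma> - s))"
  have "continuous_on UNIV (\<lambda>p :: real \<times> real. avg gauss_lap x (snd p) (snd p - fst p))"
    by (intro avg_continuous decay_gauss_lap continuous_intros)
  from borel_measurable_continuous_onI[OF this]
  have [measurable]: "(\<lambda>p :: real \<times> real. avg gauss_lap x (snd p) (snd p - fst p)) \<in> borel_measurable (lborel \<Otimes>\<^sub>M lborel)"
    by (simp add: borel_prod lborel_prod)
  have "open {p :: real \<times> real. 0 < fst p \<and> fst p < snd p \<and> snd p < t}"
    by (intro open_Collect_conj open_Collect_less continuous_intros)
  then have [measurable]: "{p :: real \<times> real. 0 < fst p \<and> fst p < snd p \<and> snd p < t} \<in> sets (lborel \<Otimes>\<^sub>M lborel)"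
    by (simp only: lborel_prod sets_lborel borel_open)
  have k_meas: "k \<in> borel_measurable (lborel \<Otimes>\<^sub>M lborel)"
    unfolding k_def a_def case_prod_beta prod.collapse by measurable
  have K_int: "integrable (lborel \<Otimes>\<^sub>M lborel) K"
  proof (rule lborel_pair.Fubini_integrable)
    show "K \<in> borel_measurable (lborel \<Otimes>\<^sub>M lborel)" unfolding K_def by measurable
    have shift: "integrable lborel (\<lambda>\<sigma>. g (\<sigma> - s))" for s
      using lborel_integrable_real_affine[OF g_int, of 1 "-s"] by simp
    then show "AE s in lborel. integrable lborel (\<lambda>\<sigma>. K (s, \<sigma>))"
      by (simp add: K_def)
    have "(\<integral>\<sigma>. norm (K (s, \<sigma>)) \<partial>lborel) = indicator {0<..<t} s * (\<integral>r. \<bar>g r\<bar> \<partial>lborel)" for s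
      using lborel_integral_real_affine[of 1 "\<lambda>r. \<bar>g r\<bar>" "-s"] by (simp add: K_def abs_mult)
    with ind_int show "integrable lborel (\<lambda>s. \<integral>\<sigma>. norm (K (s, \<sigma>)) \<partial>lborel)" by simp
  qed
  have k_int: "integrable (lborel \<Otimes>\<^sub>M lborel) k"
  proof (rule Bochner_Integration.integrable_bound[OF K_int k_meas])
    have "\<bar>a s \<sigma>\<bar> \<le> C / sqrt (\<sigma> - s)" if "s < \<sigma>" "\<sigma> < t" for s \<sigma>
      unfolding a_def C_def using that by (intro avg_gauss_lap_divide_bound) auto
    then have "norm (k (s, \<sigma>)) \<le> norm (K (s, \<sigma>))" for s \<sigma>
      using \<open>0 \<le> C\<close> by (auto simp: k_def K_def g_def indicator_def)
    then show "AE p in lborel \<Otimes>\<^sub>M lborel. norm (k p) \<le> norm (K p)"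
      by (intro AE_I2) (metis surj_pair)
  qed
  have inner1: "(\<integral>\<sigma>. k (s, \<sigma>) \<partial>lborel) = indicator {0<..<t} s * (avg gauss x t (t - s) - h x s)" for s
  proof (cases "0 < s \<and> s < t")
    case True
    then have "k (s, \<sigma>) = indicator {s<..<t} \<sigma> * (avg gauss_lap x \<sigma> (\<sigma> - s) / (\<sigma> - s))" for \<sigma>
      by (auto simp: k_def a_def indicator_def)
    then show ?thesis using avg_gauss_increment[of s t] True by simp
  next
    case False
    then have "k (s, \<sigma>) = 0" for \<sigma> by (auto simp: k_def indicator_def)
    then show ?thesis using False by (simp add: indicator_def)
  qed
  have inner2: "(\<integral>s. k (s, \<sigma>) \<partial>lborel) = indicator {0<..<t} \<sigma> * duhamel_lap x \<sigma>" for \<sigma>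
  proof (cases "0 < \<sigma> \<and> \<sigma> < t")
    case True
    then have "k (s, \<sigma>) = indicator {0<..<\<sigma>} s * a s \<sigma>" for s
      by (auto simp: k_def indicator_def)
    then have "(\<integral>s. k (s, \<sigma>) \<partial>lborel) = (\<integral>s. indicator {0<..<\<sigma>} s * a s \<sigma> \<partial>lborel)" by simp
    also have "\<dots> = \<sigma> * (\<integral>\<theta>. a (\<sigma> - \<sigma> * \<theta>) \<sigma> \<partial>unit_measure)"
      by (rule integral_unit_reflect) (use True in simp)
    also have "\<dots> = duhamel_lap x \<sigma>" unfolding duhamel_lap_def a_def by (simp add: mult.commute)
    finally show ?thesis using True by simp
  next
    case False
    then have "k (s, \<sigma>) = 0" for s by (auto simp: k_def indicator_def)
    then show ?thesis using False by (simp add: indicator_def)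
  qed
  have "(\<integral>\<sigma>. indicator {0<..<t} \<sigma> * duhamel_lap x \<sigma> \<partial>lborel)
      = (\<integral>s. indicator {0<..<t} s * (avg gauss x t (t - s) - h x s) \<partial>lborel)"
    using lborel_pair.Fubini_integral[of "\<lambda>s \<sigma>. k (s, \<sigma>)"] k_int by (simp add: inner1 inner2)
  moreover have i1: "integrable lborel (\<lambda>s. indicator {0<..<t} s * (avg gauss x t (t - s)))"
  proof (rule Bochner_Integration.integrable_bound)
    show "integrable lborel (\<lambda>s. indicator {0<..<t} s * (B * (\<integral>z. \<bar>gauss (z::real^'n)\<bar> \<partial>lborel)))"
      using ind_int by simp
    have "continuous_on UNIV (\<lambda>s. avg gauss x t (t - s))"
      by (intro avg_continuous decay_gauss continuous_intros)
    from borel_measurable_continuous_onI[OF this]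
    show "(\<lambda>s. indicator {0<..<t} s * (avg gauss x t (t - s))) \<in> borel_measurable lborel" by simp
    have "\<bar>avg gauss x t (t - s)\<bar> \<le> \<bar>B * (\<integral>z. \<bar>gauss (z::real^'n)\<bar> \<partial>lborel)\<bar>" for s
      by (rule order_trans[OF avg_bound[OF decay_gauss] abs_ge_self])
    then show "AE s in lborel. norm (indicator {0<..<t} s * (avg gauss x t (t - s)))
        \<le> norm (indicator {0<..<t} s * (B * (\<integral>z. \<bar>gauss (z::real^'n)\<bar> \<partial>lborel)))"
      by (auto simp: indicator_def)
  qed
  moreover have i2: "integrable lborel (\<lambda>s. indicator {0<..<t} s * h x s)"
  proof (rule Bochner_Integration.integrable_bound)
    show "integrable lborel (\<lambda>s. indicator {0<..<t} s * B)" using ind_int by simp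
    have "continuous_on UNIV (\<lambda>s. h x s)" by (intro continuous_h continuous_intros)
    from borel_measurable_continuous_onI[OF this]
    show "(\<lambda>s. indicator {0<..<t} s * h x s) \<in> borel_measurable lborel" by simp
    show "AE s in lborel. norm (indicator {0<..<t} s * h x s) \<le> norm (indicator {0<..<t} s * B)"
      using order_trans[OF bounded abs_ge_self] by (auto simp: indicator_def)
  qed
  moreover have i3: "integrable lborel (\<lambda>\<sigma>. indicator {0<..<t} \<sigma> * duhamel_lap x \<sigma>)"
    using lborel_pair.integrable_snd[of "\<lambda>s \<sigma>. k (s, \<sigma>)"] k_int by (simp add: inner2)
  moreover have "(\<integral>s. indicator {0<..<t} s * avg gauss x t (t - s) \<partial>lborel) = duhamel x t"
    using integral_unit_reflect[OF assms, of "\<lambda>s. avg gauss x t (t - s)"]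
    by (simp add: duhamel_def)
  ultimately show "duhamel x t = (\<integral>\<sigma>. indicator {0<..<t} \<sigma> * (h x \<sigma> + duhamel_lap x \<sigma>) \<partial>lborel)"
    by (simp add: distrib_left right_diff_distrib)
  show "integrable lborel (\<lambda>\<sigma>. indicator {0<..<t} \<sigma> * (h x \<sigma> + duhamel_lap x \<sigma>))"
    using i2 i3 by (simp add: distrib_left)
qed

text \<open>The integrand is known to be continuous only at positive times. The primitive is
  therefore restarted at \<open>e = t / 2\<close>, with the contribution of earlier times frozen in
  the constant \<open>duhamel x e\<close>.\<close>

lemma duhamel_has_derivative_time:
  assumes "0 < t"
  shows "(duhamel x has_real_derivative h x t + duhamel_lap x t) (at t)"
proof -
  define q where "q \<sigma> = h x \<sigma> + duhamel_lap x \<sigma>" for \<sigma>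
  define T where "T = 2 * t"
  define e where "e = t / 2"
  have e: "0 < e" "e < t" "t < T" using assms by (auto simp: e_def T_def)
  have "continuous_on {0<..<T+1} (\<lambda>\<sigma>. duhamel_lap (fst (x, \<sigma>)) (snd (x, \<sigma>)))"
    by (rule continuous_on_compose2[OF duhamel_lap_continuous[of "T+1"]]) (auto intro!: continuous_intros)
  then have "continuous_on {0<..<T+1} q"
    unfolding q_def by (intro continuous_intros continuous_h) auto
  then have qc: "continuous_on {e..T} q" by (rule continuous_on_subset) (use e in auto)
  have eq: "duhamel x s = duhamel x e + integral {e..s} q" if "s \<in> {e<..<T}" for s
  proof -
    have s: "0 < s" "e < s" using that e by auto
    have "set_integrable lborel {0<..<s} q"
      using duhamel_eq_integral(2)[OF s(1), of x] by (simp add: set_integrable_def q_def)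
    then have 1: "set_integrable lborel {e..<s} q"
      by (rule set_integrable_subset) (use e in auto)
    have 2: "set_integrable lborel {0<..<e} q"
      using duhamel_eq_integral(2)[OF e(1), of x] by (simp add: set_integrable_def q_def)
    have "duhamel x s = (LINT \<sigma>:{0<..<s}|lborel. q \<sigma>)"
      using duhamel_eq_integral(1)[OF s(1)] by (simp add: set_lebesgue_integral_def q_def)
    also have "{0<..<s} = {0<..<e} \<union> {e..<s}" using e s by auto
    also have "(LINT \<sigma>:{0<..<e} \<union> {e..<s}|lborel. q \<sigma>)
        = (LINT \<sigma>:{0<..<e}|lborel. q \<sigma>) + (LINT \<sigma>:{e..<s}|lborel. q \<sigma>)"
      by (rule set_integral_Un[OF _ 2 1]) auto
    also have "(LINT \<sigma>:{0<..<e}|lborel. q \<sigma>) = duhamel x e"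
      using duhamel_eq_integral(1)[OF e(1)] by (simp add: set_lebesgue_integral_def q_def)
    also have "(LINT \<sigma>:{e..<s}|lborel. q \<sigma>) = integral {e..<s} q"
      by (rule set_borel_integral_eq_integral(2)[OF 1])
    also have "\<dots> = integral {e..s} q"
      by (rule integral_spike_set) (auto intro: negligible_subset[of "{s}"])
    finally show ?thesis .
  qed
  have "((\<lambda>s. integral {e..s} q) has_real_derivative q t) (at t within {e..T})"
    by (rule integral_has_real_derivative[OF qc]) (use e in auto)
  moreover have "at t within {e..T} = at t"
    using e by (intro at_within_interior) auto
  ultimately have "((\<lambda>s. integral {e..s} q) has_real_derivative q t) (at t)" by simp
  then have "((\<lambda>s. duhamel x e + integral {e..s} q) has_real_derivative q t) (at t)"
    by (auto intro!: derivative_eq_intros)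
  then show ?thesis
    unfolding q_def[symmetric]
    by (rule has_field_derivative_transform_within_open[where S="{e<..<T}"]) (use e eq in auto)
qed

end

section \<open>Classical solutions for a bounded Lipschitz nonlinearity\<close>

context heat_source
begin

text \<open>\<open>gauss\<close> is a probability density, so a uniform bound on the difference of
  two slices passes to the averages with constant exactly 1.\<close>

lemma avg_diff_bound:
  assumes h2: "heat_source h2 B2 \<Lambda>2"
    and diff: "\<And>z. \<bar>h (x + z) (t - \<tau>) - h2 (y + z) (t - \<tau>)\<bar> \<le> M"
  shows "\<bar>avg gauss x t \<tau> - heat_source.avg h2 gauss y t \<tau>\<bar> \<le> M"
proof -
  interpret h2: heat_source h2 B2 \<Lambda>2 by (rule h2)
  define k1 where "k1 z = h (x + sqrt \<tau> *\<^sub>R z) (t - \<tau>)" for z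
  define k2 where "k2 z = h2 (y + sqrt \<tau> *\<^sub>R z) (t - \<tau>)" for z
  have m: "k1 \<in> borel_measurable borel" "k2 \<in> borel_measurable borel"
    unfolding k1_def k2_def
    by (intro borel_measurable_continuous_onI continuous_h h2.continuous_h continuous_intros)+
  have int: "integrable lborel (\<lambda>z. gauss z * k1 z)" "integrable lborel (\<lambda>z. gauss z * k2 z)"
    using integrable_gauss_decay_mult[OF decay_gauss m(1), of B]
      integrable_gauss_decay_mult[OF decay_gauss m(2), of B2]
    by (auto simp: k1_def k2_def bounded h2.bounded)
  have "avg gauss x t \<tau> - h2.avg gauss y t \<tau> = (\<integral>z. gauss z * (k1 z - k2 z) \<partial>lborel)"
    using int by (simp add: avg_def h2.avg_def gauss_avg_def k1_def k2_def right_diff_distrib)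
  also have "\<bar>\<dots>\<bar> \<le> M * (\<integral>z. \<bar>gauss (z::real^'n)\<bar> \<partial>lborel)"
  proof (rule gaussian_integral_bound[OF decay_gauss])
    show "(\<lambda>z. k1 z - k2 z) \<in> borel_measurable borel" using m by simp
    show "\<bar>k1 z - k2 z\<bar> \<le> M" for z by (simp add: k1_def k2_def diff)
  qed
  also have "\<dots> = M"
    using integral_gauss[where 'a='n] gauss_pos[where 'n='n] by (simp add: abs_of_pos)
  finally show ?thesis .
qed

text \<open>Integrating the exponential over (0, t) gains the factor 1 / \<kappa>. Two sources and
  two base points are allowed at once: one source at \<open>x\<close> and \<open>y\<close> gives the
  Lipschitz bound of the iteration, two sources at the same point give the contraction.\<close>

lemma duhamel_diff_bound:
  assumes h2: "heat_source h2 B2 \<Lambda>2" and "0 < \<kappa>" "0 \<le> t" "0 \<le> M"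
    and diff: "\<And>z s. 0 \<le> s \<Longrightarrow> s \<le> t \<Longrightarrow> \<bar>h (x + z) s - h2 (y + z) s\<bar> \<le> M * exp (\<kappa> * s)"
  shows "\<bar>duhamel x t - heat_source.duhamel h2 y t\<bar> \<le> M * (exp (\<kappa> * t) - 1) / \<kappa>"
proof (cases "t = 0")
  case True
  then show ?thesis by (simp add: duhamel_def heat_source.duhamel_def[OF h2])
next
  case False
  with \<open>0 \<le> t\<close> have "0 < t" by simp
  interpret h2: heat_source h2 B2 \<Lambda>2 by (rule h2)
  have m: "(\<lambda>\<theta>. M * exp (\<kappa> * (t - t * \<theta>))) \<in> borel_measurable unit_measure"
    by (intro measurable_unit) measurable
  have int3: "integrable unit_measure (\<lambda>\<theta>. M * exp (\<kappa> * (t - t * \<theta>)))"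
  proof (rule Bochner_Integration.integrable_bound[OF integrable_unit_const m])
    have "M * exp (\<kappa> * (t - t * \<theta>)) \<le> M * exp (\<kappa> * t)" if "0 < \<theta>" for \<theta>
      using assms that by (intro mult_left_mono) auto
    then show "AE \<theta> in unit_measure. norm (M * exp (\<kappa> * (t - t * \<theta>))) \<le> norm (M * exp (\<kappa> * t))"
      using assms by (intro AE_unit) (auto simp: abs_mult)
  qed
  have int: "integrable unit_measure (\<lambda>\<theta>. avg gauss x t (t * \<theta>))"
    "integrable unit_measure (\<lambda>\<theta>. h2.avg gauss y t (t * \<theta>))"
    by (intro integrable_avg h2.integrable_avg decay_gauss)+
  have "duhamel x t - h2.duhamel y t = t * (\<integral>\<theta>. avg gauss x t (t * \<theta>) - h2.avg gauss y t (t * \<theta>) \<partial>unit_measure)"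
    using int by (simp add: duhamel_def h2.duhamel_def right_diff_distrib)
  then have "\<bar>duhamel x t - h2.duhamel y t\<bar> \<le> t * (\<integral>\<theta>. \<bar>avg gauss x t (t * \<theta>) - h2.avg gauss y t (t * \<theta>)\<bar> \<partial>unit_measure)"
    using integral_norm_bound[of unit_measure "\<lambda>\<theta>. avg gauss x t (t * \<theta>) - h2.avg gauss y t (t * \<theta>)"] \<open>0 < t\<close>
    by (simp add: abs_mult)
  also have "\<dots> \<le> t * (\<integral>\<theta>. M * exp (\<kappa> * (t - t * \<theta>)) \<partial>unit_measure)"
  proof (intro mult_left_mono integral_mono_AE AE_unit int3)
    show "integrable unit_measure (\<lambda>\<theta>. \<bar>avg gauss x t (t * \<theta>) - h2.avg gauss y t (t * \<theta>)\<bar>)"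
      using int by (intro integrable_abs Bochner_Integration.integrable_diff)
    fix \<theta> :: real assume "0 < \<theta>" "\<theta> < 1"
    then have "0 \<le> t - t * \<theta>" "t - t * \<theta> \<le> t" using \<open>0 < t\<close> by auto
    then show "\<bar>avg gauss x t (t * \<theta>) - h2.avg gauss y t (t * \<theta>)\<bar> \<le> M * exp (\<kappa> * (t - t * \<theta>))"
      by (intro avg_diff_bound[OF h2] diff)
  qed (use \<open>0 < t\<close> in auto)
  also have "\<dots> = (\<integral>s. indicator {0<..<t} s * (M * exp (\<kappa> * s)) \<partial>lborel)"
    by (rule integral_unit_reflect[OF \<open>0 < t\<close>, symmetric])
  also have "\<dots> = M * (exp (\<kappa> * t) - 1) / \<kappa>"
  proof -
    have hi: "((\<lambda>s. M * exp (\<kappa> * s)) has_integral (M * exp (\<kappa> * t) / \<kappa> - M * exp (\<kappa> * 0) / \<kappa>)) {0..t}"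
    proof (rule fundamental_theorem_of_calculus)
      show "((\<lambda>s. M * exp (\<kappa> * s) / \<kappa>) has_vector_derivative M * exp (\<kappa> * s)) (at s within {0..t})" for s
        unfolding has_real_derivative_iff_has_vector_derivative[symmetric]
        using \<open>0 < \<kappa>\<close> by (auto intro!: derivative_eq_intros)
    qed (use \<open>0 < t\<close> in auto)
    have "set_integrable lborel {0..t} (\<lambda>s. M * exp (\<kappa> * s))"
      by (intro borel_integrable_atLeastAtMost') (auto intro!: continuous_intros)
    then have "set_integrable lborel {0<..<t} (\<lambda>s. M * exp (\<kappa> * s))"
      by (rule set_integrable_subset) auto
    from set_borel_integral_eq_integral(2)[OF this]
    have "(\<integral>s. indicator {0<..<t} s * (M * exp (\<kappa> * s)) \<partial>lborel) = integral {0<..<t} (\<lambda>s. M * exp (\<kappa> * s))"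
      unfolding set_lebesgue_integral_def real_scaleR_def .
    also have "\<dots> = integral {0..t} (\<lambda>s. M * exp (\<kappa> * s))" by (rule integral_open_interval_real[symmetric])
    also have "\<dots> = M * exp (\<kappa> * t) / \<kappa> - M * exp (\<kappa> * 0) / \<kappa>" by (rule integral_unique[OF hi])
    finally show ?thesis by (simp add: right_diff_distrib diff_divide_distrib)
  qed
  finally show ?thesis .
qed

lemma avg_gauss_nonneg:
  assumes "\<And>x. 0 \<le> h x (t - \<tau>)"
  shows "0 \<le> avg gauss x t \<tau>"
  unfolding avg_def gauss_avg_def
  using assms gauss_pos by (intro integral_nonneg_AE AE_I2 mult_nonneg_nonneg) (auto intro: less_imp_le)

lemma duhamel_nonneg:
  assumes "\<And>x t. 0 \<le> h x t" "0 \<le> t"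
  shows "0 \<le> duhamel x t"
  unfolding duhamel_def using assms
  by (intro mult_nonneg_nonneg integral_nonneg_AE AE_I2 avg_gauss_nonneg) auto

lemma avg_gauss_bound: "\<bar>avg gauss x t \<tau>\<bar> \<le> B"
  using avg_bound[OF decay_gauss, of x t \<tau>] integral_gauss[where 'a='n] gauss_pos[where 'n='n]
  by (simp add: abs_of_pos)

lemma duhamel_bound:
  assumes "0 \<le> t"
  shows "\<bar>duhamel x t\<bar> \<le> t * B"
proof -
  have "\<bar>\<integral>\<theta>. avg gauss x t (t * \<theta>) \<partial>unit_measure\<bar> \<le> (\<integral>\<theta>. \<bar>avg gauss x t (t * \<theta>)\<bar> \<partial>unit_measure)"
    using integral_norm_bound[of unit_measure "\<lambda>\<theta>. avg gauss x t (t * \<theta>)"] by simp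
  also have "\<dots> \<le> (\<integral>\<theta>. B \<partial>unit_measure)"
    by (intro integral_mono integrable_abs integrable_avg decay_gauss integrable_unit_const avg_gauss_bound)
  also have "\<dots> = B" by (simp add: measure_restrict_space)
  finally show ?thesis using assms by (simp add: duhamel_def abs_mult mult_left_mono)
qed

end

text \<open>The unknown is \<open>v = exp (- \<kappa> t) u\<close>: with this weight Duhamel's formula is a contraction on the
  whole half-line of times. Since \<open>bcontfun\<close> consists of functions on the full type, \<open>v\<close> is
  extended to negative times by its value at time 0.\<close>

definition weighted_source ::
    "(real \<Rightarrow> real) \<Rightarrow> real \<Rightarrow> (((real ^ 'n::finite) \<times> real) \<Rightarrow>\<^sub>C real) \<Rightarrow> real ^ 'n \<Rightarrow> real \<Rightarrow> real" where
  "weighted_source g \<kappa> v x t = g (exp (\<kappa> * max t 0) * apply_bcontfun v (x, max t 0))"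

definition weighted_mild ::
    "(real \<Rightarrow> real) \<Rightarrow> real \<Rightarrow> (real ^ 'n::finite \<Rightarrow> real) \<Rightarrow> (((real ^ 'n) \<times> real) \<Rightarrow>\<^sub>C real) \<Rightarrow> (real ^ 'n) \<times> real \<Rightarrow> real" where
  "weighted_mild g \<kappa> u0 v p = exp (- \<kappa> * max (snd p) 0) *
     (gauss_avg gauss (max (snd p) 0) u0 (fst p) +
      heat_source.duhamel (weighted_source g \<kappa> v) (fst p) (max (snd p) 0))"

section \<open>The contraction on weighted Lipschitz functions and its fixed point\<close>

locale heat_cauchy =
  fixes g :: "real \<Rightarrow> real" and Bg L :: real
    and u0 :: "real ^ 'n::finite \<Rightarrow> real" and B0 \<Lambda>0 :: real
  assumes g_range: "\<And>y. 0 \<le> g y" "\<And>y. g y \<le> Bg"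
    and L_pos: "0 < L" and g_lipschitz: "\<And>y z. \<bar>g y - g z\<bar> \<le> L * \<bar>y - z\<bar>"
    and u0_range: "\<And>x. 0 \<le> u0 x" "\<And>x. u0 x \<le> B0"
    and u0_lipschitz: "\<And>x y. \<bar>u0 x - u0 y\<bar> \<le> \<Lambda>0 * norm (x - y)"
begin

text \<open>The choice makes L / \<kappa> = 1/2, which is the contraction constant.\<close>

definition \<kappa> :: real where "\<kappa> = 2 * L"

text \<open>The constant is that of the datum, for all times. The weight permits this: the
  unweighted iterate has Lipschitz constant at most \<Lambda>0 + \<Lambda>0 (exp (\<kappa> t) - 1) /
  2, which stays below \<Lambda>0 exp (\<kappa> t).\<close>

definition S :: "(((real ^ 'n) \<times> real) \<Rightarrow>\<^sub>C real) set" where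
  "S = {v. \<forall>x y t. \<bar>apply_bcontfun v (x, t) - apply_bcontfun v (y, t)\<bar> \<le> \<Lambda>0 * norm (x - y)}"

lemma \<kappa>_pos: "0 < \<kappa>" using L_pos by (simp add: \<kappa>_def)

lemma \<Lambda>0_nonneg: "0 \<le> \<Lambda>0"
  using order_trans[OF abs_ge_zero u0_lipschitz[of "axis undefined 1" 0]] by simp

lemma u0_continuous: "continuous_on UNIV u0"
proof -
  have "\<Lambda>0-lipschitz_on UNIV u0"
    using u0_lipschitz \<Lambda>0_nonneg by (intro lipschitz_onI) (auto simp: dist_norm)
  then show ?thesis by (rule lipschitz_on_continuous_on)
qed

lemma g_continuous: "continuous_on UNIV g"
proof -
  have "L-lipschitz_on UNIV g"
    using g_lipschitz L_pos by (intro lipschitz_onI) (auto simp: dist_norm)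
  then show ?thesis by (rule lipschitz_on_continuous_on)
qed

text \<open>The datum is viewed as a source constant in time, so the estimates for Gaussian averages
  also serve the semigroup acting on \<open>u0\<close>.\<close>

sublocale init: heat_source "\<lambda>x t. u0 x" B0 "\<lambda>_. \<Lambda>0"
proof
  show "continuous_on UNIV (\<lambda>p :: (real^'n) \<times> real. u0 (fst p))"
    by (intro continuous_on_compose2[OF u0_continuous] continuous_intros) auto
  show "\<bar>u0 x\<bar> \<le> B0" for x using u0_range[of x] by simp
  show "\<bar>u0 x - u0 y\<bar> \<le> \<Lambda>0 * norm (x - y)" for x y by (rule u0_lipschitz)
qed

lemma init_avg: "init.avg G x t \<tau> = gauss_avg G \<tau> u0 x"
  by (simp add: init.avg_def)

lemma heat_source_weighted:
  assumes "v \<in> S"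
  shows "heat_source (weighted_source g \<kappa> v) Bg (\<lambda>T. L * exp (\<kappa> * max T 0) * \<Lambda>0)"
proof
  have "continuous_on UNIV (\<lambda>p :: (real^'n) \<times> real. exp (\<kappa> * max (snd p) 0) * v (fst p, max (snd p) 0))"
    by (intro continuous_intros continuous_on_compose2[OF continuous_on_apply_bcontfun[of UNIV v]]) auto
  then show "continuous_on UNIV (\<lambda>p. weighted_source g \<kappa> v (fst p) (snd p))"
    unfolding weighted_source_def by (rule continuous_on_compose2[OF g_continuous]) auto
  show "\<bar>weighted_source g \<kappa> v x t\<bar> \<le> Bg" for x t
    using g_range by (simp add: weighted_source_def)
  fix T x y t assume "t \<le> (T::real)"
  have "\<bar>weighted_source g \<kappa> v x t - weighted_source g \<kappa> v y t\<bar>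
      \<le> L * \<bar>exp (\<kappa> * max t 0) * v (x, max t 0) - exp (\<kappa> * max t 0) * v (y, max t 0)\<bar>"
    unfolding weighted_source_def by (rule g_lipschitz)
  also have "\<dots> = L * exp (\<kappa> * max t 0) * \<bar>v (x, max t 0) - v (y, max t 0)\<bar>"
    by (simp add: abs_mult flip: right_diff_distrib)
  also have "\<dots> \<le> L * exp (\<kappa> * max T 0) * (\<Lambda>0 * norm (x - y))"
    using \<open>t \<le> T\<close> L_pos \<kappa>_pos assms unfolding S_def by (intro mult_mono) auto
  finally show "\<bar>weighted_source g \<kappa> v x t - weighted_source g \<kappa> v y t\<bar>
      \<le> L * exp (\<kappa> * max T 0) * \<Lambda>0 * norm (x - y)" by (simp add: mult_ac)
qed

text \<open>Without the weight the iterate grows at most like B0 + t Bg; the weight bounds it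
  because t exp (- \<kappa> t) \<le> 1 / \<kappa>.\<close>

lemma weighted_mild_bcontfun:
  assumes "v \<in> S"
  shows "weighted_mild g \<kappa> u0 v \<in> bcontfun"
proof -
  interpret h: heat_source "weighted_source g \<kappa> v" Bg "\<lambda>T. L * exp (\<kappa> * max T 0) * \<Lambda>0"
    by (rule heat_source_weighted[OF assms])
  have c1: "continuous_on UNIV (\<lambda>p :: (real^'n) \<times> real. gauss_avg gauss (max (snd p) 0) u0 (fst p))"
    unfolding init_avg[symmetric, where t=0]
    by (intro init.avg_continuous decay_gauss continuous_intros)
  have c2: "continuous_on UNIV (\<lambda>p :: (real^'n) \<times> real. h.duhamel (fst p) (max (snd p) 0))"
  proof -
    have "continuous_on UNIV (\<lambda>p :: (real^'n) \<times> real. (fst p, max (snd p) 0))"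
      by (intro continuous_intros)
    from continuous_on_compose2[OF h.duhamel_continuous this] show ?thesis by simp
  qed
  have c: "continuous_on UNIV (weighted_mild g \<kappa> u0 v)"
    unfolding weighted_mild_def[abs_def] by (intro continuous_intros c1 c2)
  have "\<bar>weighted_mild g \<kappa> u0 v p\<bar> \<le> B0 + Bg / \<kappa>" for p
  proof -
    define t where "t = max (snd p) 0"
    have "0 \<le> t" by (simp add: t_def)
    have "0 \<le> Bg" using g_range order_trans by blast
    have "0 \<le> B0" using u0_range order_trans by blast
    have "\<bar>gauss_avg gauss t u0 (fst p)\<bar> \<le> B0"
      using init.avg_gauss_bound[of "fst p" 0 t] by (simp add: init_avg)
    moreover have "\<bar>h.duhamel (fst p) t\<bar> \<le> t * Bg" by (rule h.duhamel_bound[OF \<open>0 \<le> t\<close>])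
    ultimately have "\<bar>gauss_avg gauss t u0 (fst p) + h.duhamel (fst p) t\<bar> \<le> B0 + t * Bg" by linarith
    then have "\<bar>weighted_mild g \<kappa> u0 v p\<bar> \<le> exp (- \<kappa> * t) * (B0 + t * Bg)"
      by (simp add: weighted_mild_def t_def[symmetric] abs_mult)
    also have "\<dots> = exp (- \<kappa> * t) * B0 + (t * exp (- \<kappa> * t)) * Bg" by (simp add: algebra_simps)
    also have "\<dots> \<le> 1 * B0 + (1 / \<kappa>) * Bg"
    proof (intro add_mono mult_right_mono)
      have "\<kappa> * t \<le> exp (\<kappa> * t)" using exp_ge_add_one_self[of "\<kappa> * t"] by linarith
      then show "t * exp (- \<kappa> * t) \<le> 1 / \<kappa>" using \<kappa>_pos by (simp add: exp_minus field_simps)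
    qed (use \<open>0 \<le> t\<close> \<kappa>_pos \<open>0 \<le> Bg\<close> \<open>0 \<le> B0\<close> in auto)
    finally show ?thesis by simp
  qed
  then have "bounded (range (weighted_mild g \<kappa> u0 v))"
    by (auto simp: bounded_iff)
  with c show ?thesis by (simp add: bcontfun_def)
qed

lemma init_lipschitz: "\<bar>gauss_avg gauss \<tau> u0 x - gauss_avg gauss \<tau> u0 y\<bar> \<le> \<Lambda>0 * norm (x - y)"
proof -
  have "\<bar>u0 (x + z) - u0 (y + z)\<bar> \<le> \<Lambda>0 * norm (x - y)" for z
    using u0_lipschitz[of "x + z" "y + z"] by simp
  from init.avg_diff_bound[OF init.heat_source_axioms this]
  show ?thesis by (simp only: init_avg)
qed

lemma weighted_mild_lipschitz:
  assumes "v \<in> S"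
  shows "\<bar>weighted_mild g \<kappa> u0 v (x, t) - weighted_mild g \<kappa> u0 v (y, t)\<bar> \<le> \<Lambda>0 * norm (x - y)"
proof -
  note hs = heat_source_weighted[OF assms]
  interpret h: heat_source "weighted_source g \<kappa> v" Bg "\<lambda>T. L * exp (\<kappa> * max T 0) * \<Lambda>0"
    by (rule hs)
  define s where "s = max t 0"
  define M where "M = \<Lambda>0 * norm (x - y)"
  have "0 \<le> M" using \<Lambda>0_nonneg by (simp add: M_def)
  have "\<bar>h.duhamel x s - h.duhamel y s\<bar> \<le> (L * M) * (exp (\<kappa> * s) - 1) / \<kappa>"
  proof (rule h.duhamel_diff_bound[OF hs \<kappa>_pos])
    show "0 \<le> s" by (simp add: s_def)
    show "0 \<le> L * M" using \<open>0 \<le> M\<close> L_pos by simp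
    fix z r :: _ assume "0 \<le> (r::real)"
    then show "\<bar>weighted_source g \<kappa> v (x + z) r - weighted_source g \<kappa> v (y + z) r\<bar> \<le> L * M * exp (\<kappa> * r)"
      using h.lipschitz[of r r "x + z" "y + z"] by (simp add: M_def mult_ac)
  qed
  also have "\<dots> = M * (exp (\<kappa> * s) - 1) / 2" using L_pos by (simp add: \<kappa>_def)
  also have "\<dots> \<le> M * (exp (\<kappa> * s) - 1)"
    using \<open>0 \<le> M\<close> \<kappa>_pos by (simp add: s_def)
  finally have "\<bar>(gauss_avg gauss s u0 x + h.duhamel x s) - (gauss_avg gauss s u0 y + h.duhamel y s)\<bar> \<le> M * exp (\<kappa> * s)"
    using init_lipschitz[of s x y] by (simp add: M_def algebra_simps)
  then have "exp (- \<kappa> * s) * \<bar>(gauss_avg gauss s u0 x + h.duhamel x s) - (gauss_avg gauss s u0 y + h.duhamel y s)\<bar>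
      \<le> exp (- \<kappa> * s) * (M * exp (\<kappa> * s))"
    by (rule mult_left_mono) simp
  also have "\<dots> = M" by (simp add: exp_minus)
  finally show ?thesis
    by (simp add: weighted_mild_def s_def[symmetric] M_def abs_mult flip: right_diff_distrib)
qed

lemma weighted_mild_contraction:
  assumes "v \<in> S" "w \<in> S"
  shows "\<bar>weighted_mild g \<kappa> u0 v p - weighted_mild g \<kappa> u0 w p\<bar> \<le> 1/2 * dist v w"
proof -
  note hs = heat_source_weighted[OF assms(1)] heat_source_weighted[OF assms(2)]
  interpret h: heat_source "weighted_source g \<kappa> v" Bg "\<lambda>T. L * exp (\<kappa> * max T 0) * \<Lambda>0"
    by (rule hs)
  interpret k: heat_source "weighted_source g \<kappa> w" Bg "\<lambda>T. L * exp (\<kappa> * max T 0) * \<Lambda>0"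
    by (rule hs)
  define s where "s = max (snd p) 0"
  define M where "M = dist v w"
  have "0 \<le> M" by (simp add: M_def)
  have "\<bar>h.duhamel (fst p) s - k.duhamel (fst p) s\<bar> \<le> (L * M) * (exp (\<kappa> * s) - 1) / \<kappa>"
  proof (rule h.duhamel_diff_bound[OF hs(2) \<kappa>_pos])
    show "0 \<le> s" by (simp add: s_def)
    show "0 \<le> L * M" using \<open>0 \<le> M\<close> L_pos by simp
    fix z r :: _ assume "0 \<le> (r::real)"
    let ?z = "fst p + z"
    have "\<bar>weighted_source g \<kappa> v ?z r - weighted_source g \<kappa> w ?z r\<bar>
        \<le> L * \<bar>exp (\<kappa> * max r 0) * v (?z, max r 0) - exp (\<kappa> * max r 0) * w (?z, max r 0)\<bar>"
      unfolding weighted_source_def by (rule g_lipschitz)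
    also have "\<dots> = L * exp (\<kappa> * r) * \<bar>v (?z, r) - w (?z, r)\<bar>"
      using \<open>0 \<le> r\<close> by (simp add: abs_mult flip: right_diff_distrib)
    also have "\<dots> \<le> L * exp (\<kappa> * r) * M"
      using dist_bounded[of v "(?z, r)" w] L_pos by (intro mult_left_mono) (auto simp: M_def dist_real_def)
    finally show "\<bar>weighted_source g \<kappa> v ?z r - weighted_source g \<kappa> w ?z r\<bar> \<le> L * M * exp (\<kappa> * r)"
      by (simp add: mult_ac)
  qed
  also have "\<dots> = M * (exp (\<kappa> * s) - 1) / 2" using L_pos by (simp add: \<kappa>_def)
  also have "\<dots> \<le> 1/2 * M * exp (\<kappa> * s)"
    using \<open>0 \<le> M\<close> by (simp add: right_diff_distrib)
  finally have "exp (- \<kappa> * s) * \<bar>h.duhamel (fst p) s - k.duhamel (fst p) s\<bar> \<le> exp (- \<kappa> * s) * (1/2 * M * exp (\<kappa> * s))"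
    by (rule mult_left_mono) simp
  also have "\<dots> = 1/2 * M" by (simp add: exp_minus)
  finally show ?thesis
    by (simp add: weighted_mild_def s_def[symmetric] M_def abs_mult flip: right_diff_distrib)
qed

lemma closed_S: "closed S"
  unfolding closed_sequential_limits
proof safe
  fix f l assume seq: "\<forall>n. f n \<in> S" and lim: "f \<longlonglongrightarrow> l"
  have pt: "(\<lambda>n. f n p) \<longlonglongrightarrow> l p" for p
    using tendsto_bcontfun_uniform_limit[OF lim] by (rule tendsto_uniform_limitI) simp
  show "l \<in> S"
    unfolding S_def
  proof safe
    fix x y t
    have "(\<lambda>n. \<bar>f n (x, t) - f n (y, t)\<bar>) \<longlonglongrightarrow> \<bar>l (x, t) - l (y, t)\<bar>"
      by (intro tendsto_intros pt)
    then show "\<bar>l (x, t) - l (y, t)\<bar> \<le> \<Lambda>0 * norm (x - y)"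
      by (rule LIMSEQ_le_const2) (use seq in \<open>auto simp: S_def\<close>)
  qed
qed

lemma fixed_point:
  obtains v where "v \<in> S" "\<And>p. v p = weighted_mild g \<kappa> u0 v p"
proof -
  have "\<exists>!v\<in>S. Bcontfun (weighted_mild g \<kappa> u0 v) = v"
  proof (rule Banach_fix[where c="1/2"])
    show "complete S" using closed_S by (simp add: complete_eq_closed)
    have "const_bcontfun 0 \<in> S"
      using \<Lambda>0_nonneg by (auto simp: S_def const_bcontfun.rep_eq)
    then show "S \<noteq> {}" by auto
    show "(\<lambda>v. Bcontfun (weighted_mild g \<kappa> u0 v)) ` S \<subseteq> S"
      using weighted_mild_lipschitz by (auto simp: S_def[of] Bcontfun_inverse weighted_mild_bcontfun)
    show "dist (Bcontfun (weighted_mild g \<kappa> u0 v)) (Bcontfun (weighted_mild g \<kappa> u0 w)) \<le> 1/2 * dist v w"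
      if "v \<in> S" "w \<in> S" for v w
      using weighted_mild_contraction[OF that]
      by (intro dist_bound) (simp add: Bcontfun_inverse weighted_mild_bcontfun that dist_real_def)
  qed auto
  then obtain v where "v \<in> S" "Bcontfun (weighted_mild g \<kappa> u0 v) = v" by auto
  then show ?thesis
    using that[of v] Bcontfun_inverse[OF weighted_mild_bcontfun[of v]] by simp
qed

text \<open>Every derivative of \<open>u\<close> is the sum of a semigroup part acting on the datum
  and a Duhamel part, both already computed; the equation then follows from the trace identity
  between \<open>gauss_lap\<close> and \<open>gauss2\<close>. The linear bound in time is part of
  the conclusion because comparison on the whole space needs boundedness on strips.\<close>

theorem classical_solution:
  obtains u where "\<And>T. 0 < T \<Longrightarrow> solves_heat g u0 T u" "\<And>x t. 0 \<le> t \<Longrightarrow> u x t \<le> B0 + t * Bg"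
proof -
  obtain v where v: "v \<in> S" "\<And>p. v p = weighted_mild g \<kappa> u0 v p"
    using fixed_point by blast
  interpret h: heat_source "weighted_source g \<kappa> v" Bg "\<lambda>T. L * exp (\<kappa> * max T 0) * \<Lambda>0"
    by (rule heat_source_weighted[OF v(1)])
  define u where "u x t = gauss_avg gauss t u0 x + h.duhamel x t" for x t
  \<comment> \<open>Here the fixed point enters: with the weight removed, the source that generates
    \<open>u\<close> is \<open>g\<close> evaluated at \<open>u\<close> itself.\<close>
  have hu: "weighted_source g \<kappa> v x t = g (u x t)" if "0 \<le> t" for x t
    using v(2)[of "(x, t)"] that
    by (simp add: weighted_source_def weighted_mild_def u_def exp_minus field_simps)
  define u1 where "u1 j x t = gauss_avg (gauss1 j) t u0 x / sqrt t + h.duhamel1 j x t" for j x t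
  define u2 where "u2 i j x t = gauss_avg (gauss2 i j) t u0 x / t + h.duhamel2 i j x t" for i j x t
  define ut where "ut x t = gauss_avg gauss_lap t u0 x / t + (weighted_source g \<kappa> v x t + h.duhamel_lap x t)" for x t
  have avg_cont: "continuous_on A (\<lambda>p :: (real^'n) \<times> real. gauss_avg G (snd p) u0 (fst p))"
    if "gauss_decay G" for G A
    unfolding init_avg[symmetric, where t=0]
    by (intro init.avg_continuous that continuous_intros)
  have u_cont: "continuous_on UNIV (\<lambda>p. u (fst p) (snd p))"
    unfolding u_def by (intro continuous_intros avg_cont decay_gauss h.duhamel_continuous)
  have u_nonneg: "0 \<le> u x t" if "0 \<le> t" for x t
    unfolding u_def using init.avg_gauss_nonneg[where t=0 and \<tau>=t and x=x] u0_range that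
    by (intro add_nonneg_nonneg h.duhamel_nonneg) (auto simp: init_avg weighted_source_def g_range)
  have u_le: "u x t \<le> B0 + t * Bg" if "0 \<le> t" for x t
    using init.avg_gauss_bound[of x 0 t] h.duhamel_bound[OF that, of x] by (simp add: u_def init_avg)
  have "u x 0 = u0 x" for x
    by (simp add: u_def h.duhamel_def gauss_avg_def integral_gauss)
  have du: "((\<lambda>s. u (x + s *\<^sub>R axis i 1) t) has_real_derivative u1 i x t) (at 0)" if "0 < t" for x t i
    unfolding u_def u1_def
    by (intro DERIV_add h.duhamel_has_derivative[OF that] gauss_avg_has_derivative_space[where B=B0]
        decay_gauss decay_gauss1 gauss_has_derivative u0_continuous init.bounded that)
  have du1: "((\<lambda>s. u1 j (x + s *\<^sub>R axis i 1) t) has_real_derivative u2 i j x t) (at 0)" if "0 < t" for x t i j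
  proof -
    have "((\<lambda>s. gauss_avg (gauss1 j) t u0 (x + s *\<^sub>R axis i 1)) has_real_derivative
        gauss_avg (gauss2 i j) t u0 x / sqrt t) (at 0)"
      by (intro gauss_avg_has_derivative_space[where B=B0]
        decay_gauss1 decay_gauss2 gauss1_has_derivative u0_continuous init.bounded that)
    from DERIV_add[OF DERIV_cdivide[OF this, of "sqrt t"] h.duhamel1_has_derivative[OF that]]
    have "((\<lambda>s. u1 j (x + s *\<^sub>R axis i 1) t) has_real_derivative
        gauss_avg (gauss2 i j) t u0 x / sqrt t / sqrt t + h.duhamel2 i j x t) (at 0)"
      by (simp only: u1_def)
    then show ?thesis using that by (simp add: u2_def)
  qed
  have dut: "((\<lambda>s. u x s) has_real_derivative ut x t) (at t)" if "0 < t" for x t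
    unfolding u_def ut_def
    by (intro DERIV_add h.duhamel_has_derivative_time[OF that]
        gauss_avg_has_derivative_time[OF u0_continuous init.bounded that])
  have pd1: "partial_deriv j (\<lambda>y. u y t) = (\<lambda>x. u1 j x t)" if "0 < t" for t j
    using DERIV_imp_deriv[OF du[OF that]] by (simp add: partial_deriv_def fun_eq_iff)
  have pd2: "partial_deriv i (partial_deriv j (\<lambda>y. u y t)) x = u2 i j x t" if "0 < t" for t i j x
    unfolding pd1[OF that] using DERIV_imp_deriv[OF du1[OF that]] by (simp add: partial_deriv_def)
  have pdt: "deriv (\<lambda>s. u x s) t = ut x t" if "0 < t" for x t
    using DERIV_imp_deriv[OF dut[OF that]] .
  have lap: "ut x t = (\<Sum>i\<in>UNIV. u2 i i x t) + g (u x t)" if "0 < t" for x t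
    using init.avg_gauss_lap[of x 0 t] that
    by (simp add: ut_def u2_def hu sum.distrib h.duhamel_lap_eq init_avg sum_divide_distrib)
  have sol: "solves_heat g u0 T u" if "0 < T" for T
    unfolding solves_heat_def
  proof (intro conjI ballI allI)
    show "0 \<le> u x t" if "t \<in> {0..<T}" for x t using u_nonneg that by simp
    show "continuous_on (UNIV \<times> {0..<T}) (\<lambda>(x, t). u x t)"
      unfolding case_prod_beta by (rule continuous_on_subset[OF u_cont]) auto
    show "u x 0 = u0 x" for x by fact
    show "deriv (u x) t = laplacian (\<lambda>y. u y t) x + g (u x t)" if "t \<in> {0<..<T}" for x t
      using that by (simp add: pdt lap laplacian_def pd2)
    have c2: "continuous_on (UNIV \<times> {0<..<T}) (\<lambda>p. u2 i j (fst p) (snd p))" for i j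
      unfolding u2_def
      by (intro continuous_intros avg_cont decay_gauss2 h.duhamel2_continuous) auto
    have c1: "continuous_on (UNIV \<times> {0<..<T}) (\<lambda>p. u1 j (fst p) (snd p))" for j
      unfolding u1_def
      by (intro continuous_intros avg_cont decay_gauss1 h.duhamel1_continuous) auto
    have ct: "continuous_on (UNIV \<times> {0<..<T}) (\<lambda>p. ut (fst p) (snd p))"
      unfolding ut_def
      by (intro continuous_intros avg_cont decay_gauss_lap h.duhamel_lap_continuous h.continuous_h) auto
    show "C21 T u"
      unfolding C21_def
    proof (intro conjI ballI allI)
      fix x t assume "t \<in> {0<..<T}"
      then have t: "0 < t" by simp
      show "u x field_differentiable at t"
        using dut[OF t] by (auto simp: field_differentiable_def)
      show "has_partial_deriv i (\<lambda>y. u y t) x" for i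
        using du[OF t] by (auto simp: has_partial_deriv_def field_differentiable_def)
      show "has_partial_deriv i (partial_deriv j (\<lambda>y. u y t)) x" for i j
        unfolding pd1[OF t] using du1[OF t] by (auto simp: has_partial_deriv_def field_differentiable_def)
    next
      show "continuous_on (UNIV \<times> {0<..<T}) (\<lambda>(x, t). u x t)"
        unfolding case_prod_beta by (rule continuous_on_subset[OF u_cont]) auto
      show "continuous_on (UNIV \<times> {0<..<T}) (\<lambda>(x, t). deriv (u x) t)"
        using ct by (rule continuous_on_cong[THEN iffD1, rotated 2]) (auto simp: pdt)
      show "continuous_on (UNIV \<times> {0<..<T}) (\<lambda>(x, t). partial_deriv i (\<lambda>y. u y t) x)" for i
        using c1[of i] by (rule continuous_on_cong[THEN iffD1, rotated 2]) (auto simp: pd1)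
      show "continuous_on (UNIV \<times> {0<..<T}) (\<lambda>(x, t). partial_deriv i (partial_deriv j (\<lambda>y. u y t)) x)" for i j
        using c2[of i j] by (rule continuous_on_cong[THEN iffD1, rotated 2]) (auto simp: pd2)
    qed
  qed
  show ?thesis by (rule that[OF sol u_le])
qed

end

section \<open>The explicit supersolution\<close>

text \<open>The derivatives are existentially quantified functions, in the format of the hypotheses
  of \<open>parabolic_maximum_principle\<close>; an explicit \<open>W\<close> can then supply its
  formulas directly.\<close>

definition supersolution :: "(real \<Rightarrow> real) \<Rightarrow> (real ^ 'n::finite \<Rightarrow> real \<Rightarrow> real) \<Rightarrow> bool" where
  "supersolution g W \<longleftrightarrow> continuous_on (UNIV \<times> {0..}) (\<lambda>p. W (fst p) (snd p)) \<and>
    (\<exists>Wt W1 W2. \<forall>x t. 0 < t \<longrightarrow>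
      ((\<lambda>s. W x s) has_real_derivative Wt x t) (at t) \<and>
      (\<forall>i. ((\<lambda>h. W (x + h *\<^sub>R axis i 1) t) has_real_derivative W1 i x t) (at 0)) \<and>
      (\<forall>i. ((\<lambda>h. W1 i (x + h *\<^sub>R axis i 1) t) has_real_derivative W2 i x t) (at 0)) \<and>
      (\<Sum>i\<in>UNIV. W2 i x t) + g (W x t) \<le> Wt x t)"

text \<open>Two modifications reduce the claim to the strict principle on balls. The factor exp (- k
  t) with k = L + 1 outweighs the Lipschitz term, leaving a strict surplus where u > W. The
  subtracted e (1 + |x|^2 + 2 N t) solves the heat equation, hence does not disturb the inequality,
  and it dominates the bounded \<open>u\<close> on a large sphere. Finally \<open>e\<close> tends to
  0.\<close>

lemma solution_le_supersolution:
  fixes u W :: "real ^ 'n::finite \<Rightarrow> real \<Rightarrow> real"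
  assumes sol: "\<And>T. 0 < T \<Longrightarrow> solves_heat g u0 T u"
    and u_le: "\<And>x t. 0 \<le> t \<Longrightarrow> t \<le> T \<Longrightarrow> u x t \<le> C"
    and g_lipschitz: "\<And>y z. \<bar>g y - g z\<bar> \<le> L * \<bar>y - z\<bar>"
    and W: "supersolution g W"
    and W_nonneg: "\<And>x t. 0 \<le> t \<Longrightarrow> 0 \<le> W x t"
    and initial: "\<And>x. u0 x \<le> W x 0"
    and "0 \<le> T"
  shows "u x T \<le> W x T"
proof (cases "T = 0")
  case True
  then show ?thesis using sol[of 1] initial unfolding solves_heat_def by simp
next
  case False
  with \<open>0 \<le> T\<close> have "0 < T" by simp
  obtain Wt W1 W2 where dWt: "\<And>x t. 0 < t \<Longrightarrow> ((\<lambda>s. W x s) has_real_derivative Wt x t) (at t)"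
    and dW1: "\<And>i x t. 0 < t \<Longrightarrow> ((\<lambda>h. W (x + h *\<^sub>R axis i 1) t) has_real_derivative W1 i x t) (at 0)"
    and dW2: "\<And>i x t. 0 < t \<Longrightarrow> ((\<lambda>h. W1 i (x + h *\<^sub>R axis i 1) t) has_real_derivative W2 i x t) (at 0)"
    and super: "\<And>x t. 0 < t \<Longrightarrow> (\<Sum>i\<in>UNIV. W2 i x t) + g (W x t) \<le> Wt x t"
    using W unfolding supersolution_def by blast
  have sol': "solves_heat g u0 (T + 1) u" using sol \<open>0 < T\<close> by simp
  have eq: "\<And>x t. 0 < t \<Longrightarrow> t < T + 1 \<Longrightarrow>
      deriv (\<lambda>s. u x s) t = laplacian (\<lambda>y. u y t) x + g (u x t)"
    and init: "\<And>x. u x 0 = u0 x"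
    and nonneg: "\<And>x t. 0 \<le> t \<Longrightarrow> t < T + 1 \<Longrightarrow> 0 \<le> u x t"
    and u_cont: "continuous_on (UNIV \<times> {0..<T+1}) (\<lambda>(x, t). u x t)"
    using sol' unfolding solves_heat_def by auto
  define N where "N = real CARD('n)"
  define k where "k = L + 1"
  have "0 \<le> C" using nonneg[of 0 0] u_le[of 0 0] \<open>0 < T\<close> by force
  have "0 \<le> L" using g_lipschitz[of 1 0] by (simp add: order_trans[OF abs_ge_zero])
  have main: "exp (- k * T) * (u x T - W x T) \<le> e * (1 + (norm x)\<^sup>2 + 2 * N * T)" if "0 < e" for e
  proof -
    define \<zeta> where "\<zeta> x t = exp (- k * t) * (u x t - W x t) - e * (1 + (norm x)\<^sup>2 + 2 * N * t)" for x t
    define Dt where "Dt x t = - k * exp (- k * t) * (u x t - W x t)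
      + (deriv (\<lambda>s. u x s) t - Wt x t) * exp (- k * t) - 2 * N * e" for x t
    define D1 where "D1 i x t = exp (- k * t) * (partial_deriv i (\<lambda>y. u y t) x - W1 i x t) - e * (2 * x $ i)" for i x t
    define D2 where "D2 i x t = exp (- k * t) * (partial_deriv i (partial_deriv i (\<lambda>y. u y t)) x - W2 i x t) - e * 2" for i x t
    \<comment> \<open>Large enough to contain x and to give e R^2 \<ge> C, using both R \<ge> 1 and
      R \<ge> C / e.\<close>
    define R where "R = norm x + C / e + 1"
    have R: "1 \<le> R" "C / e \<le> R" "norm x \<le> R" using \<open>0 \<le> C\<close> \<open>0 < e\<close> by (auto simp: R_def add_nonneg_nonneg)
    then have "R * 1 \<le> R * R" by (intro mult_left_mono) auto
    then have "e * R \<le> e * R\<^sup>2" using \<open>0 < e\<close> by (simp add: power2_eq_square)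
    moreover have "C \<le> e * R" using R(2) \<open>0 < e\<close> by (simp add: pos_divide_le_eq mult.commute)
    ultimately have CR: "C \<le> e * R\<^sup>2" by simp
    have "\<zeta> x T \<le> 0"
    proof (rule parabolic_maximum_principle[where \<zeta>=\<zeta> and R=R and T=T and Dt=Dt and ?D1.0=D1 and ?D2.0=D2])
      have "continuous_on (cball 0 R \<times> {0..T}) (\<lambda>(x, t). u x t)"
        by (rule continuous_on_subset[OF u_cont]) auto
      moreover have "continuous_on (cball 0 R \<times> {0..T}) (\<lambda>p. W (fst p) (snd p))"
        using W unfolding supersolution_def by (auto elim: continuous_on_subset)
      ultimately show "continuous_on (cball 0 R \<times> {0..T}) (\<lambda>(x, t). \<zeta> x t)"
        unfolding \<zeta>_def case_prod_beta by (intro continuous_intros)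
    next
      fix x :: "real ^ 'n" and t :: real assume xt: "0 < t" "t \<le> T"
      have "t < T + 1" using xt by simp
      note du = solves_heat_has_derivatives[OF sol' xt(1) this]
      have dexp: "((\<lambda>s. exp (- k * s)) has_real_derivative - k * exp (- k * t)) (at t)"
        by (auto intro!: derivative_eq_intros)
      have dlin: "((\<lambda>s. e * (1 + (norm x)\<^sup>2 + 2 * N * s)) has_real_derivative 2 * N * e) (at t)"
        by (auto intro!: derivative_eq_intros)
      show "((\<lambda>s. \<zeta> x s) has_real_derivative Dt x t) (at t)"
        unfolding \<zeta>_def Dt_def
        by (rule DERIV_diff[OF DERIV_mult[OF dexp DERIV_diff[OF du(1) dWt[OF xt(1)]]] dlin])
      show "((\<lambda>h. \<zeta> (x + h *\<^sub>R axis i 1) t) has_real_derivative D1 i x t) (at 0)" for i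
        unfolding \<zeta>_def D1_def
        by (intro DERIV_diff DERIV_cmult du dW1 xt has_real_derivative_radial[where \<phi>="\<lambda>s. e * (1 + s + 2 * N * t)"])
          (auto intro!: derivative_eq_intros)
      have "((\<lambda>h. e * (2 * (x + h *\<^sub>R axis i 1) $ i)) has_real_derivative e * 2) (at 0)" for i
        by (auto intro!: derivative_eq_intros)
      from DERIV_diff[OF DERIV_cmult[OF DERIV_diff[OF du(3) dW2[OF xt(1)]]] this]
      show "((\<lambda>h. D1 i (x + h *\<^sub>R axis i 1) t) has_real_derivative D2 i x t) (at 0)" for i
        unfolding D1_def D2_def .
      assume pos: "0 < \<zeta> x t"
      show "Dt x t < (\<Sum>i\<in>UNIV. D2 i x t)"
      proof -
        define E where "E = exp (- k * t)"
        have "0 < E" by (simp add: E_def)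
        have "0 \<le> N" by (simp add: N_def)
        then have "0 \<le> e * (1 + (norm x)\<^sup>2 + 2 * N * t)"
          using \<open>0 < e\<close> xt by (intro mult_nonneg_nonneg add_nonneg_nonneg) auto
        with pos have "0 < E * (u x t - W x t)" by (simp add: \<zeta>_def E_def)
        then have uW: "0 < u x t - W x t" using \<open>0 < E\<close> by (simp add: zero_less_mult_iff)
        have "(\<Sum>i\<in>UNIV. D2 i x t) = E * (laplacian (\<lambda>y. u y t) x - (\<Sum>i\<in>UNIV. W2 i x t)) - 2 * N * e"
          by (simp add: D2_def sum_subtractf laplacian_def E_def N_def flip: sum_distrib_left)
        moreover have "Dt x t = E * (- k * (u x t - W x t) + laplacian (\<lambda>y. u y t) x + g (u x t) - Wt x t) - 2 * N * e"
          using eq[of t x] xt by (simp add: Dt_def E_def algebra_simps)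
        moreover have "E * (- k * (u x t - W x t) + laplacian (\<lambda>y. u y t) x + g (u x t) - Wt x t)
            < E * (laplacian (\<lambda>y. u y t) x - (\<Sum>i\<in>UNIV. W2 i x t))"
        proof (intro mult_strict_left_mono \<open>0 < E\<close>)
          have "g (u x t) - g (W x t) \<le> L * (u x t - W x t)"
            using g_lipschitz[of "u x t" "W x t"] uW by simp
          moreover have "k * (u x t - W x t) = L * (u x t - W x t) + (u x t - W x t)"
            by (simp add: k_def algebra_simps)
          ultimately show "- k * (u x t - W x t) + laplacian (\<lambda>y. u y t) x + g (u x t) - Wt x t
              < laplacian (\<lambda>y. u y t) x - (\<Sum>i\<in>UNIV. W2 i x t)"
            using super[OF xt(1), of x] uW by simp
        qed
        ultimately show ?thesis by simp
      qed
    next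
      show "\<zeta> x 0 \<le> 0" if "norm x \<le> R" for x
      proof -
        have "0 \<le> e * (1 + (norm x)\<^sup>2)" using \<open>0 < e\<close> by simp
        then show ?thesis using initial[of x] by (simp add: \<zeta>_def init)
      qed
      show "\<zeta> x t \<le> 0" if "norm x = R" "0 \<le> t" "t \<le> T" for x t
      proof -
        have "0 \<le> k * t" using \<open>0 \<le> L\<close> that by (simp add: k_def)
        then have "exp (- k * t) \<le> 1" by simp
        have "exp (- k * t) * (u x t - W x t) \<le> exp (- k * t) * C"
          using u_le[of t x] W_nonneg[of t x] that by (intro mult_left_mono) auto
        also have "\<dots> \<le> 1 * C"
          using \<open>exp (- k * t) \<le> 1\<close> \<open>0 \<le> C\<close> by (rule mult_right_mono)
        also have "\<dots> \<le> e * R\<^sup>2" using CR by simp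
        also have "\<dots> \<le> e * (1 + (norm x)\<^sup>2 + 2 * N * t)"
          using that \<open>0 < e\<close> by (intro mult_left_mono) (auto simp: N_def)
        finally show ?thesis by (simp add: \<zeta>_def)
      qed
    qed (use R \<open>0 < T\<close> in auto)
    then show ?thesis by (simp add: \<zeta>_def)
  qed
  define K where "K = 1 + (norm x)\<^sup>2 + 2 * N * T"
  have "0 < K" using \<open>0 < T\<close> by (simp add: K_def N_def add_pos_nonneg)
  have "exp (- k * T) * (u x T - W x T) \<le> 0 + e" if "0 < e" for e
    using main[of "e / K"] \<open>0 < K\<close> that by (simp add: K_def[symmetric])
  then have "exp (- k * T) * (u x T - W x T) \<le> 0" by (rule field_le_epsilon)
  then show ?thesis by (simp add: mult_le_0_iff)
qed

text \<open>The function \<open>W = 1 / Q\<close> is a supersolution iff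
  \<open>\<Delta> Q - Q\<^sub>t - 2 |\<nabla> Q|\<^sup>2 / Q \<ge> Q\<^sup>2 exp (- Q)\<close>. Below, \<open>s = |x|\<^sup>2\<close>, \<open>m = (2 N + 2) (t + 1)\<close>, and
  \<open>super_exponent1\<close>, \<open>super_exponent2\<close> are the derivatives in \<open>s\<close>. The bounded correction
  \<open>8 * m / (s + m)\<close> is what makes the left-hand side positive also in dimensions 1 and 2.\<close>

definition super_exponent :: "real \<Rightarrow> real \<Rightarrow> real \<Rightarrow> real" where
  "super_exponent A m s = A + ln (s + m) + 2 * ln (A + ln (s + m)) - 8 * m / (s + m)"

definition super_exponent1 :: "real \<Rightarrow> real \<Rightarrow> real \<Rightarrow> real" where
  "super_exponent1 A m s = (1 + 2 / (A + ln (s + m)) + 8 * (m / (s + m))) / (s + m)"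

definition super_exponent2 :: "real \<Rightarrow> real \<Rightarrow> real \<Rightarrow> real" where
  "super_exponent2 A m s = - (1 + 2 / (A + ln (s + m)) + 2 / (A + ln (s + m))\<^sup>2 + 16 * (m / (s + m))) / (s + m)\<^sup>2"

context
  fixes A m s :: real
  assumes A: "4000 \<le> A" and m: "1 \<le> m" and s: "0 \<le> s"
begin

lemma super_log_ge: "A \<le> A + ln (s + m)"
  using m s by simp

lemma super_exponent_bounds:
  "A + ln (s + m) - 8 \<le> super_exponent A m s"
  "super_exponent A m s \<le> A + ln (s + m) + 2 * ln (A + ln (s + m))"
  "super_exponent A m s \<le> 3 * (A + ln (s + m))"
proof -
  have l: "4000 \<le> A + ln (s + m)" using super_log_ge A by simp
  have "m / (s + m) \<le> 1" "0 \<le> m / (s + m)" using m s by auto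
  moreover have "0 \<le> ln (A + ln (s + m))" using l by simp
  moreover have "ln (A + ln (s + m)) \<le> A + ln (s + m)" using ln_bound[of "A + ln (s + m)"] l by simp
  ultimately show "A + ln (s + m) - 8 \<le> super_exponent A m s"
    "super_exponent A m s \<le> A + ln (s + m) + 2 * ln (A + ln (s + m))"
    "super_exponent A m s \<le> 3 * (A + ln (s + m))"
    by (auto simp: super_exponent_def)
qed

lemma super_exponent_pos: "0 < super_exponent A m s" "A - 8 \<le> super_exponent A m s"
  using super_exponent_bounds(1) super_log_ge A by auto

text \<open>\<open>s\<close> and \<open>m\<close> enter through \<open>s + m\<close> alone, except
  in the numerator \<open>8 * m\<close>; that numerator accounts for the extra
  \<open>- 8 / (s + m)\<close> in the derivative in \<open>m\<close>.\<close>

lemma super_exponent_DERIV: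
  "(super_exponent A m has_real_derivative super_exponent1 A m s) (at s)"
  "((\<lambda>m. super_exponent A m s) has_real_derivative super_exponent1 A m s - 8 / (s + m)) (at m)"
  "(super_exponent1 A m has_real_derivative super_exponent2 A m s) (at s)"
proof -
  define \<rho> where "\<rho> = s + m"
  define l where "l = A + ln \<rho>"
  have pos: "0 < \<rho>" "0 < l" "0 < s + m" "0 < A + ln (s + m)"
    using super_log_ge A m s unfolding \<rho>_def l_def by linarith+
  have d1: "((\<lambda>s. ln (s + m)) has_real_derivative 1 / \<rho>) (at s)"
    "((\<lambda>m. ln (s + m)) has_real_derivative 1 / \<rho>) (at m)"
    using pos by (auto intro!: derivative_eq_intros simp: \<rho>_def)
  have d2: "((\<lambda>s. ln (A + ln (s + m))) has_real_derivative 1 / \<rho> / l) (at s)"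
    "((\<lambda>m. ln (A + ln (s + m))) has_real_derivative 1 / \<rho> / l) (at m)"
    using pos by (auto intro!: derivative_eq_intros simp: \<rho>_def l_def)
  have d3: "((\<lambda>s. 8 * m / (s + m)) has_real_derivative - (8 * m / \<rho>\<^sup>2)) (at s)"
    using pos by (auto intro!: derivative_eq_intros simp: \<rho>_def power2_eq_square)
  have "((\<lambda>m. 8 * m / (s + m)) has_real_derivative (8 * (s + m) - 8 * m * 1) / ((s + m) * (s + m))) (at m)"
    by (rule DERIV_divide) (use pos in \<open>auto intro!: derivative_eq_intros\<close>)
  moreover have "(8 * (s + m) - 8 * m * 1) / ((s + m) * (s + m)) = 8 / \<rho> - 8 * m / \<rho>\<^sup>2"
    unfolding \<rho>_def[symmetric] using pos by (simp add: diff_divide_distrib power2_eq_square)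
  ultimately have d3': "((\<lambda>m. 8 * m / (s + m)) has_real_derivative 8 / \<rho> - 8 * m / \<rho>\<^sup>2) (at m)"
    by simp
  have d4: "((\<lambda>s. 2 / (A + ln (s + m))) has_real_derivative - (2 * (1 / \<rho>) / l\<^sup>2)) (at s)"
    using pos by (auto intro!: derivative_eq_intros d1 simp: l_def \<rho>_def power2_eq_square)
  have d5: "((\<lambda>s. 8 * (m / (s + m))) has_real_derivative - (8 * m / \<rho>\<^sup>2)) (at s)"
    using d3 by simp
  have eq: "1 / \<rho> + 2 * (1 / \<rho> / l) + 8 * m / \<rho>\<^sup>2 = super_exponent1 A m s"
    by (simp add: super_exponent1_def \<rho>_def l_def add_divide_distrib power2_eq_square)
  have "((\<lambda>s. A + ln (s + m) + 2 * ln (A + ln (s + m)) - 8 * m / (s + m)) has_real_derivative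
      0 + 1 / \<rho> + 2 * (1 / \<rho> / l) - - (8 * m / \<rho>\<^sup>2)) (at s)"
    by (intro DERIV_diff DERIV_add DERIV_cmult DERIV_const d1 d2 d3)
  then show "(super_exponent A m has_real_derivative super_exponent1 A m s) (at s)"
    unfolding super_exponent_def[abs_def] eq[symmetric] by simp
  have "((\<lambda>m. A + ln (s + m) + 2 * ln (A + ln (s + m)) - 8 * m / (s + m)) has_real_derivative
      0 + 1 / \<rho> + 2 * (1 / \<rho> / l) - (8 / \<rho> - 8 * m / \<rho>\<^sup>2)) (at m)"
    by (intro DERIV_diff DERIV_add DERIV_cmult DERIV_const d1 d2 d3')
  then show "((\<lambda>m. super_exponent A m s) has_real_derivative super_exponent1 A m s - 8 / (s + m)) (at m)"
    unfolding super_exponent_def[abs_def] eq[symmetric] \<rho>_def[symmetric] by (simp add: algebra_simps)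
  have "((\<lambda>s. 1 + 2 / (A + ln (s + m)) + 8 * (m / (s + m))) has_real_derivative
      0 + - (2 * (1 / \<rho>) / l\<^sup>2) + - (8 * m / \<rho>\<^sup>2)) (at s)"
    by (intro DERIV_add DERIV_const d4 d5)
  moreover have "((\<lambda>s. s + m) has_real_derivative 1) (at s)"
    by (auto intro!: derivative_eq_intros)
  ultimately have "((\<lambda>s. (1 + 2 / (A + ln (s + m)) + 8 * (m / (s + m))) / (s + m)) has_real_derivative
      ((0 + - (2 * (1 / \<rho>) / l\<^sup>2) + - (8 * m / \<rho>\<^sup>2)) * (s + m) - (1 + 2 / (A + ln (s + m)) + 8 * (m / (s + m))) * 1)
      / ((s + m) * (s + m))) (at s)"
    by (rule DERIV_divide) (use pos in simp)
  moreover have "((0 + - (2 * (1 / \<rho>) / l\<^sup>2) + - (8 * m / \<rho>\<^sup>2)) * (s + m) - (1 + 2 / (A + ln (s + m)) + 8 * (m / (s + m))) * 1)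
      / ((s + m) * (s + m)) = super_exponent2 A m s"
  proof -
    have 1: "2 * (1 / \<rho>) / l\<^sup>2 * \<rho> = 2 / l\<^sup>2" and 2: "8 * m / \<rho>\<^sup>2 * \<rho> = 8 * (m / \<rho>)"
      using pos by (auto simp: power2_eq_square)
    have "(0 + - (2 * (1 / \<rho>) / l\<^sup>2) + - (8 * m / \<rho>\<^sup>2)) * \<rho> = - (2 / l\<^sup>2) - 8 * (m / \<rho>)"
      unfolding distrib_right mult_minus_left 1 2 by simp
    then show ?thesis
      unfolding super_exponent2_def \<rho>_def[symmetric] l_def[symmetric] power2_eq_square[of \<rho>]
      by (intro arg_cong[where f="\<lambda>r. r / (\<rho> * \<rho>)"]) simp
  qed
  ultimately show "(super_exponent1 A m has_real_derivative super_exponent2 A m s) (at s)"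
    unfolding super_exponent1_def[abs_def] by simp
qed

text \<open>The right-hand side is \<Delta> Q - Q_t - 2 |grad Q|^2 / Q in the variables s and m: the
  Laplacian is 4 s q2 + 2 N q1, the squared gradient is 4 s q1^2, and the time derivative is (2 N +
  2) (q1 - 8 / (s + m)). With p = s / (s + m), every term is 1 / (s + m) times a polynomial in p, up
  to errors in 1 / l and 1 / q that the size of \<open>A\<close> makes small.\<close>

lemma super_exponent_inequality:
  assumes N: "1 \<le> N"
  defines "q \<equiv> super_exponent A m s" and "q1 \<equiv> super_exponent1 A m s" and "q2 \<equiv> super_exponent2 A m s"
  shows "q\<^sup>2 * exp (- q) \<le> (16 * N + 16) / (s + m) - 2 * q1 + 4 * s * q2 - 8 * s * q1\<^sup>2 / q"
proof -
  define \<rho> where "\<rho> = s + m"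
  define l where "l = A + ln \<rho>"
  define p where "p = s / \<rho>"
  define a where "a = 1 / l"
  define b where "b = 1 / q"
  have \<rho>: "0 < \<rho>" using m s by (simp add: \<rho>_def)
  have l: "4000 \<le> l" using super_log_ge A by (simp add: l_def \<rho>_def)
  have q: "l - 8 \<le> q" "q \<le> 3 * l" "2000 \<le> q"
    using super_exponent_bounds l by (auto simp: q_def l_def \<rho>_def)
  have p: "0 \<le> p" "p \<le> 1" "s = p * \<rho>" using m s by (auto simp: p_def \<rho>_def)
  have mp: "m / \<rho> = 1 - p" using \<rho> by (simp add: p_def \<rho>_def field_simps)
  have a: "0 \<le> a" "a \<le> 1 / 4000" using l by (auto simp: a_def field_simps)
  have b: "0 \<le> b" "b \<le> 1 / 2000" using q by (auto simp: b_def field_simps)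
  define X where "X = 1 + 2 * a + 2 * a\<^sup>2 + 16 * (1 - p)"
  define c where "c = 1 + 2 * a + 8 * (1 - p)"
  have q1: "q1 = c / \<rho>"
    by (simp add: q1_def super_exponent1_def \<rho>_def[symmetric] mp l_def[symmetric] a_def c_def)
  have q2: "q2 = - X / \<rho>\<^sup>2"
    by (simp add: X_def q2_def super_exponent2_def \<rho>_def[symmetric] mp l_def[symmetric] a_def power_divide)
  have c: "0 \<le> c" "c \<le> 10" using a p by (auto simp: c_def)
  have "c\<^sup>2 \<le> 10\<^sup>2" using c by (intro power_mono) auto
  then have "p * c\<^sup>2 \<le> 1 * 100" using p by (intro mult_mono) auto
  then have "p * c\<^sup>2 * b \<le> 100 * (1 / 2000)" using b by (intro mult_mono) auto
  then have e1: "8 * (p * c\<^sup>2 * b) \<le> 1 / 2" by simp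
  have "p * a \<le> 1 * (1 / 4000)" using p a by (intro mult_mono) auto
  moreover have "p * a\<^sup>2 \<le> 1 / 4000"
  proof -
    have "(p * a) * a \<le> 1 * (1 / 4000)" using p a by (intro mult_mono) (auto simp: mult_le_one)
    then show ?thesis by (simp add: power2_eq_square)
  qed
  ultimately have e2: "4 * a + 8 * (p * a) + 8 * (p * a\<^sup>2) \<le> 1 / 100" using a by simp
  \<comment> \<open>Completing the square: the minimum over p is 14 - 169/16 = 55/16, above 3. After
    the errors 1/2 and 1/100 there is still more than 2 left.\<close>
  have "0 \<le> 64 * (p - 13 / 32)\<^sup>2" by simp
  then have e3: "3 \<le> 14 - 52 * p + 64 * p\<^sup>2" by (simp add: power2_eq_square algebra_simps)
  have "(16 * N + 16) / \<rho> - 2 * q1 + 4 * s * q2 - 8 * s * q1\<^sup>2 / q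
      = ((16 * N + 16) - 2 * c - 4 * p * X - 8 * (p * c\<^sup>2 * b)) / \<rho>"
  proof -
    have "s * q2 = - p * X / \<rho>"
      using \<rho> by (simp add: q2 p(3) power2_eq_square)
    moreover have "s * q1\<^sup>2 = p * c\<^sup>2 / \<rho>"
      using \<rho> by (simp add: q1 p(3) power2_eq_square)
    moreover have "4 * s * q2 = 4 * (s * q2)" "8 * s * q1\<^sup>2 / q = 8 * (s * q1\<^sup>2) * b"
      by (simp_all add: b_def)
    ultimately show ?thesis
      unfolding q1 by (simp only:) (simp add: diff_divide_distrib add_divide_distrib)
  qed
  also have "\<dots> \<ge> 2 / \<rho>"
  proof (rule divide_right_mono)
    have "(16 * N + 16) - 2 * c - 4 * p * X
        = 16 * (N - 1) + (14 - 52 * p + 64 * p\<^sup>2) - (4 * a + 8 * (p * a) + 8 * (p * a\<^sup>2))"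
      by (simp add: c_def X_def power2_eq_square algebra_simps)
    then show "2 \<le> (16 * N + 16) - 2 * c - 4 * p * X - 8 * (p * c\<^sup>2 * b)"
      using e1 e2 e3 N by simp
  qed (use \<rho> in simp)
  finally have main: "2 / \<rho> \<le> (16 * N + 16) / (s + m) - 2 * q1 + 4 * s * q2 - 8 * s * q1\<^sup>2 / q"
    by (simp add: \<rho>_def)
  \<comment> \<open>The iterated logarithm in the exponent makes exp (- q) carry a factor 1 / l^2,
    which cancels q^2 \<le> 9 l^2. What remains is a multiple of 1 / \<rho> that a large
    \<open>A\<close> makes small.\<close>
  have "q = A + ln \<rho> + 2 * ln l - 8 * (1 - p)"
    by (simp add: q_def super_exponent_def \<rho>_def[symmetric] mp[symmetric] l_def)
  then have "- q = (8 * (1 - p) - A) + - ln \<rho> + - (2 * ln l)" by simp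
  then have "exp (- q) = exp (8 * (1 - p) - A) * exp (- ln \<rho>) * exp (- (2 * ln l))"
    by (simp only: exp_add)
  also have "exp (- ln \<rho>) = 1 / \<rho>" using \<rho> by (simp add: exp_minus inverse_eq_divide)
  also have "exp (- (2 * ln l)) = 1 / l\<^sup>2"
  proof -
    have "2 * ln l = ln (l\<^sup>2)" using l by (simp add: ln_realpow)
    then show ?thesis using l by (simp add: exp_minus inverse_eq_divide)
  qed
  finally have expq: "exp (- q) = exp (8 * (1 - p) - A) / (\<rho> * l\<^sup>2)" by simp
  have "q\<^sup>2 \<le> (3 * l)\<^sup>2" using q by (intro power_mono) auto
  then have "q\<^sup>2 * exp (- q) \<le> (3 * l)\<^sup>2 * exp (- q)" by (intro mult_right_mono) auto
  also have "\<dots> = 9 * exp (8 * (1 - p) - A) / \<rho>"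
    using l by (simp add: expq power_mult_distrib)
  also have "\<dots> \<le> 2 / \<rho>"
  proof (rule divide_right_mono)
    have "5 \<le> exp (A - 8 * (1 - p))"
      using exp_ge_add_one_self[of "A - 8 * (1 - p)"] A p by simp
    then have "1 / exp (A - 8 * (1 - p)) \<le> 1 / 5" by (intro divide_left_mono) auto
    also have "1 / exp (A - 8 * (1 - p)) = exp (8 * (1 - p) - A)"
      by (simp flip: exp_minus inverse_eq_divide)
    finally show "9 * exp (8 * (1 - p) - A) \<le> 2" by simp
  qed (use \<rho> in simp)
  finally show ?thesis using main by simp
qed

end

text \<open>\<open>A\<close> serves two purposes: 4000 feeds the differential inequality, and 1 / M
  forces Q \<ge> A - 8 \<ge> 1 / M, that is W \<le> M. Domination of the datum is checked after
  exponentiating: exp Q at time 0 is at most a constant times (|x|^2 + 1) (ln (|x| + e))^2.\<close>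

lemma supersolution_exists:
  fixes M :: real
  assumes "0 < M"
  obtains W :: "real ^ 'n::finite \<Rightarrow> real \<Rightarrow> real" and c0
  where "0 < c0" and "supersolution (\<lambda>y. exp (- 1 / y)) W"
    and "\<And>x t. 0 \<le> t \<Longrightarrow> 0 < W x t" and "\<And>x t. 0 \<le> t \<Longrightarrow> W x t \<le> M"
    and "\<And>c x. 0 < c \<Longrightarrow> c < c0 \<Longrightarrow> u_init c x \<le> W x 0"
proof -
  define N where "N = real CARD('n)"
  have N: "1 \<le> N" unfolding N_def by (simp add: Suc_leI)
  define A where "A = 4000 + 1 / M"
  have A: "4000 \<le> A" "1 / M \<le> A - 8" using \<open>0 < M\<close> by (auto simp: A_def)
  define b where "b = 2 * N + 2"
  have b: "1 \<le> b" using N by (simp add: b_def)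
  define \<mu> where "\<mu> t = b * (t + 1)" for t
  have \<mu>: "1 \<le> \<mu> t" if "0 \<le> t" for t
    unfolding \<mu>_def using mult_mono[of 1 b 1 "t + 1"] b that by simp
  define q where "q m s = super_exponent A m s" for m s
  define q1 where "q1 m s = super_exponent1 A m s" for m s
  define q2 where "q2 m s = super_exponent2 A m s" for m s
  define W where "W x t = 1 / q (\<mu> t) ((norm x)\<^sup>2)" for x :: "real ^ 'n" and t
  define Wt where "Wt x t = - (q1 (\<mu> t) ((norm x)\<^sup>2) - 8 / ((norm x)\<^sup>2 + \<mu> t)) * b / (q (\<mu> t) ((norm x)\<^sup>2))\<^sup>2"
    for x :: "real ^ 'n" and t
  define \<phi>1 where "\<phi>1 m s = - q1 m s / (q m s)\<^sup>2" for m s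
  define \<phi>2 where "\<phi>2 m s = - q2 m s / (q m s)\<^sup>2 + 2 * (q1 m s)\<^sup>2 / (q m s) ^ 3" for m s
  define W1 where "W1 i x t = \<phi>1 (\<mu> t) ((norm x)\<^sup>2) * (2 * x $ i)" for i and x :: "real ^ 'n" and t
  define W2 where "W2 i x t = \<phi>2 (\<mu> t) ((norm x)\<^sup>2) * (2 * x $ i)\<^sup>2 + 2 * \<phi>1 (\<mu> t) ((norm x)\<^sup>2)"
    for i and x :: "real ^ 'n" and t
  have qpos: "0 < q m s" "A - 8 \<le> q m s" if "1 \<le> m" "0 \<le> s" for m s
    using super_exponent_pos[OF A(1) that] by (auto simp: q_def)
  have dq: "(q m has_real_derivative q1 m s) (at s)"
    "((\<lambda>m. q m s) has_real_derivative q1 m s - 8 / (s + m)) (at m)"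
    "(q1 m has_real_derivative q2 m s) (at s)" if "1 \<le> m" "0 \<le> s" for m s
    using super_exponent_DERIV[OF A(1) that] by (auto simp: q_def[abs_def] q1_def[abs_def] q2_def)
  have d\<phi>: "((\<lambda>s. 1 / q m s) has_real_derivative \<phi>1 m s) (at s)"
    "(\<phi>1 m has_real_derivative \<phi>2 m s) (at s)" if "1 \<le> m" "0 \<le> s" for m s
    unfolding \<phi>1_def[abs_def] \<phi>2_def using qpos[OF that]
    by (auto intro!: derivative_eq_intros dq that simp: power2_eq_square power3_eq_cube field_simps)
  \<comment> \<open>The constant in the comparison at time 0: exp A from the additive
    \<open>A\<close>, b from |x|^2 + b \<le> b (|x|^2 + 1), and the square from l \<le> (A + ln b +
    2) ln (|x| + e). The threshold for c is 1 / K.\<close>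
  define K where "K = exp A * b * (A + ln b + 2)\<^sup>2"
  have lnb: "0 \<le> ln b" using b by simp
  have "0 < A + ln b + 2" using A lnb by linarith
  then have K: "0 < K" unfolding K_def using b by (intro mult_pos_pos) auto
  have ne: "(norm v)\<^sup>2 + b * (t + 1) \<noteq> 0" if "0 \<le> t" for v :: "real^'n" and t
    using \<mu>[OF that] zero_le_power2[of "norm v"] unfolding \<mu>_def by linarith
  have "continuous_on (UNIV \<times> {0..}) (\<lambda>p :: (real^'n) \<times> real. super_exponent A (\<mu> (snd p)) ((norm (fst p))\<^sup>2))"
    unfolding super_exponent_def
  proof (intro continuous_intros)
    show "\<forall>p\<in>UNIV \<times> {0..}. (norm (fst p :: real^'n))\<^sup>2 + \<mu> (snd p) \<noteq> 0"
      using ne by (auto simp: \<mu>_def)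
    show "\<forall>p\<in>UNIV \<times> {0..}. A + ln ((norm (fst p :: real^'n))\<^sup>2 + \<mu> (snd p)) \<noteq> 0"
    proof -
      have "A + ln ((norm v)\<^sup>2 + \<mu> t) \<noteq> 0" if "0 \<le> t" for v :: "real^'n" and t
        using super_log_ge[OF A(1) \<mu>[OF that] zero_le_power2, of "norm v"] A(1) by linarith
      then show ?thesis by auto
    qed
  qed (use ne in \<open>auto simp: \<mu>_def[abs_def] intro!: continuous_intros\<close>)
  moreover have "q (\<mu> (snd p)) ((norm (fst p))\<^sup>2) \<noteq> 0" if "p \<in> UNIV \<times> {0..}" for p :: "(real^'n) \<times> real"
    using qpos(1)[OF \<mu>, of "snd p" "(norm (fst p))\<^sup>2"] that by force
  ultimately have W_cont: "continuous_on (UNIV \<times> {0..}) (\<lambda>p. W (fst p) (snd p))"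
    unfolding W_def q_def by (intro continuous_intros) auto
  have W_deriv: "((\<lambda>s. W x s) has_real_derivative Wt x t) (at t) \<and>
      (\<forall>i. ((\<lambda>h. W (x + h *\<^sub>R axis i 1) t) has_real_derivative W1 i x t) (at 0)) \<and>
      (\<forall>i. ((\<lambda>h. W1 i (x + h *\<^sub>R axis i 1) t) has_real_derivative W2 i x t) (at 0)) \<and>
      (\<Sum>i\<in>UNIV. W2 i x t) + exp (- 1 / W x t) \<le> Wt x t"
    if t: "0 < t" for x t
  proof (intro conjI allI)
    define s where "s = (norm x)\<^sup>2"
    have s: "0 \<le> s" by (simp add: s_def)
    have \<mu>t: "1 \<le> \<mu> t" using \<mu> t by simp
    note qp = qpos[OF \<mu>t s]
    have d\<mu>: "(\<mu> has_real_derivative b) (at t)" unfolding \<mu>_def[abs_def] by (auto intro!: derivative_eq_intros)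
    define X where "X = q1 (\<mu> t) s - 8 / (s + \<mu> t)"
    have "((\<lambda>r. q (\<mu> r) s) has_real_derivative X * b) (at t)"
      unfolding X_def by (rule DERIV_chain2[of "\<lambda>m. q m s" _ \<mu>, OF dq(2)[OF \<mu>t s] d\<mu>])
    then show "((\<lambda>r. W x r) has_real_derivative Wt x t) (at t)"
      unfolding W_def Wt_def s_def[symmetric] X_def[symmetric] using qp
      by (auto intro!: derivative_eq_intros simp: power2_eq_square)
    show "((\<lambda>h. W (x + h *\<^sub>R axis i 1) t) has_real_derivative W1 i x t) (at 0)" for i
      unfolding W_def W1_def by (rule has_real_derivative_radial) (use d\<phi>(1)[OF \<mu>t] in simp)
    show "((\<lambda>h. W1 i (x + h *\<^sub>R axis i 1) t) has_real_derivative W2 i x t) (at 0)" for i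
      unfolding W1_def W2_def by (rule has_real_derivative_radial2) (use d\<phi>(2)[OF \<mu>t] in simp)
    show "(\<Sum>i\<in>UNIV. W2 i x t) + exp (- 1 / W x t) \<le> Wt x t"
    proof -
      define Q where "Q = q (\<mu> t) s"
      define Q1 where "Q1 = q1 (\<mu> t) s"
      define Q2 where "Q2 = q2 (\<mu> t) s"
      have Q: "0 < Q" using qp by (simp add: Q_def)
      have "(\<Sum>i\<in>UNIV. W2 i x t) = 4 * s * \<phi>2 (\<mu> t) s + 2 * N * \<phi>1 (\<mu> t) s"
        by (simp add: W2_def sum.distrib power_mult_distrib s_def N_def sum_power2_eq_norm_power2
            flip: sum_distrib_left)
      also have "\<dots> = (- 4 * s * Q2 + 8 * s * Q1\<^sup>2 / Q - 2 * N * Q1) / Q\<^sup>2"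
        using Q by (simp add: \<phi>1_def \<phi>2_def Q_def[symmetric] Q1_def[symmetric] Q2_def[symmetric]
            power2_eq_square power3_eq_cube field_simps)
      finally have S: "(\<Sum>i\<in>UNIV. W2 i x t) = (- 4 * s * Q2 + 8 * s * Q1\<^sup>2 / Q - 2 * N * Q1) / Q\<^sup>2" .
      have "Q\<^sup>2 * exp (- Q) \<le> (16 * N + 16) / (s + \<mu> t) - 2 * Q1 + 4 * s * Q2 - 8 * s * Q1\<^sup>2 / Q"
        using super_exponent_inequality[OF A(1) \<mu>t s N] by (simp add: Q_def Q1_def Q2_def q_def q1_def q2_def)
      then have "exp (- Q) \<le> ((16 * N + 16) / (s + \<mu> t) - 2 * Q1 + 4 * s * Q2 - 8 * s * Q1\<^sup>2 / Q) / Q\<^sup>2"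
        using Q by (simp add: pos_le_divide_eq mult.commute)
      also have "\<dots> = Wt x t - (\<Sum>i\<in>UNIV. W2 i x t)"
        unfolding S Wt_def s_def[symmetric] Q_def[symmetric] Q1_def[symmetric] b_def
          diff_divide_distrib[symmetric]
        by (rule arg_cong[where f="\<lambda>r. r / Q\<^sup>2"]) (simp add: algebra_simps add_divide_distrib)
      finally show ?thesis using Q by (simp add: W_def s_def[symmetric] Q_def[symmetric])
    qed
  qed
  show ?thesis
  proof (rule that[of "1 / K" W])
    show "0 < 1 / K" using K by simp
    show "supersolution (\<lambda>y. exp (- 1 / y)) W"
      unfolding supersolution_def using W_cont W_deriv by blast
    show "0 < W x t" if "0 \<le> t" for x t using qpos[OF \<mu>[OF that]] by (simp add: W_def)
    show "W x t \<le> M" if "0 \<le> t" for x t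
    proof -
      have "1 / M \<le> q (\<mu> t) ((norm x)\<^sup>2)" using qpos(2)[OF \<mu>[OF that], of "(norm x)\<^sup>2"] A by simp
      then show ?thesis using qpos(1)[OF \<mu>[OF that], of "(norm x)\<^sup>2"] \<open>0 < M\<close>
        by (simp add: W_def field_simps)
    qed
  next
    fix c :: real and x :: "real ^ 'n" assume c: "0 < c" "c < 1 / K"
    define r where "r = norm x"
    have r: "0 \<le> r" by (simp add: r_def)
    define \<rho> where "\<rho> = r\<^sup>2 + b"
    have \<rho>: "1 \<le> \<rho>" using b zero_le_power2[of r] unfolding \<rho>_def by linarith
    define l where "l = A + ln \<rho>"
    have "0 \<le> ln \<rho>" using \<rho> by simp
    then have l: "4000 \<le> l" using A unfolding l_def by linarith
    define e where "e = ln (r + exp 1)"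
    have e: "1 \<le> e" unfolding e_def using r by (subst ln_ge_iff) (auto simp: add_nonneg_pos)
    have "\<rho> \<le> b * (r\<^sup>2 + 1)" using b mult_right_mono[of 1 b "r\<^sup>2"] by (simp add: \<rho>_def algebra_simps)
    have "r\<^sup>2 + 1 \<le> (r + exp 1)\<^sup>2"
    proof -
      have "1 \<le> (exp 1 :: real)\<^sup>2" by simp
      moreover have "0 \<le> 2 * r * exp 1" using r by simp
      ultimately show ?thesis unfolding power2_sum by linarith
    qed
    have "ln \<rho> \<le> ln (b * (r + exp 1)\<^sup>2)"
    proof (subst ln_le_cancel_iff)
      have "b * (r\<^sup>2 + 1) \<le> b * (r + exp 1)\<^sup>2" using \<open>r\<^sup>2 + 1 \<le> _\<close> b by (intro mult_left_mono) auto
      with \<open>\<rho> \<le> _\<close> show "\<rho> \<le> b * (r + exp 1)\<^sup>2" by simp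
      have "0 < r + exp 1" using r by (simp add: add_nonneg_pos)
      then show "0 < b * (r + exp 1)\<^sup>2" using b by simp
    qed (use \<rho> in auto)
    also have "\<dots> = ln b + 2 * e"
    proof -
      have "0 < r + exp 1" using r by (simp add: add_nonneg_pos)
      then show ?thesis using b by (simp add: ln_mult ln_realpow e_def)
    qed
    finally have "l \<le> (A + ln b) * 1 + 2 * e" by (simp add: l_def)
    also have "\<dots> \<le> (A + ln b) * e + 2 * e" using e A lnb by (intro add_right_mono mult_left_mono) auto
    finally have le: "l \<le> (A + ln b + 2) * e" by (simp add: algebra_simps)
    have "q b (r\<^sup>2) \<le> l + 2 * ln l"
      using super_exponent_bounds(2)[OF A(1) b zero_le_power2, of r] by (simp add: q_def l_def \<rho>_def)
    also have "\<dots> = ln (exp A * \<rho> * l\<^sup>2)"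
      using \<rho> l by (simp add: ln_mult ln_realpow l_def)
    also have "\<dots> \<le> ln (K * ((r\<^sup>2 + 1) * e\<^sup>2))"
    proof (subst ln_le_cancel_iff)
      have "l\<^sup>2 \<le> ((A + ln b + 2) * e)\<^sup>2" using le l by (intro power_mono) auto
      then have "exp A * \<rho> * l\<^sup>2 \<le> exp A * (b * (r\<^sup>2 + 1)) * ((A + ln b + 2) * e)\<^sup>2"
        using \<open>\<rho> \<le> _\<close> \<rho> b by (intro mult_mono mult_left_mono) auto
      also have "\<dots> = K * ((r\<^sup>2 + 1) * e\<^sup>2)" by (simp add: K_def power_mult_distrib)
      finally show "exp A * \<rho> * l\<^sup>2 \<le> K * ((r\<^sup>2 + 1) * e\<^sup>2)" .
      have "0 < r\<^sup>2 + 1" by (simp add: add_nonneg_pos)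
      then show "0 < K * ((r\<^sup>2 + 1) * e\<^sup>2)" using K e by simp
    qed (use \<rho> l in auto)
    also have "\<dots> \<le> ln (inverse c * (r\<^sup>2 + 1) * e\<^sup>2 + 1)"
    proof (subst ln_le_cancel_iff)
      have pos: "0 < (r\<^sup>2 + 1) * e\<^sup>2" using e by (simp add: add_nonneg_pos)
      then show "0 < K * ((r\<^sup>2 + 1) * e\<^sup>2)" using K by simp
      show "0 < inverse c * (r\<^sup>2 + 1) * e\<^sup>2 + 1" using pos c by (simp add: add_nonneg_pos)
      have "K \<le> inverse c" using c K by (simp add: field_simps)
      then have "K * ((r\<^sup>2 + 1) * e\<^sup>2) \<le> inverse c * ((r\<^sup>2 + 1) * e\<^sup>2)" using pos by (intro mult_right_mono) auto
      then show "K * ((r\<^sup>2 + 1) * e\<^sup>2) \<le> inverse c * (r\<^sup>2 + 1) * e\<^sup>2 + 1" by (simp add: mult.assoc)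
    qed
    finally have "q b (r\<^sup>2) \<le> ln (inverse c * (r\<^sup>2 + 1) * e\<^sup>2 + 1)" .
    moreover have "0 < q b (r\<^sup>2)" using qpos(1)[OF b] by simp
    ultimately have "1 / ln (inverse c * (r\<^sup>2 + 1) * e\<^sup>2 + 1) \<le> 1 / q b (r\<^sup>2)"
      by (intro divide_left_mono) auto
    then show "u_init c x \<le> W x 0"
      by (simp add: u_init_def W_def \<mu>_def r_def e_def)
  qed
qed

text \<open>Makes \<open>u_init\<close> an admissible datum for \<open>heat_cauchy\<close>. The
  Lipschitz bound comes from the radial profile 1 / ln (Y + 1): since Y' \<le> 2 Y, its slope is at
  most 2 / (ln (Y + 1))^2, and Y \<ge> 1 / c bounds the logarithm below by \<open>l\<close>.\<close>

lemma u_init_properties: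
  fixes x y :: "real ^ 'n::finite"
  assumes "0 < c"
  defines "l \<equiv> ln (inverse c + 1)"
  shows "0 \<le> u_init c x" "u_init c x \<le> 1 / l" "\<bar>u_init c x - u_init c y\<bar> \<le> 2 / l\<^sup>2 * norm (x - y)"
proof -
  define Y where "Y r = inverse c * (r\<^sup>2 + 1) * (ln (r + exp 1))\<^sup>2" for r
  define U where "U r = 1 / ln (Y r + 1)" for r
  have uU: "u_init c x = U (norm x)" for x :: "real ^ 'n" by (simp add: u_init_def U_def Y_def)
  have l: "0 < l" unfolding l_def using \<open>0 < c\<close> by (intro ln_gt_zero) simp
  have e: "1 \<le> ln (r + exp 1)" if "0 \<le> r" for r :: real
    using that by (subst ln_ge_iff) (auto simp: add_nonneg_pos)
  have Y: "inverse c \<le> Y r" if "0 \<le> r" for r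
  proof -
    have "1 * 1 \<le> (r\<^sup>2 + 1) * (ln (r + exp 1))\<^sup>2"
      using e[OF that] by (intro mult_mono) auto
    then have "inverse c * (1 * 1) \<le> inverse c * ((r\<^sup>2 + 1) * (ln (r + exp 1))\<^sup>2)"
      using \<open>0 < c\<close> by (intro mult_left_mono) auto
    then show ?thesis by (simp add: Y_def mult.assoc)
  qed
  have ic: "0 < inverse c" using \<open>0 < c\<close> by simp
  have lY: "l \<le> ln (Y r + 1)" if "0 \<le> r" for r
    unfolding l_def using Y[OF that] ic by (subst ln_le_cancel_iff) linarith+
  show "0 \<le> u_init c x" "u_init c x \<le> 1 / l"
    unfolding uU U_def using lY[of "norm x"] l by (auto intro!: divide_left_mono)
  define Y' where "Y' r = inverse c * (2 * r) * (ln (r + exp 1))\<^sup>2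
    + inverse c * (r\<^sup>2 + 1) * (2 * ln (r + exp 1) / (r + exp 1))" for r
  have dY: "(Y has_real_derivative Y' r) (at r)" if "0 \<le> r" for r
  proof -
    have "0 < r + exp 1" using that by (simp add: add_nonneg_pos)
    then show ?thesis
      unfolding Y_def[abs_def] Y'_def by (auto intro!: derivative_eq_intros simp: power2_eq_square)
  qed
  have dU: "(U has_real_derivative - (Y' r / (Y r + 1)) / (ln (Y r + 1))\<^sup>2) (at r)" if "0 \<le> r" for r
  proof -
    have "0 < Y r + 1" using Y[OF that] ic by linarith
    then have "((\<lambda>r. ln (Y r + 1)) has_real_derivative Y' r / (Y r + 1)) (at r)"
      by (auto intro!: derivative_eq_intros dY[OF that])
    moreover have "0 < ln (Y r + 1)" using lY[OF that] l by simp
    ultimately show ?thesis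
      unfolding U_def[abs_def]
      by (intro DERIV_cong[OF DERIV_divide[OF DERIV_const]]) (auto simp: power2_eq_square)
  qed
  have bound: "norm (- (Y' r / (Y r + 1)) / (ln (Y r + 1))\<^sup>2) \<le> 2 / l\<^sup>2" if "0 \<le> r" for r
  proof -
    define E where "E = ln (r + exp 1)"
    have E: "1 \<le> E" using e[OF that] by (simp add: E_def)
    have "1 + 1 \<le> exp (1::real)" by (rule exp_ge_add_one_self)
    then have re: "2 \<le> r + exp 1" using that by simp
    have "2 * r \<le> r\<^sup>2 + 1" using zero_le_power2[of "r - 1"] by (simp add: power2_eq_square algebra_simps)
    then have "inverse c * (2 * r) * E\<^sup>2 \<le> inverse c * (r\<^sup>2 + 1) * E\<^sup>2"
      using ic by (intro mult_right_mono mult_left_mono) auto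
    moreover have "2 * E / (r + exp 1) \<le> E\<^sup>2"
    proof -
      have "2 * E \<le> (r + exp 1) * E" using re E by (intro mult_right_mono) auto
      also have "\<dots> \<le> (r + exp 1) * E\<^sup>2" using re E by (intro mult_left_mono) (auto simp: power2_eq_square)
      finally show ?thesis using re by (simp add: pos_divide_le_eq mult.commute)
    qed
    then have "inverse c * (r\<^sup>2 + 1) * (2 * E / (r + exp 1)) \<le> inverse c * (r\<^sup>2 + 1) * E\<^sup>2"
      using ic by (intro mult_left_mono) auto
    ultimately have "Y' r \<le> 2 * Y r" by (simp add: Y'_def Y_def E_def)
    moreover have "0 \<le> Y r" using Y[OF that] ic by linarith
    ultimately have "Y' r / (Y r + 1) \<le> 2" by (simp add: divide_le_eq)
    moreover have "0 \<le> Y' r"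
      unfolding Y'_def E_def[symmetric] using that E re ic by (intro add_nonneg_nonneg mult_nonneg_nonneg) auto
    moreover have "l\<^sup>2 \<le> (ln (Y r + 1))\<^sup>2" using lY[OF that] l by (intro power_mono) auto
    ultimately have "(Y' r / (Y r + 1)) / (ln (Y r + 1))\<^sup>2 \<le> 2 / l\<^sup>2"
      using l \<open>0 \<le> Y r\<close> by (intro frac_le) auto
    then show ?thesis using \<open>0 \<le> Y' r\<close> \<open>0 \<le> Y r\<close> by simp
  qed
  have "norm (U (norm x) - U (norm y)) \<le> 2 / l\<^sup>2 * norm (norm x - norm y)"
    by (rule field_differentiable_bound[where S="{0..}" and f'="\<lambda>r. - (Y' r / (Y r + 1)) / (ln (Y r + 1))\<^sup>2"])
      (use dU bound in \<open>auto intro: has_field_derivative_at_within\<close>)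
  also have "\<dots> \<le> 2 / l\<^sup>2 * norm (x - y)"
    using norm_triangle_ineq3[of x y] by (intro mult_left_mono) auto
  finally show "\<bar>u_init c x - u_init c y\<bar> \<le> 2 / l\<^sup>2 * norm (x - y)" by (simp add: uU)
qed

section \<open>Blow-up for large data\<close>

text \<open>The bump vanishes on the unit sphere, where \<open>u\<close> is nonnegative. It is
  squared because 1 - |x|^2 itself has negative Laplacian where it vanishes, a defect no decay rate
  in time can repair; the square has positive Laplacian near the sphere.\<close>

lemma nonneg_solution_lower_bound:
  fixes u :: "real ^ 'n::finite \<Rightarrow> real \<Rightarrow> real"
  assumes sol: "solves_heat f u0 T u" and "1 < T"
    and f: "\<And>y. 0 \<le> y \<Longrightarrow> 0 \<le> f y"
    and "0 < m" and u0: "\<And>x. norm x \<le> 1 \<Longrightarrow> m \<le> u0 x"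
    and x: "norm x \<le> 1" and t: "0 \<le> t" "t \<le> 1"
  defines "k \<equiv> (real CARD('n) + 2)\<^sup>2"
  shows "m * exp (- k * t) * (1 - (norm x)\<^sup>2)\<^sup>2 \<le> u x t"
proof -
  define \<zeta> where "\<zeta> x t = m * exp (- k * t) * (1 - (norm x)\<^sup>2)\<^sup>2 - u x t" for x t
  define Dt where "Dt x t = - k * (m * exp (- k * t)) * (1 - (norm x)\<^sup>2)\<^sup>2 - deriv (\<lambda>s. u x s) t" for x t
  define D1 where "D1 i x t = m * exp (- k * t) * (-2 * (1 - (norm x)\<^sup>2)) * (2 * x $ i)
      - partial_deriv i (\<lambda>y. u y t) x" for i x t
  define D2 where "D2 i x t = m * exp (- k * t) * 2 * (2 * x $ i)\<^sup>2
      + 2 * (m * exp (- k * t) * (-2 * (1 - (norm x)\<^sup>2)))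
      - partial_deriv i (partial_deriv i (\<lambda>y. u y t)) x" for i x t
  have cont: "continuous_on (UNIV \<times> {0..<T}) (\<lambda>(x, t). u x t)"
    and nonneg: "\<And>x t. 0 \<le> t \<Longrightarrow> t < T \<Longrightarrow> 0 \<le> u x t"
    and init: "\<And>x. u x 0 = u0 x"
    and eq: "\<And>x t. 0 < t \<Longrightarrow> t < T \<Longrightarrow>
      deriv (\<lambda>s. u x s) t = laplacian (\<lambda>y. u y t) x + f (u x t)"
    using sol unfolding solves_heat_def by auto
  have "\<zeta> x t \<le> 0"
  proof (rule parabolic_maximum_principle[where \<zeta>=\<zeta> and R=1 and T=1 and Dt=Dt and ?D1.0=D1 and ?D2.0=D2])
    have "continuous_on (cball 0 1 \<times> {0..1}) (\<lambda>(x, t). u x t)"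
      by (rule continuous_on_subset[OF cont]) (use \<open>1 < T\<close> in auto)
    then show "continuous_on (cball 0 1 \<times> {0..1}) (\<lambda>(x, t). \<zeta> x t)"
      unfolding \<zeta>_def case_prod_beta by (intro continuous_intros)
  next
    fix x :: "real ^ 'n" and t :: real assume xt: "norm x < 1" "0 < t" "t \<le> 1"
    have "t < T" using xt \<open>1 < T\<close> by simp
    note du = solves_heat_has_derivatives[OF sol xt(2) this]
    show "((\<lambda>s. \<zeta> x s) has_real_derivative Dt x t) (at t)"
      unfolding \<zeta>_def Dt_def
      by (auto intro!: derivative_eq_intros du)
    show "((\<lambda>h. \<zeta> (x + h *\<^sub>R axis i 1) t) has_real_derivative D1 i x t) (at 0)" for i
      unfolding \<zeta>_def D1_def
      by (intro DERIV_diff du has_real_derivative_radial[where \<phi>="\<lambda>s. m * exp (- k * t) * (1 - s)\<^sup>2"])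
        (use xt \<open>1 < T\<close> in \<open>auto intro!: derivative_eq_intros simp: algebra_simps\<close>)
    show "((\<lambda>h. D1 i (x + h *\<^sub>R axis i 1) t) has_real_derivative D2 i x t) (at 0)" for i
      unfolding D1_def D2_def
      by (intro DERIV_diff du has_real_derivative_radial2[where \<phi>'="\<lambda>s. m * exp (- k * t) * (-2 * (1 - s))"])
        (use xt \<open>1 < T\<close> in \<open>auto intro!: derivative_eq_intros simp: algebra_simps\<close>)
    show "Dt x t < (\<Sum>i\<in>UNIV. D2 i x t)"
    proof -
      define E where "E = m * exp (- k * t)"
      define a where "a = 1 - (norm x)\<^sup>2"
      define N where "N = real CARD('n)"
      have "E > 0" using \<open>0 < m\<close> by (simp add: E_def)
      have "(\<Sum>i\<in>UNIV. D2 i x t) = 8 * E * (norm x)\<^sup>2 - 4 * N * E * a - laplacian (\<lambda>y. u y t) x"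
      proof -
        have "D2 i x t = 8 * E * (x $ i)\<^sup>2 + (- 4 * E * a)
            - partial_deriv i (partial_deriv i (\<lambda>y. u y t)) x" for i
          by (simp add: D2_def E_def a_def power2_eq_square algebra_simps)
        then show ?thesis
          by (simp add: sum.distrib sum_subtractf sum_negf laplacian_def N_def
              sum_power2_eq_norm_power2 flip: sum_distrib_left)
      qed
      moreover have "Dt x t = - k * E * a\<^sup>2 - laplacian (\<lambda>y. u y t) x - f (u x t)"
        using eq[of t x] xt \<open>1 < T\<close> by (simp add: Dt_def E_def a_def)
      moreover have "0 \<le> f (u x t)" using f nonneg xt \<open>1 < T\<close> by simp
      moreover have "0 < E * (k * a\<^sup>2 - (4 * N + 8) * a + 8)"
      proof -
        \<comment> \<open>The rate \<open>k\<close> is chosen so that this quadratic in a = 1 -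
          |x|^2 is a square plus 4.\<close>
        have "k * a\<^sup>2 - (4 * N + 8) * a + 8 = ((N + 2) * a - 2)\<^sup>2 + 4"
          by (simp add: k_def N_def power2_eq_square algebra_simps)
        also have "\<dots> > 0" by (simp add: add_nonneg_pos)
        finally show ?thesis using \<open>E > 0\<close> by simp
      qed
      moreover have "(norm x)\<^sup>2 = 1 - a" by (simp add: a_def)
      ultimately show ?thesis by (simp add: algebra_simps)
    qed
  next
    show "\<zeta> x 0 \<le> 0" if "norm x \<le> 1" for x
    proof -
      have "(1 - (norm x)\<^sup>2)\<^sup>2 \<le> 1"
        using that by (simp add: power_le_one)
      then show ?thesis using u0[OF that] \<open>0 < m\<close> unfolding \<zeta>_def init
        by (smt (verit, best) exp_zero mult_eq_0_iff mult_le_cancel_left1 mult_cancel_left1)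
    qed
    show "\<zeta> x t \<le> 0" if "norm x = 1" "0 \<le> t" "t \<le> 1" for x t
      using nonneg[of t x] that \<open>1 < T\<close> by (simp add: \<zeta>_def)
  qed (use x t in auto)
  then show ?thesis by (simp add: \<zeta>_def)
qed

text \<open>The total mass of \<open>1 / f\<close> is written as a supremum of integrals over bounded intervals, which
  avoids improper integrals.\<close>

lemma nonlinearity_tail_function:
  assumes nl: "nonlinearity d f f' f''"
  obtains F where "\<And>y. 1 \<le> y \<Longrightarrow> (F has_real_derivative - 1 / f y) (at y)"
    "\<And>y. 1 \<le> y \<Longrightarrow> 0 < F y" "\<And>e. 0 < e \<Longrightarrow> \<exists>y\<ge>1. F y < e"
proof -
  \<comment> \<open>Clamping at 1/4 keeps the argument of \<open>f\<close> positive and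
    \<open>g\<close> continuous on the line. The gap between 1/4 and 1/2 leaves room for two-sided
    derivatives of \<Phi> from 1/2 on.\<close>
  define g where "g x = 1 / f (max x (1/4))" for x
  have fpos: "0 < f y" if "0 < y" for y
    using nl that unfolding nonlinearity_def by auto
  have gpos: "0 < g x" for x unfolding g_def using fpos[of "max x (1/4)"] by simp
  have contf: "continuous_on {0<..} f"
    using nonlinearity_has_derivative[OF nl]
    by (intro continuous_at_imp_continuous_on) (auto intro: DERIV_isCont)
  have contg: "continuous_on UNIV g"
    unfolding g_def
  proof (intro continuous_intros continuous_on_compose2[OF contf])
    show "\<forall>x\<in>UNIV. f (max x (1 / 4)) \<noteq> 0" using fpos by (metis max.strict_coboundedI2 less_irrefl zero_less_divide_1_iff zero_less_numeral)
  qed (auto simp: less_max_iff_disj)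
  define \<Phi> where "\<Phi> y = integral {1/4..y} g" for y
  have \<Phi>': "(\<Phi> has_real_derivative g y) (at y)" if "1/4 < y" for y
  proof -
    have "(\<Phi> has_real_derivative g y) (at y within {1/4..y+1})"
      unfolding \<Phi>_def
      by (rule integral_has_real_derivative) (use that contg in \<open>auto intro: continuous_on_subset\<close>)
    moreover have "at y within {1/4..y+1} = at y"
      using that by (intro at_within_interior) auto
    ultimately show ?thesis by simp
  qed
  define C where "C = enn2real (\<integral>\<^sup>+s\<in>{1/2..}. ennreal (1 / f s) \<partial>lborel)"
  have bound: "\<Phi> y \<le> \<Phi> (1/2) + C" if "1/2 \<le> y" for y
  proof -
    have fin: "(\<integral>\<^sup>+s\<in>{1/2..}. ennreal (1 / f s) \<partial>lborel) < \<infinity>"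
      using nl unfolding nonlinearity_def by auto
    have "(\<integral>\<^sup>+x. ennreal (g x) * indicator {1/2..y} x \<partial>lborel) = \<Phi> y - \<Phi> (1/2)"
      by (rule nn_integral_FTC_Icc)
        (use \<Phi>' gpos that contg in \<open>auto intro: less_imp_le borel_measurable_continuous_onI has_field_derivative_at_within\<close>)
    moreover have "(\<integral>\<^sup>+x. ennreal (g x) * indicator {1/2..y} x \<partial>lborel)
        \<le> (\<integral>\<^sup>+s\<in>{1/2..}. ennreal (1 / f s) \<partial>lborel)"
      by (intro nn_integral_mono) (auto simp: indicator_def g_def max_def)
    ultimately have "ennreal (\<Phi> y - \<Phi> (1/2)) \<le> ennreal C"
      using fin by (simp add: C_def)
    then show ?thesis by (simp add: C_def)
  qed
  define L where "L = (SUP y\<in>{1/2..}. \<Phi> y)"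
  have bdd: "bdd_above (\<Phi> ` {1/2..})" using bound by (auto intro!: bdd_aboveI)
  have mono: "\<Phi> y < \<Phi> z" if "1/2 \<le> y" "y < z" for y z
  proof (rule DERIV_pos_imp_increasing[OF that(2)])
    fix w assume "y \<le> w" "w \<le> z"
    then have "1/4 < w" using that by simp
    then show "\<exists>D. (\<Phi> has_real_derivative D) (at w) \<and> 0 < D"
      using \<Phi>' gpos by blast
  qed
  show ?thesis
  proof (rule that[of "\<lambda>y. L - \<Phi> y"])
    fix y :: real assume y: "1 \<le> y"
    show "((\<lambda>y. L - \<Phi> y) has_real_derivative - 1 / f y) (at y)"
      using \<Phi>'[of y] y by (auto intro!: derivative_eq_intros simp: g_def max_def)
    have "\<Phi> y < \<Phi> (y + 1)" using y by (intro mono) auto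
    also have "\<dots> \<le> L" unfolding L_def using y by (intro cSUP_upper bdd) auto
    finally show "0 < L - \<Phi> y" by simp
  next
    fix e :: real assume "0 < e"
    then have "L - e < L" by simp
    then obtain y where y: "1/2 \<le> y" "L - e < \<Phi> y"
      unfolding L_def using less_cSUP_iff[OF _ bdd] by auto
    have "\<Phi> y < \<Phi> (y + 1)" using y by (intro mono) auto
    then show "\<exists>y\<ge>1. L - \<Phi> y < e"
      using y by (intro exI[of _ "y + 1"]) auto
  qed
qed

text \<open>ln (1 + Y / c) \<le> Y / c, and on the unit ball Y \<le> 2 * 2^2 = 8.\<close>

lemma u_init_lower_bound:
  fixes x :: "real ^ 'n::finite"
  assumes "0 < c" "norm x \<le> 1"
  shows "c / 8 \<le> u_init c x"
proof -
  have e: "exp (1::real) \<le> 3" by (rule exp_le)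
  have e1: "1 \<le> exp (1::real)" by simp
  have "ln (norm x + exp 1) \<le> ln (exp 2)"
  proof (subst ln_le_cancel_iff)
    have "norm x + exp 1 \<le> 4" using e assms by simp
    also have "(4::real) \<le> exp 1 * exp 1"
    proof -
      have "(2::real) \<le> exp 1" using exp_ge_add_one_self[of 1] by simp
      then show ?thesis using mult_mono[of 2 "exp 1" 2 "exp (1::real)"] by simp
    qed
    also have "\<dots> = exp (2::real)" by (simp flip: exp_add)
    finally show "norm x + exp 1 \<le> exp 2" .
  qed (auto simp: add_nonneg_pos)
  then have l: "ln (norm x + exp 1) \<le> 2" by simp
  have l0: "1 \<le> ln (norm x + exp 1)"
    by (subst ln_ge_iff) (auto simp: add_nonneg_pos)
  define Y where "Y = ((norm x)\<^sup>2 + 1) * (ln (norm x + exp 1))\<^sup>2"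
  have "(ln (norm x + exp 1))\<^sup>2 \<le> 2\<^sup>2" by (rule power_mono[OF l]) (use l0 in auto)
  moreover have "(norm x)\<^sup>2 + 1 \<le> 2" using assms by (simp add: power_le_one)
  ultimately have "Y \<le> 2 * 2\<^sup>2" unfolding Y_def by (intro mult_mono) auto
  have "0 < Y" unfolding Y_def using l0
    by (intro mult_pos_pos add_nonneg_pos) auto
  have "ln (Y / c + 1) \<le> Y / c"
    using ln_add_one_self_le_self[of "Y / c"] \<open>0 < Y\<close> assms by (simp add: add.commute)
  also have "\<dots> \<le> 8 / c" using \<open>Y \<le> _\<close> assms by (intro divide_right_mono) auto
  finally have "ln (Y / c + 1) \<le> 8 / c" .
  moreover have "0 < ln (Y / c + 1)" using \<open>0 < Y\<close> assms by (intro ln_gt_zero) auto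
  ultimately have "1 / (8 / c) \<le> 1 / ln (Y / c + 1)" by (intro divide_left_mono) (use assms in auto)
  moreover have "inverse c * ((norm x)\<^sup>2 + 1) * (ln (norm x + exp 1))\<^sup>2 = Y / c"
    unfolding Y_def by (simp only: divide_inverse mult_ac)
  ultimately show ?thesis
    unfolding u_init_def by simp
qed

text \<open>The barrier for F u is A |x|^2 + e - t / 2 on the ball of radius 1/2 up to time 2 e. It
  starts above e, which bounds F u throughout, and it reaches 0 at the centre exactly at the final
  time.\<close>

lemma no_global_solution_if_large:
  assumes nl: "nonlinearity d f f' f''"
  obtains m0 where "0 < m0"
    "\<And>u0 (u :: real ^ 'n::finite \<Rightarrow> real \<Rightarrow> real).
      (\<And>x. norm x \<le> 1 \<Longrightarrow> m0 \<le> u0 x) \<Longrightarrow> \<not> global_solution f u0 u"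
proof -
  obtain F where F': "\<And>y. 1 \<le> y \<Longrightarrow> (F has_real_derivative - 1 / f y) (at y)"
    and Fpos: "\<And>y. 1 \<le> y \<Longrightarrow> 0 < F y" and Flim: "\<And>e. 0 < e \<Longrightarrow> \<exists>y\<ge>1. F y < e"
    using nonlinearity_tail_function[OF nl] by metis
  define N where "N = real CARD('n)"
  have N: "1 \<le> N" unfolding N_def by (simp add: Suc_leI)
  \<comment> \<open>1 / (32 N) is the value of A |x|^2 on the sphere of radius 1/2; being above e,
    it keeps the barrier above F u there until time 2 e. It also gives 2 e \<le> 1, the range of the
    lower bound for \<open>u\<close>.\<close>
  obtain M where M: "1 \<le> M" "F M < 1 / (32 * N)" using Flim[of "1 / (32 * N)"] N by auto
  define e where "e = F M"
  have e: "0 < e" "e < 1 / (32 * N)" using M Fpos by (auto simp: e_def)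
  have "1 / (32 * N) \<le> 1 / 32" using N by (simp add: divide_simps)
  then have e2: "2 * e \<le> 1" using e by simp
  have fpos: "0 < f y" if "0 < y" for y
    using nl that unfolding nonlinearity_def by auto
  have f'pos: "0 < f' y" if "0 < y" for y
    using nl that unfolding nonlinearity_def by auto
  have f0: "f 0 = 0" using nl unfolding nonlinearity_def by auto
  have fnn: "0 \<le> f y" if "0 \<le> y" for y
    using fpos[of y] f0 that by (cases "y = 0") auto
  define k where "k = (N + 2)\<^sup>2"
  \<comment> \<open>Compensates the worst values of the bump for |x| \<le> 1/2 and t \<le> 1, namely
    exp (- k) and (3/4)^2, so that \<open>u\<close> is at least \<open>M\<close> there.\<close>
  define m0 where "m0 = M * exp k * (16 / 9)"
  have "0 < m0" using M by (simp add: m0_def)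
  moreover have "\<not> global_solution f u0 u" if u0: "\<And>x. norm x \<le> 1 \<Longrightarrow> m0 \<le> u0 x"
    for u0 and u :: "real ^ 'n \<Rightarrow> real \<Rightarrow> real"
  proof
    assume "global_solution f u0 u"
    then have sol: "solves_heat f u0 2 u" unfolding global_solution_def by auto
    have uM: "M \<le> u x t" if "norm x \<le> 1/2" "0 \<le> t" "t \<le> 1" for x t
    proof -
      have "M = m0 * exp (- k) * (1 - 1/4 - 0)\<^sup>2 "
        by (simp add: m0_def power2_eq_square exp_minus field_simps)
      also have "\<dots> \<le> m0 * exp (- k * t) * (1 - (norm x)\<^sup>2)\<^sup>2"
      proof (intro mult_mono power_mono)
        have "(norm x)\<^sup>2 \<le> (1/2)\<^sup>2" using that by (intro power_mono) auto
        then show "1 - 1/4 - 0 \<le> 1 - (norm x)\<^sup>2" by (simp add: power2_eq_square)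
        have "k * t \<le> k * 1" using that by (intro mult_left_mono) (auto simp: k_def)
        then show "exp (- k) \<le> exp (- k * t)" by simp
      qed (use \<open>0 < m0\<close> in auto)
      also have "\<dots> \<le> u x t"
        using nonneg_solution_lower_bound[OF sol _ fnn \<open>0 < m0\<close> u0, of x t] that
        by (simp add: k_def N_def)
      finally show ?thesis .
    qed
    have Fu: "F (u x t) \<le> e" if "norm x \<le> 1/2" "0 \<le> t" "t \<le> 1" for x t
      unfolding e_def
    proof (rule DERIV_nonpos_imp_nonincreasing[OF uM[OF that]])
      fix y assume "M \<le> y" "y \<le> u x t"
      then have "1 \<le> y" using M by simp
      then show "\<exists>z. (F has_real_derivative z) (at y) \<and> z \<le> 0"
        using F'[of y] fpos[of y] by (intro exI[of _ "- 1 / f y"]) auto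
    qed
    \<comment> \<open>The Laplacian of A |x|^2 is 1/4. Together with the slope -1/2 in time it uses
      up 3/4 of the unit decay of F u, so the inequality stays strict.\<close>
    define A where "A = 1 / (8 * N)"
    define \<zeta> where "\<zeta> x t = F (u x t) - (A * (norm x)\<^sup>2 + e - t / 2)" for x t
    define Dt where "Dt x t = (- 1 / f (u x t)) * deriv (\<lambda>s. u x s) t + 1/2" for x t
    define D1 where "D1 i x t = (- 1 / f (u x t)) * partial_deriv i (\<lambda>y. u y t) x - A * (2 * x $ i)" for i x t
    define D2 where "D2 i x t = (- 1 / f (u x t)) * partial_deriv i (partial_deriv i (\<lambda>y. u y t)) x
      + f' (u x t) / (f (u x t))\<^sup>2 * (partial_deriv i (\<lambda>y. u y t) x)\<^sup>2 - 2 * A" for i x t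
    have cont: "continuous_on (UNIV \<times> {0..<2}) (\<lambda>(x, t). u x t)"
      and eq: "\<And>x t. 0 < t \<Longrightarrow> t < 2 \<Longrightarrow>
        deriv (\<lambda>s. u x s) t = laplacian (\<lambda>y. u y t) x + f (u x t)"
      using sol unfolding solves_heat_def by auto
    have "\<zeta> 0 (2 * e) \<le> 0"
    proof (rule parabolic_maximum_principle[where \<zeta>=\<zeta> and R="1/2" and T="2*e" and Dt=Dt and ?D1.0=D1 and ?D2.0=D2])
      have "continuous_on (cball 0 (1/2) \<times> {0..2*e}) (\<lambda>(x, t). u x t)"
        by (rule continuous_on_subset[OF cont]) (use e2 in auto)
      moreover have "continuous_on {1..} F"
        using F' by (intro continuous_at_imp_continuous_on) (auto intro: DERIV_isCont)
      moreover have "1 \<le> u x t" if "norm x \<le> 1/2" "0 \<le> t" "t \<le> 2 * e" for x t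
        using uM[of x t] that e2 M by simp
      ultimately have "continuous_on (cball 0 (1/2) \<times> {0..2*e}) (\<lambda>p. F (u (fst p) (snd p)))"
        unfolding case_prod_beta by (rule_tac continuous_on_compose2[of "{1..}" F]) auto
      then show "continuous_on (cball 0 (1/2) \<times> {0..2*e}) (\<lambda>(x, t). \<zeta> x t)"
        unfolding \<zeta>_def case_prod_beta by (auto intro!: continuous_intros)
    next
      fix x :: "real ^ 'n" and t :: real assume xt: "norm x < 1/2" "0 < t" "t \<le> 2 * e"
      have t2: "t < 2" "t \<le> 1" using xt e2 by auto
      have u1: "1 \<le> u x t" using uM[of x t] xt t2 M by simp
      have fp: "0 < f (u x t)" and f'p: "0 < f' (u x t)" using fpos f'pos u1 by auto
      note du = solves_heat_has_derivatives[OF sol xt(2) t2(1)]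
      have "((\<lambda>s. F (u x s)) has_real_derivative (- 1 / f (u x t)) * deriv (\<lambda>s. u x s) t) (at t)"
        by (rule DERIV_chain2[of F _ "\<lambda>s. u x s"]) (use F'[OF u1] du in auto)
      then show "((\<lambda>s. \<zeta> x s) has_real_derivative Dt x t) (at t)"
        unfolding \<zeta>_def Dt_def by (auto intro!: derivative_eq_intros)
      show "((\<lambda>h. \<zeta> (x + h *\<^sub>R axis i 1) t) has_real_derivative D1 i x t) (at 0)" for i
      proof -
        have 1: "((\<lambda>h. F (u (x + h *\<^sub>R axis i 1) t)) has_real_derivative
            (- 1 / f (u x t)) * partial_deriv i (\<lambda>y. u y t) x) (at 0)"
          by (rule DERIV_chain2[of F _ "\<lambda>h. u (x + h *\<^sub>R axis i 1) t"]) (use F'[OF u1] du in auto)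
        have 2: "((\<lambda>h. A * (norm (x + h *\<^sub>R axis i 1))\<^sup>2 + e - t/2) has_real_derivative A * (2 * x $ i)) (at 0)"
          by (rule has_real_derivative_radial[where \<phi>="\<lambda>s. A * s + e - t / 2"])
            (auto intro!: derivative_eq_intros)
        show ?thesis unfolding \<zeta>_def D1_def by (rule DERIV_diff[OF 1 2])
      qed
      show "((\<lambda>h. D1 i (x + h *\<^sub>R axis i 1) t) has_real_derivative D2 i x t) (at 0)" for i
      proof -
        have f1: "((\<lambda>h. f (u (x + h *\<^sub>R axis i 1) t)) has_real_derivative
            f' (u x t) * partial_deriv i (\<lambda>y. u y t) x) (at 0)"
          by (rule DERIV_chain2[of f _ "\<lambda>h. u (x + h *\<^sub>R axis i 1) t"])
            (use nonlinearity_has_derivative[OF nl, of "u x t"] u1 du in auto)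
        show ?thesis unfolding D1_def D2_def
          by (auto intro!: derivative_eq_intros f1 du) (use fp in \<open>auto simp: field_simps power2_eq_square\<close>)
      qed
      show "Dt x t < (\<Sum>i\<in>UNIV. D2 i x t)"
      proof -
        have "Dt x t = - laplacian (\<lambda>y. u y t) x / f (u x t) - 1/2"
          unfolding Dt_def using eq[OF xt(2) t2(1)] fp by (simp add: field_simps)
        also have "\<dots> < - laplacian (\<lambda>y. u y t) x / f (u x t) - 1/4" by simp
        also have "\<dots> = (\<Sum>i\<in>UNIV. (- 1 / f (u x t)) * partial_deriv i (partial_deriv i (\<lambda>y. u y t)) x - 2 * A)"
          using N by (simp add: laplacian_def sum_subtractf sum_divide_distrib sum_negf A_def N_def)
        also have "\<dots> \<le> (\<Sum>i\<in>UNIV. D2 i x t)"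
          unfolding D2_def using f'p by (intro sum_mono) auto
        finally show ?thesis .
      qed
    next
      show "\<zeta> x 0 \<le> 0" if "norm x \<le> 1/2" for x
      proof -
        have "0 \<le> A * (norm x)\<^sup>2" using N by (simp add: A_def)
        then show ?thesis using Fu[of x 0] that by (simp add: \<zeta>_def)
      qed
      show "\<zeta> x t \<le> 0" if "norm x = 1/2" "0 \<le> t" "t \<le> 2 * e" for x t
      proof -
        have A: "A * (norm x)\<^sup>2 = 1 / (32 * N)" by (simp only: A_def that(1)) (simp add: power2_eq_square)
        show ?thesis using Fu[of x t] that e2 e unfolding \<zeta>_def A by simp
      qed
    qed (use e in auto)
    then have "F (u 0 (2 * e)) \<le> 0" by (simp add: \<zeta>_def)
    moreover have "1 \<le> u 0 (2 * e)" using uM[of 0 "2 * e"] M e e2 by simp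
    ultimately show False using Fpos[of "u 0 (2 * e)"] by simp
  qed
  ultimately show ?thesis using that by blast
qed

section \<open>The dichotomy\<close>

lemma nonlinearity_lipschitz:
  assumes nl: "nonlinearity d f f' f''" and "0 < M"
  obtains L where "0 < L" "\<And>y z. y \<in> {0..M} \<Longrightarrow> z \<in> {0..M} \<Longrightarrow> \<bar>f y - f z\<bar> \<le> L * \<bar>y - z\<bar>"
proof -
  have df: "\<And>y. 0 \<le> y \<Longrightarrow> (f has_real_derivative f' y) (at y within {0..})"
    and f'_cont: "continuous_on {0..} f'"
    using nl unfolding nonlinearity_def C1_C2_halfline_def by auto
  have "continuous_on {0..M} f'" by (rule continuous_on_subset[OF f'_cont]) auto
  then have "bounded (f' ` {0..M})" by (intro compact_imp_bounded compact_continuous_image) auto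
  then obtain L where L: "0 < L" "\<And>y. y \<in> {0..M} \<Longrightarrow> norm (f' y) \<le> L"
    unfolding bounded_pos by auto
  have df': "(f has_real_derivative f' y) (at y within {0..M})" if "y \<in> {0..M}" for y
    by (rule has_field_derivative_subset[OF df]) (use that in auto)
  have "norm (f y - f z) \<le> L * norm (y - z)" if "y \<in> {0..M}" "z \<in> {0..M}" for y z
    by (rule field_differentiable_bound[where S="{0..M}" and f'=f', OF _ df']) (use that L in auto)
  with L(1) show ?thesis using that by auto
qed

lemma global_solution_if_small:
  fixes f f' f'' :: "real \<Rightarrow> real"
  assumes "0 < d" and nl: "nonlinearity d f f' f''"
  obtains c0 where "0 < c0"
    "\<And>c. 0 < c \<Longrightarrow> c < c0 \<Longrightarrow> \<exists>u :: real ^ 'n::finite \<Rightarrow> real \<Rightarrow> real.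
      global_solution f (u_init c) u \<and> bounded_on_strips u"
proof -
  \<comment> \<open>Strictly below \<open>d\<close>, so that on the range of \<open>W\<close> the
    truncated nonlinearity is exactly exp (- 1 / y).\<close>
  define M where "M = d / 2"
  have M: "0 < M" "M < d" using \<open>0 < d\<close> by (auto simp: M_def)
  obtain L where L: "0 < L"
    and f_lip: "\<And>y z. y \<in> {0..M} \<Longrightarrow> z \<in> {0..M} \<Longrightarrow> \<bar>f y - f z\<bar> \<le> L * \<bar>y - z\<bar>"
    using nonlinearity_lipschitz[OF nl M(1)] by metis
  have f0: "f 0 = 0" and fpos: "\<And>y. 0 < y \<Longrightarrow> 0 < f y"
    and fexp: "\<And>y. 0 < y \<Longrightarrow> y < d \<Longrightarrow> f y = exp (- 1 / y)"
    using nl unfolding nonlinearity_def by auto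
  \<comment> \<open>The clamp is 1-Lipschitz, so \<open>g\<close> is Lipschitz on the whole line
    with the constant of \<open>f\<close> on [0, M]; with f 0 = 0 this also yields the upper bound L
    M.\<close>
  define g where "g y = f (min (max y 0) M)" for y
  have clamp: "min (max y 0) M \<in> {0..M}" for y using M by auto
  have g_eq: "g y = f y" if "0 \<le> y" "y \<le> M" for y using that by (simp add: g_def)
  have g_nonneg: "0 \<le> g y" for y
  proof -
    have "0 \<le> f r" if "r \<in> {0..M}" for r
      using fpos[of r] f0 that by (cases "r = 0") auto
    then show ?thesis using clamp unfolding g_def by blast
  qed
  have g_le: "g y \<le> L * M" for y
  proof -
    have "g y \<le> L * \<bar>min (max y 0) M - 0\<bar>"
      using f_lip[OF clamp[of y], of 0] f0 M by (simp add: g_def)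
    also have "\<dots> \<le> L * M" using L clamp[of y] by (intro mult_left_mono) auto
    finally show ?thesis .
  qed
  have g_lip: "\<bar>g y - g z\<bar> \<le> L * \<bar>y - z\<bar>" for y z
  proof -
    have "\<bar>g y - g z\<bar> \<le> L * \<bar>min (max y 0) M - min (max z 0) M\<bar>"
      unfolding g_def by (rule f_lip[OF clamp clamp])
    also have "\<dots> \<le> L * \<bar>y - z\<bar>" using L M by (intro mult_left_mono) auto
    finally show ?thesis .
  qed
  obtain W :: "real ^ 'n \<Rightarrow> real \<Rightarrow> real" and c0 where "0 < c0"
    and W_super: "supersolution (\<lambda>y. exp (- 1 / y)) W"
    and W: "\<And>x t. 0 \<le> t \<Longrightarrow> 0 < W x t" "\<And>x t. 0 \<le> t \<Longrightarrow> W x t \<le> M"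
    and W_init: "\<And>c x. 0 < c \<Longrightarrow> c < c0 \<Longrightarrow> u_init c x \<le> W x 0"
    by (rule supersolution_exists[OF M(1), where 'n='n]) (rule that)
  have "g (W x t) = exp (- 1 / W x t)" if "0 < t" for x t
    using W[of t x] that M by (simp add: g_eq fexp)
  with W_super have W_super: "supersolution g W"
    by (simp add: supersolution_def cong: conj_cong)
  have "\<exists>u :: real ^ 'n \<Rightarrow> real \<Rightarrow> real. global_solution f (u_init c) u \<and> bounded_on_strips u"
    if c: "0 < c" "c < c0" for c
  proof -
    define l where "l = ln (inverse c + 1)"
    interpret heat_cauchy g "L * M" L "u_init c :: real ^ 'n \<Rightarrow> real" "1 / l" "2 / l\<^sup>2"
      using L g_nonneg g_le g_lip u_init_properties[OF c(1)] by unfold_locales (auto simp: l_def)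
    obtain u :: "real ^ 'n \<Rightarrow> real \<Rightarrow> real" where sol: "\<And>T. 0 < T \<Longrightarrow> solves_heat g (u_init c) T u"
      and u_bound: "\<And>x t. 0 \<le> t \<Longrightarrow> u x t \<le> 1 / l + t * (L * M)"
      using classical_solution by blast
    have "u x T \<le> W x T" if "0 \<le> T" for x T
    proof (rule solution_le_supersolution[OF sol _ g_lip W_super _ W_init[OF c] that])
      show "u x t \<le> 1 / l + T * (L * M)" if "0 \<le> t" "t \<le> T" for x t
      proof -
        have "t * (L * M) \<le> T * (L * M)" using that L M by (intro mult_right_mono) auto
        then show ?thesis using u_bound[OF that(1), of x] by simp
      qed
      show "0 \<le> W x t" if "0 \<le> t" for x t using W(1)[OF that] by (rule less_imp_le)
    qed
    then have u_le: "u x t \<le> M" if "0 \<le> t" for x t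
      using W(2)[OF that, of x] that order_trans by blast
    have u_nonneg: "0 \<le> u x t" if "0 \<le> t" for x t
      using sol[of "t + 1"] that unfolding solves_heat_def by auto
    have "solves_heat f (u_init c) T u" if "0 < T" for T
      using sol[OF that] u_le u_nonneg unfolding solves_heat_def by (auto simp: g_eq)
    then have "global_solution f (u_init c) u" by (simp add: global_solution_def)
    moreover have "bounded_on_strips u"
      unfolding bounded_on_strips_def bounded_iff
      using u_le u_nonneg by (auto intro!: exI[of _ M])
    ultimately show ?thesis by blast
  qed
  with \<open>0 < c0\<close> show ?thesis by (rule that)
  have "g (W x t) = exp (- 1 / W x t)" if "0 < t" for x t
    using W[of t x] that M by (simp add: g_eq fexp)
  with W_super have W_super: "supersolution g W"
    by (simp add: supersolution_def cong: conj_cong)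
qed

theorem theorem5p1:
  fixes f f' f'' :: "real \<Rightarrow> real" and d :: real
  assumes "0 < d" and "d \<le> 1"
    and "nonlinearity d f f' f''"
  shows "\<exists>c0 c1. 0 < c0 \<and> c0 \<le> c1 \<and>
    (\<forall>c. 0 < c \<and> c < c0 \<longrightarrow>
       (\<exists>u :: real ^ 'n::finite \<Rightarrow> real \<Rightarrow> real.
          global_solution f (u_init c) u \<and> bounded_on_strips u)) \<and>
    (\<forall>c. c > c1 \<longrightarrow>
       \<not> (\<exists>u :: real ^ 'n::finite \<Rightarrow> real \<Rightarrow> real. global_solution f (u_init c) u))"
proof -
  obtain c0 where c0: "0 < c0"
    "\<And>c. 0 < c \<Longrightarrow> c < c0 \<Longrightarrow> \<exists>u :: real ^ 'n \<Rightarrow> real \<Rightarrow> real.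
      global_solution f (u_init c) u \<and> bounded_on_strips u"
    using global_solution_if_small[OF assms(1,3)] by metis
  obtain m0 where m0: "0 < m0"
    "\<And>u0 (u :: real ^ 'n \<Rightarrow> real \<Rightarrow> real).
      (\<And>x. norm x \<le> 1 \<Longrightarrow> m0 \<le> u0 x) \<Longrightarrow> \<not> global_solution f u0 u"
    using no_global_solution_if_large[OF assms(3)] by metis
  \<comment> \<open>8 m0 turns the bound c / 8 on the unit ball into m0; the maximum with c0 secures
    c0 \<le> c1.\<close>
  have "\<not> (\<exists>u :: real ^ 'n \<Rightarrow> real \<Rightarrow> real. global_solution f (u_init c) u)"
    if "max c0 (8 * m0) < c" for c
  proof -
    have "m0 \<le> u_init c x" if "norm x \<le> 1" for x :: "real ^ 'n"
      using u_init_lower_bound[of c x] that \<open>max c0 (8 * m0) < c\<close> \<open>0 < c0\<close> by simp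
    then show ?thesis using m0(2) by blast
  qed
  with c0 show ?thesis by (intro exI[of _ c0] exI[of _ "max c0 (8 * m0)"]) auto
qed

end
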